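(* Let the ideal $J\subset R'$ define a zero-dimensional scheme $\mathfrak Z=\operatorname{Spec}(R'/J)$ concentrated at the origin, and let $\alpha=\alpha(\mathfrak Z)$ be the socle degree of $R'/J$. Let $L'=J^{-1}\subset\Gamma'$ be the affine inverse system of $\mathfrak Z$, and set $I=\operatorname{Homog}(J,z)\subset R$, $A=R/I$, $L=\operatorname{Homog}(L',Z)=\bigoplus_i L'[i]\subset\Gamma$. Then: (i) $I=I_{\mathfrak Z}$, and is a saturated ideal primary to the ideal $m_p=(x_1,\dots,x_n)$ of $p=(0:\dots:0:1)\in\mathbb P^n$, and it satisfies $m_p\supset I\supset m_p^{\alpha+1}$. In particular, $I_a=(I_b:R_{b-a})$ for $a\le b$, and $I_b=R_{b-a}I_a$ for $b\ge a\ge\alpha(\mathfrak Z)$. Furthermore, if $a\le b$, then $I_a=(I_b:z^{b-a})$, and if $b\ge\alpha$ we have $I_b=z^{b-\alpha}\cdot I_\alpha+(m_p^{\alpha+1})_b$. (ii) $L=L_{\mathfrak Z}$ and satisfies $L_a=z^{b-a}\circ L_b$ for $a\le b$, and $k_{DP}[Z]\subset L\subset\Gamma_{\le\alpha}\cdot k_{DP}[Z]$. Furthermore, for $\alpha\le a\le b$ the map $F\mapsto F[b]$ taking $L_a$ to $L_b$, and the map $z^{b-a}\circ:L_b\to L_a$, are inverse isomorphisms. Also, $L$ satisfies $L_b=L_a[b]$ for any pair $(a,b)$ satisfying $a\ge\alpha$. (iii) For $a\le b$, multiplication by $z^{b-a}$, $A_a\to A_b$, is injective, and furthermore it defines an isomorphism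 $A_a\cong A_b$ for $\alpha\le a\le b$. In particular, for an integer $m>0$, multiplication by $z^m$ is an injection $A_{\alpha-m}\to A_\alpha$, and is an isomorphism $A_\alpha\to A_{\alpha+m}$ onto. (iv) Let $\dim_k R'/J=s$. The subscheme $\mathfrak Z=\operatorname{Proj}(A)$ of $\mathbb P^n$ has degree $s$, and $J\supset M'^s$, where $M'=(y_1,\dots,y_n)$. Furthermore, the regularity $\sigma(\mathfrak Z)$ satisfies $\sigma(\mathfrak Z)=\tau(\mathfrak Z)+1\le\alpha+1\le s$. (v) Let $\mathfrak L\subset\Gamma$ be an inverse system satisfying $k_{DP}[Z]\subset\mathfrak L\subset\Gamma_{\le\alpha}\cdot k_{DP}[Z]$, and let $\mathfrak I=\operatorname{Ann}(\mathfrak L)$. Then, letting $\mathfrak J=\mathfrak I_{(z=1)}\subset R'$, and $\mathfrak L'=(\mathfrak L_b)_{Z=1}$, $b\ge\alpha$, we have that $\mathfrak L'=\mathfrak J^{-1}$, and $\mathfrak J$ defines a scheme $\mathfrak Z$ (in this part $\mathfrak Z$ denotes this scheme) concentrated at the origin with $\mathfrak I=I_{\mathfrak Z}$, $\mathfrak L=L_{\mathfrak Z}$, $\alpha(\mathfrak Z)\le\alpha$, and $\mathfrak L=\operatorname{Homog}(\mathfrak L',Z)$.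
   Context: $k$ is a field which is algebraically closed (or all support points are rational), of characteristic $0$ or larger than the degree of every form considered. $R=k[x_1,\dots,x_n,z]$ ($z=x_{n+1}$) is the coordinate ring of $\mathbb P^n$; $\Gamma=k_{DP}[X_1,\dots,X_n,Z]$ ($Z=X_{n+1}$) is the divided power ring with product $X^{[U]}X^{[V]}=\binom{U+V}{U}X^{[U+V]}$; $R$ acts on $\Gamma$ by contraction $x^K\circ X^{[U]}=X^{[U-K]}$ ($0$ if an exponent is negative). An inverse system in $\Gamma$ is a graded $R$-submodule of $\Gamma$; its annihilator is the graded ideal $\operatorname{Ann}(W)$ of $R$ whose degree-$j$ part is $\{h\in R_j:h\circ w=0\ \forall w\in W\}$. For a graded ideal $I$, $I^{-1}$ is the graded submodule of $\Gamma$ annihilated by $I$. A graded ideal is saturated if it has no component primary to the irrelevant ideal $(x_1,\dots,x_n,z)$. $R'=k[y_1,\dots,y_n]$ is the coordinate ring of $\mathbb A^n=\{z\ne0\}$ ($y_i=x_i/z$), $\Gamma'=k_{DP}[Y_1,\dots,Y_n]$ with the contraction action of $R'$, and for an ideal $J$ of $R'$ concentrated at the origin, $J^{-1}=\{f\in\Gamma':h\circ f=0\ \forall h\in J\}$. $\operatorname{Homog}(J,z)$ is the ideal generated by all $z^uh(x_1/z,\dots,x_n/z)$ with $h\in J$, $u\ge\deg h$. For $f=\sum_i f_i\in\Gamma'$, $f_i\in\Gamma'_i$, $f[u]=\operatorname{Homog}(f,Z,u)=\sum_{0\le i\le u}f_i(X_1,\dots,X_n)Z^{[u-i]}$; $L'[u]$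 is the span of the $f[u]$, $f\in L'$, and $\operatorname{Homog}(L',Z)=\bigoplus_{u\ge0}L'[u]$. For $F\in\Gamma_a$ and $b\ge0$, $F[b]\in\Gamma_b$ is obtained by replacing, in each monomial term, the factor $Z^{[u]}$ by $Z^{[u+b-a]}$ (terms with negative exponent become $0$), and $L_a[b]=\{F[b]:F\in L_a\}$. $(\cdot)_{z=1}$ sets $z=1$, $x_i=y_i$; $(\cdot)_{Z=1}$ replaces every $Z^{[u]}$ by $1$ and $X_i$ by $Y_i$. $I_{\mathfrak Z}$ is the saturated ideal of $\mathfrak Z\subset\mathbb P^n$, $L_{\mathfrak Z}=(I_{\mathfrak Z})^{-1}$. The socle degree $\alpha(\mathfrak Z)$ is the largest $i$ with $\mathfrak m^i\neq0$ in the local ring of $\mathfrak Z$. $\tau(\mathfrak Z)=\min\{i:\dim_k(R/I_{\mathfrak Z})_i=\deg\mathfrak Z\}$, and $\sigma(\mathfrak Z)$ is the Castelnuovo–Mumford regularity of $\mathfrak Z$.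
   Formalization: In (i), I_b=R_{b-a}I_a is stated for b≥a≥α+1 (false at a=α for J=(y_1,…,y_n)); in (v), all conclusions except concentration at the origin and α(Z)≤α also assume 𝔏_a=z^{b-a}∘𝔏_b for a≤b (false without it: n=α=1, 𝔏=k_DP[Z]+⟨X⟩). *)

theory Defs
  imports Complex_Main "HOL-Library.Poly_Mapping" "HOL-Library.Set_Algebras"
begin

section \<open>Polynomials, divided powers, gradings\<close>

text \<open>The affine variables are indexed by a finite type \<open>'n\<close>, the homogeneous coordinates by
  \<open>'n option\<close>: \<open>Some i\<close> is the index of \<open>x\<^sub>i\<close> (or \<open>X\<^sub>i\<close>) and \<open>None\<close> that of \<open>z\<close> (or \<open>Z\<close>).
  The same carrier serves for polynomials and for divided powers: as a polynomial, \<open>single U c\<close>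
  is \<open>c x^U\<close>, and \<open>*\<close> is the product; as a divided power element it is \<open>c X^[U]\<close>, and the product
  is \<open>dp_mult\<close>, never \<open>*\<close>.\<close>

type_synonym ('v, 'k) mpoly = "('v \<Rightarrow>\<^sub>0 nat) \<Rightarrow>\<^sub>0 'k"
type_synonym ('v, 'k) dpow = "('v \<Rightarrow>\<^sub>0 nat) \<Rightarrow>\<^sub>0 'k"

definition const :: "'k::zero \<Rightarrow> ('v, 'k) mpoly" where
  "const c = Poly_Mapping.single 0 c"

definition var :: "'v \<Rightarrow> ('v, 'k::field) mpoly" where
  "var v = Poly_Mapping.single (Poly_Mapping.single v 1) 1"

abbreviation z_var :: "('n option, 'k::field) mpoly" where
  "z_var \<equiv> var None"

definition kscale :: "'k::field \<Rightarrow> ('e \<Rightarrow>\<^sub>0 'k) \<Rightarrow> ('e \<Rightarrow>\<^sub>0 'k)" where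
  "kscale c f = Poly_Mapping.map ((*) c) f"

text \<open>The exponents are natural numbers, or integers in the case of Laurent polynomials.\<close>

definition mdeg :: "('v::finite \<Rightarrow>\<^sub>0 'd::comm_monoid_add) \<Rightarrow> 'd" where
  "mdeg m = (\<Sum>v\<in>UNIV. Poly_Mapping.lookup m v)"

definition hom_part :: "'d::comm_monoid_add \<Rightarrow> (('v::finite \<Rightarrow>\<^sub>0 'd) \<Rightarrow>\<^sub>0 'k::field) set" where
  "hom_part d = {f. \<forall>m\<in>Poly_Mapping.keys f. mdeg m = d}"

definition hom_component :: "nat \<Rightarrow> ('v::finite, 'k::field) mpoly \<Rightarrow> ('v, 'k) mpoly" where
  "hom_component d f = (\<Sum>m\<in>{m \<in> Poly_Mapping.keys f. mdeg m = d}.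
     Poly_Mapping.single m (Poly_Mapping.lookup f m))"

definition graded :: "('v::finite, 'k::field) mpoly set \<Rightarrow> bool" where
  "graded V \<longleftrightarrow> (\<forall>f\<in>V. \<forall>d. hom_component d f \<in> V)"

definition piece :: "('v::finite, 'k::field) mpoly set \<Rightarrow> nat \<Rightarrow> ('v, 'k) mpoly set" where
  "piece V d = V \<inter> hom_part d"

definition total_deg :: "('v::finite, 'k::field) mpoly \<Rightarrow> nat" where
  "total_deg h = Max (insert 0 (mdeg ` Poly_Mapping.keys h))"

definition dp_mult :: "('v::finite, 'k::field) dpow \<Rightarrow> ('v, 'k) dpow \<Rightarrow> ('v, 'k) dpow" where
  "dp_mult F G = (\<Sum>U\<in>Poly_Mapping.keys F. \<Sum>V\<in>Poly_Mapping.keys G.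
     Poly_Mapping.single (U + V)
       (of_nat (\<Prod>v\<in>UNIV. (Poly_Mapping.lookup U v + Poly_Mapping.lookup V v) choose Poly_Mapping.lookup U v)
          * Poly_Mapping.lookup F U * Poly_Mapping.lookup G V))"

definition contract :: "('v, 'k::field) mpoly \<Rightarrow> ('v, 'k) dpow \<Rightarrow> ('v, 'k) dpow" where
  "contract h F = (\<Sum>K\<in>Poly_Mapping.keys h. \<Sum>U\<in>Poly_Mapping.keys F.
     if \<forall>v. Poly_Mapping.lookup K v \<le> Poly_Mapping.lookup U v
     then Poly_Mapping.single (U - K) (Poly_Mapping.lookup h K * Poly_Mapping.lookup F U)
     else 0)"

text \<open>\<open>dp_Z\<close> is \<open>k\<^sub>D\<^sub>P[Z]\<close>; \<open>dp_subspace_mult V W\<close> is the space spanned by the products.\<close>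

definition dp_Z :: "('n::finite option, 'k::field) dpow set" where
  "dp_Z = {F. \<forall>m\<in>Poly_Mapping.keys F. \<forall>i. Poly_Mapping.lookup m (Some i) = 0}"

definition dp_le :: "nat \<Rightarrow> ('v::finite, 'k::field) dpow set" where
  "dp_le d = {F. \<forall>m\<in>Poly_Mapping.keys F. mdeg m \<le> d}"

definition dp_subspace_mult ::
  "('v::finite, 'k::field) dpow set \<Rightarrow> ('v, 'k) dpow set \<Rightarrow> ('v, 'k) dpow set" where
  "dp_subspace_mult V W = module.span kscale {dp_mult F G | F G. F \<in> V \<and> G \<in> W}"


section \<open>Ideals\<close>

abbreviation is_ideal :: "'r::comm_ring_1 set \<Rightarrow> bool" where
  "is_ideal \<equiv> module.subspace (*)"

abbreviation ideal_gen :: "'r::comm_ring_1 set \<Rightarrow> 'r set" where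
  "ideal_gen \<equiv> module.span (*)"

definition ideal_mult :: "'r::comm_ring_1 set \<Rightarrow> 'r set \<Rightarrow> 'r set" where
  "ideal_mult I J = ideal_gen {a * b | a b. a \<in> I \<and> b \<in> J}"

primrec ideal_power :: "'r::comm_ring_1 set \<Rightarrow> nat \<Rightarrow> 'r set" where
  "ideal_power I 0 = UNIV"
| "ideal_power I (Suc k) = ideal_mult I (ideal_power I k)"

definition radical :: "'r::comm_ring_1 set \<Rightarrow> 'r set" where
  "radical I = {f. \<exists>k. f ^ k \<in> I}"

definition prime_ideal :: "'r::comm_ring_1 set \<Rightarrow> bool" where
  "prime_ideal P \<longleftrightarrow> is_ideal P \<and> P \<noteq> UNIV \<and> (\<forall>a b. a * b \<in> P \<longrightarrow> a \<in> P \<or> b \<in> P)"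

definition primary_ideal :: "'r::comm_ring_1 set \<Rightarrow> bool" where
  "primary_ideal Q \<longleftrightarrow>
     is_ideal Q \<and> Q \<noteq> UNIV \<and> (\<forall>a b. a * b \<in> Q \<longrightarrow> a \<in> Q \<or> b \<in> radical Q)"

definition primary_decomposition :: "'r::comm_ring_1 set \<Rightarrow> 'r set set \<Rightarrow> bool" where
  "primary_decomposition I D \<longleftrightarrow>
     finite D \<and> (\<forall>Q\<in>D. primary_ideal Q) \<and> \<Inter>D = I \<and>
     inj_on radical D \<and> (\<forall>Q\<in>D. \<not> \<Inter>(D - {Q}) \<subseteq> Q)"

text \<open>The ideal of all variables: the irrelevant ideal of \<open>R\<close>, and the maximal ideal \<open>M'\<close> of the
  origin in \<open>R'\<close>.\<close>

definition var_ideal :: "('v::finite, 'k::field) mpoly set" where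
  "var_ideal = ideal_gen (range var)"

text \<open>\<open>m_p\<close>, the ideal of the point \<open>(0 : \<dots> : 0 : 1)\<close>.\<close>

definition point_ideal :: "('n::finite option, 'k::field) mpoly set" where
  "point_ideal = ideal_gen (range (\<lambda>i. var (Some i)))"

text \<open>In the Noetherian ring \<open>R\<close> irredundant primary decompositions exist, and the radicals of
  their components do not depend on the decomposition.\<close>

definition saturated :: "('v::finite, 'k::field) mpoly set \<Rightarrow> bool" where
  "saturated I \<longleftrightarrow> is_ideal I \<and> graded I \<and>
     (\<forall>D. primary_decomposition I D \<longrightarrow> (\<forall>Q\<in>D. radical Q \<noteq> var_ideal))"


section \<open>Homogenization and dehomogenization\<close>

definition ext_mono :: "('n::finite \<Rightarrow>\<^sub>0 nat) \<Rightarrow> nat \<Rightarrow> ('n option \<Rightarrow>\<^sub>0 nat)" where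
  "ext_mono m e = Poly_Mapping.Abs_poly_mapping
     (\<lambda>v. case v of None \<Rightarrow> e | Some i \<Rightarrow> Poly_Mapping.lookup m i)"

text \<open>For \<open>u \<ge> deg h\<close> this is \<open>z^u h(x\<^sub>1/z, \<dots>, x\<^sub>n/z)\<close>; on divided powers it is \<open>f[u]\<close>, where the
  terms of degree larger than \<open>u\<close> are dropped.\<close>

definition homogenize :: "nat \<Rightarrow> ('n::finite, 'k::field) mpoly \<Rightarrow> ('n option, 'k) mpoly" where
  "homogenize u f = (\<Sum>m\<in>{m \<in> Poly_Mapping.keys f. mdeg m \<le> u}.
     Poly_Mapping.single (ext_mono m (u - mdeg m)) (Poly_Mapping.lookup f m))"

text \<open>On polynomials this sets \<open>z = 1\<close>; on divided powers it replaces every \<open>Z^[u]\<close> by 1.\<close>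

definition dehomogenize :: "('n::finite option, 'k::field) mpoly \<Rightarrow> ('n, 'k) mpoly" where
  "dehomogenize F = (\<Sum>m\<in>Poly_Mapping.keys F.
     Poly_Mapping.single (Poly_Mapping.map_key Some m) (Poly_Mapping.lookup F m))"

definition Homog_ideal :: "('n::finite, 'k::field) mpoly set \<Rightarrow> ('n option, 'k) mpoly set" where
  "Homog_ideal J = ideal_gen {homogenize u h | u h. h \<in> J \<and> total_deg h \<le> u}"

definition Homog_part :: "('n::finite, 'k::field) dpow set \<Rightarrow> nat \<Rightarrow> ('n option, 'k) dpow set" where
  "Homog_part L' u = module.span kscale (homogenize u ` L')"

text \<open>The internal direct sum of the subspaces \<open>Homog_part L' u\<close> of the graded pieces.\<close>

definition Homog_dp :: "('n::finite, 'k::field) dpow set \<Rightarrow> ('n option, 'k) dpow set" where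
  "Homog_dp L' = {F. \<forall>u. hom_component u F \<in> Homog_part L' u}"

text \<open>\<open>Z_shift a b F\<close> is \<open>F[b]\<close> for \<open>F\<close> homogeneous of degree \<open>a\<close>.\<close>

definition Z_shift :: "nat \<Rightarrow> nat \<Rightarrow> ('n option, 'k::field) dpow \<Rightarrow> ('n option, 'k) dpow" where
  "Z_shift a b F = (\<Sum>m\<in>{m \<in> Poly_Mapping.keys F. a \<le> Poly_Mapping.lookup m None + b}.
     Poly_Mapping.single (Poly_Mapping.update None (Poly_Mapping.lookup m None + b - a) m)
       (Poly_Mapping.lookup F m))"


section \<open>Inverse systems\<close>

definition inverse_system :: "('v::finite, 'k::field) dpow set \<Rightarrow> bool" where
  "inverse_system W \<longleftrightarrow> module.subspace contract W \<and> graded W"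

definition Ann :: "('v::finite, 'k::field) dpow set \<Rightarrow> ('v, 'k) mpoly set" where
  "Ann W = {h. \<forall>j. \<forall>w\<in>W. contract (hom_component j h) w = 0}"

text \<open>\<open>I\<^sup>-\<^sup>1\<close>, for graded ideals of \<open>R\<close> as well as for ideals of \<open>R'\<close>.\<close>

definition perp :: "('v, 'k::field) mpoly set \<Rightarrow> ('v, 'k) dpow set" where
  "perp I = {F. \<forall>h\<in>I. contract h F = 0}"


section \<open>Zero-dimensional schemes\<close>

text \<open>\<open>Spec(R'/J)\<close> consists of the single point \<open>M'\<close>; in particular it is not empty.\<close>

definition concentrated_at_origin :: "('n::finite, 'k::field) mpoly set \<Rightarrow> bool" where
  "concentrated_at_origin J \<longleftrightarrow> is_ideal J \<and> {P. prime_ideal P \<and> J \<subseteq> P} = {var_ideal}"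

text \<open>The scheme being concentrated at the origin, \<open>R'/J\<close> is its local ring, with maximal ideal
  \<open>M'/J\<close>, whose \<open>i\<close>-th power is nonzero iff \<open>M'^i\<close> is not contained in \<open>J\<close>.\<close>

definition socle_degree :: "('n::finite, 'k::field) mpoly set \<Rightarrow> nat" where
  "socle_degree J = (GREATEST i. \<not> ideal_power var_ideal i \<subseteq> J)"

text \<open>\<open>I\<^sub>\<ZZ>\<close> for a closed subscheme \<open>\<ZZ> = Spec(R'/J)\<close> of projective space contained in the chart
  \<open>z \<noteq> 0\<close>: the ideal generated by the forms vanishing on \<open>\<ZZ>\<close>, that is, by the global sections
  of all twists of the ideal sheaf of \<open>\<ZZ>\<close>.\<close>

definition scheme_ideal :: "('n::finite, 'k::field) mpoly set \<Rightarrow> ('n option, 'k) mpoly set" where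
  "scheme_ideal J = ideal_gen {F. (\<exists>d. F \<in> hom_part d) \<and> dehomogenize F \<in> J}"

definition Proj_points :: "('v::finite, 'k::field) mpoly set \<Rightarrow> ('v, 'k) mpoly set set" where
  "Proj_points I = {P. prime_ideal P \<and> graded P \<and> I \<subseteq> P \<and> \<not> var_ideal \<subseteq> P}"

text \<open>\<open>Proj(R/I)\<close> and \<open>Spec(R'/J)\<close> are the same subscheme of projective space: the former has no
  point on the hyperplane \<open>z = 0\<close>, and on the chart \<open>z \<noteq> 0\<close> it is defined by \<open>J\<close>.\<close>

definition Proj_eq_Spec ::
  "('n::finite option, 'k::field) mpoly set \<Rightarrow> ('n, 'k) mpoly set \<Rightarrow> bool" where
  "Proj_eq_Spec I J \<longleftrightarrow> is_ideal I \<and> graded I \<and>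
     dehomogenize ` I = J \<and> (\<forall>P\<in>Proj_points I. z_var \<notin> P)"

text \<open>\<open>basis_mod V W B\<close>: the classes of the elements of \<open>B\<close> are distinct and form a basis of \<open>V/W\<close>.
  The dimension \<open>dim_quot V W\<close> of \<open>V/W\<close> is 0 if \<open>V/W\<close> is infinite-dimensional.\<close>

definition basis_mod :: "('e \<Rightarrow>\<^sub>0 'k::field) set \<Rightarrow> ('e \<Rightarrow>\<^sub>0 'k) set \<Rightarrow> ('e \<Rightarrow>\<^sub>0 'k) set \<Rightarrow> bool" where
  "basis_mod V W B \<longleftrightarrow> B \<subseteq> V \<and>
     (\<forall>S c. finite S \<and> S \<subseteq> B \<and> (\<Sum>b\<in>S. kscale (c b) b) \<in> W \<longrightarrow> (\<forall>b\<in>S. c b = 0)) \<and>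
     (\<forall>v\<in>V. \<exists>S c. finite S \<and> S \<subseteq> B \<and> v - (\<Sum>b\<in>S. kscale (c b) b) \<in> W)"

definition dim_quot :: "('e \<Rightarrow>\<^sub>0 'k::field) set \<Rightarrow> ('e \<Rightarrow>\<^sub>0 'k) set \<Rightarrow> nat" where
  "dim_quot V W = card (SOME B. basis_mod V W B)"

definition hilbert :: "('v::finite, 'k::field) mpoly set \<Rightarrow> nat \<Rightarrow> nat" where
  "hilbert I i = dim_quot (hom_part i) (piece I i)"

text \<open>The degree of the zero-dimensional scheme \<open>Proj(R/I)\<close> is its constant Hilbert polynomial.\<close>

definition Proj_degree :: "('v::finite, 'k::field) mpoly set \<Rightarrow> nat" where
  "Proj_degree I = (THE d. \<forall>\<^sub>F i in sequentially. hilbert I i = d)"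

definition tau :: "('v::finite, 'k::field) mpoly set \<Rightarrow> nat" where
  "tau I = (LEAST i. hilbert I i = Proj_degree I)"


section \<open>Graded pieces of the quotient ring\<close>

definition quot_piece :: "('v::finite, 'k::field) mpoly set \<Rightarrow> nat \<Rightarrow> ('v, 'k) mpoly set set" where
  "quot_piece I d = (\<lambda>h. h +o I) ` hom_part d"

text \<open>Multiplication by the class of \<open>g\<close> on cosets of \<open>I\<close>: \<open>h + I\<close> goes to \<open>g h + I\<close>.\<close>

definition quot_mult ::
  "('v, 'k::field) mpoly set \<Rightarrow> ('v, 'k) mpoly \<Rightarrow> ('v, 'k) mpoly set \<Rightarrow> ('v, 'k) mpoly set" where
  "quot_mult I g C = g *o C + I"

definition quot_linear ::
  "('v::finite, 'k::field) mpoly set \<Rightarrow> nat \<Rightarrow> nat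
     \<Rightarrow> (('v, 'k) mpoly set \<Rightarrow> ('v, 'k) mpoly set) \<Rightarrow> bool" where
  "quot_linear I a b f \<longleftrightarrow> f ` quot_piece I a \<subseteq> quot_piece I b \<and>
     (\<forall>C\<in>quot_piece I a. \<forall>D\<in>quot_piece I a. f (C + D) = f C + f D) \<and>
     (\<forall>c. \<forall>C\<in>quot_piece I a. f (quot_mult I (const c) C) = quot_mult I (const c) (f C))"


section \<open>Castelnuovo-Mumford regularity\<close>

text \<open>The cohomology of the sheaf associated with a graded ideal \<open>I\<close>, computed by the alternating
  Cech complex of the standard cover: its sections of degree \<open>d\<close> over the open set where all
  variables in the list \<open>t\<close> are invertible are the degree-\<open>d\<close> elements of the localization of \<open>I\<close>,
  realized inside the Laurent polynomials.\<close>

type_synonym ('v, 'k) laurent = "('v \<Rightarrow>\<^sub>0 int) \<Rightarrow>\<^sub>0 'k"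

definition to_laurent :: "('v, 'k::field) mpoly \<Rightarrow> ('v, 'k) laurent" where
  "to_laurent f = (\<Sum>m\<in>Poly_Mapping.keys f.
     Poly_Mapping.single (Poly_Mapping.map int m) (Poly_Mapping.lookup f m))"

definition sections ::
  "('v::finite, 'k::field) mpoly set \<Rightarrow> int \<Rightarrow> 'v list \<Rightarrow> ('v, 'k) laurent set" where
  "sections I d t = {f \<in> hom_part d. \<exists>N. to_laurent (prod_list (map var t) ^ N) * f \<in> to_laurent ` I}"

text \<open>Cochains of degree \<open>i\<close> live on lists of length \<open>i + 1\<close>; values on lists of a different
  length are irrelevant.\<close>

definition cech_cochain ::
  "('v::finite, 'k::field) mpoly set \<Rightarrow> int \<Rightarrow> nat \<Rightarrow> ('v list \<Rightarrow> ('v, 'k) laurent) \<Rightarrow> bool" where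
  "cech_cochain I d i c \<longleftrightarrow>
     (\<forall>t. length t = Suc i \<longrightarrow> c t \<in> sections I d t \<and> (\<not> distinct t \<longrightarrow> c t = 0)) \<and>
     (\<forall>xs x y ys. length (xs @ x # y # ys) = Suc i \<longrightarrow> c (xs @ y # x # ys) = - c (xs @ x # y # ys))"

definition cech_diff ::
  "('v list \<Rightarrow> ('v, 'k::field) laurent) \<Rightarrow> 'v list \<Rightarrow> ('v, 'k) laurent" where
  "cech_diff c t = (\<Sum>j<length t. (-1) ^ j * c (take j t @ drop (Suc j) t))"

text \<open>\<open>H^i\<close> of the twist by \<open>d\<close> of the ideal sheaf vanishes; used for \<open>i \<ge> 1\<close> only.\<close>

definition cohomology_vanishes :: "('v::finite, 'k::field) mpoly set \<Rightarrow> int \<Rightarrow> nat \<Rightarrow> bool" where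
  "cohomology_vanishes I d i \<longleftrightarrow>
     (\<forall>c. cech_cochain I d i c \<and> (\<forall>t. length t = i + 2 \<longrightarrow> cech_diff c t = 0) \<longrightarrow>
        (\<exists>b. cech_cochain I d (i - 1) b \<and> (\<forall>t. length t = i + 1 \<longrightarrow> c t = cech_diff b t)))"

definition m_regular :: "('v::finite, 'k::field) mpoly set \<Rightarrow> int \<Rightarrow> bool" where
  "m_regular I m \<longleftrightarrow> (\<forall>i\<ge>1. cohomology_vanishes I (m - int i) i)"

definition regularity :: "('v::finite, 'k::field) mpoly set \<Rightarrow> int" where
  "regularity I = (LEAST m. m_regular I m)"

end

theory Submission
  imports Defs
begin

text \<open>Everything rests on two descriptions by coefficients. First, a form \<open>F\<close> of degree \<open>d\<close> is
  recovered from its dehomogenization, so \<open>Homog(J,z)\<close> and \<open>I\<^sub>\<ZZ>\<close> are both the ideal \<open>forms_ideal J\<close>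
  of all polynomials whose homogeneous components dehomogenize into \<open>J\<close>
  (\<open>Homog_ideal_eq\<close>, \<open>scheme_ideal_eq\<close>). Multiplying by \<open>z\<close> does not change a dehomogenization, so \<open>z\<close>
  is a nonzerodivisor modulo this ideal. Krull's description of the radical by primes shows that \<open>J\<close>
  contains a power \<open>M'^(\<alpha>+1)\<close>, hence \<open>I\<close> contains \<open>m\<^sub>p^(\<alpha>+1)\<close>. Modulo \<open>I\<close> only monomials of degree at
  most \<open>\<alpha>\<close> in the \<open>x\<^sub>i\<close> matter, and in degree \<open>b \<ge> \<alpha>\<close> these are divisible by \<open>z^(b-\<alpha>)\<close>
  (\<open>reduce_degree\<close>); this gives the statements on graded pieces and on \<open>A\<close>. An element outside \<open>m\<^sub>p\<close> is,
  up to a part that is nilpotent modulo \<open>I\<close>, a nonzero polynomial in \<open>z\<close> and therefore a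
  nonzerodivisor modulo \<open>I\<close> (\<open>nonzerodivisor\<close>): \<open>I\<close> is primary, and saturated because \<open>z\<close> is in the
  irrelevant ideal.

  Second, contraction is adjoint to multiplication for the pairing \<open>\<langle>x^K, X^[U]\<rangle> = \<delta>\<close> of coefficients
  (\<open>pair_mult\<close>), so the inverse system of an ideal is its orthogonal space. An element of \<open>I\<^sup>-\<^sup>1\<close> of
  degree \<open>u\<close> is a functional on polynomials of degree at most \<open>u\<close> vanishing on \<open>J\<close>; it extends to a
  functional vanishing on all of \<open>J\<close>, that is, to some \<open>f\<close> in \<open>J\<^sup>-\<^sup>1\<close>, and it is the homogenization \<open>f[u]\<close>
  (\<open>perp_I_is_homogenized\<close>). As \<open>z\<close> contracts \<open>f[u+1]\<close> to \<open>f[u]\<close>, all statements on \<open>L\<close> follow.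
  The same duality, degree by degree, shows that an inverse system is determined by its annihilator
  (\<open>perp_Ann\<close>), and surjectivity of contraction by \<open>z\<close> dualizes to \<open>z\<close> being a nonzerodivisor modulo the
  annihilator (\<open>Ann_eq_forms_ideal\<close>).

  The Hilbert function of \<open>A\<close> in degree \<open>d\<close> is the dimension of the image of the polynomials of degree
  at most \<open>d\<close> in \<open>R'/J\<close> (\<open>hilbert_I\<close>). It equals \<open>s\<close> from degree \<open>\<tau> \<le> \<alpha>\<close> on, and \<open>\<alpha> + 1 \<le> s\<close> because the
  powers of the maximal ideal of \<open>R'/J\<close> decrease strictly (\<open>length_ge\<close>). For the regularity, the ideal
  sheaf agrees with the structure sheaf on every open set of the Cech complex except \<open>z \<noteq> 0\<close>, where it
  is \<open>J\<close> (\<open>sections_away\<close>, \<open>sections_chart\<close>). So \<open>H^i\<close> with \<open>i \<ge> 2\<close> is that of a line bundle and vanishes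
  in the relevant degrees by a contracting homotopy on each multidegree (\<open>cech_homotopy\<close>), while
  \<open>H^1\<close> of the twist by \<open>d\<close> vanishes iff every class in \<open>R'/J\<close> has a representative of degree
  at most \<open>d\<close>, that is, iff \<open>d \<ge> \<tau>\<close>.\<close>

abbreviation "lookup \<equiv> Poly_Mapping.lookup"
abbreviation "keys \<equiv> Poly_Mapping.keys"
abbreviation "single \<equiv> Poly_Mapping.single"

text \<open>The exponents of the \<open>x\<^sub>i\<close> in a monomial of \<open>R\<close>. Their sum, and not the total degree, decides
  whether the monomial lies in a power of \<open>m\<^sub>p\<close>.\<close>

abbreviation "xpart (M :: 'n::finite option \<Rightarrow>\<^sub>0 nat) \<equiv> Poly_Mapping.map_key Some M"
abbreviation "xdeg (M :: 'n::finite option \<Rightarrow>\<^sub>0 nat) \<equiv> mdeg (xpart M)"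

section \<open>Exponents and coefficients\<close>

lemma sum_singles_lookup:
  "finite A \<Longrightarrow> lookup (\<Sum>m\<in>A. single (\<sigma> m) (c m)) t = (\<Sum>m\<in>A. if \<sigma> m = t then c m else 0)"
  by (simp add: lookup_sum lookup_single when_def)

lemma poly_mapping_sum_singles: "f = (\<Sum>m\<in>keys f. single m (lookup f m))"
  by (rule poly_mapping_eqI) (simp add: sum_singles_lookup in_keys_iff)

lemma poly_mapping_induct_add [case_names zero single add]:
  assumes "P 0" and "\<And>m c. P (single m c)" and "\<And>f g. P f \<Longrightarrow> P g \<Longrightarrow> P (f + g)"
  shows "P (f :: 'a \<Rightarrow>\<^sub>0 'k::comm_monoid_add)"
proof -
  have "P (\<Sum>m\<in>A. single m (lookup f m))" if "finite A" for A
    using that by (induction A rule: finite_induct) (auto intro: assms)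
  then show ?thesis using poly_mapping_sum_singles[of f] finite_keys by metis
qed

lemma lookup_kscale [simp]: "lookup (kscale c f) m = c * lookup f m"
  by (simp add: kscale_def map.rep_eq when_def)

lemma kscale_single: "kscale c (single m d) = single m (c * d)"
  by (rule poly_mapping_eqI) (simp add: lookup_single when_def)

lemma kscale_eq_single_mult: "kscale c f = single 0 c * f"
  unfolding kscale_def by (rule mult_map_scale_conv_mult)

lemma single_0_one: "single (0 :: 'a::zero) (1 :: 'k::zero_neq_one) = 1"
  by (rule poly_mapping_eqI) (simp add: lookup_single lookup_one)

lemma lookup_single_mult:
  fixes f :: "('v \<Rightarrow>\<^sub>0 'd::cancel_comm_monoid_add) \<Rightarrow>\<^sub>0 'k::field"
  shows "lookup (single M c * f) (M + m) = c * lookup f m"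
proof (induction f rule: poly_mapping_induct_add)
  case (single m' c')
  then show ?case by (auto simp: mult_single lookup_single when_def)
qed (auto simp: lookup_add distrib_left)

lemma keys_single_mult:
  "keys (single M c * (f :: ('v \<Rightarrow>\<^sub>0 'd::cancel_comm_monoid_add) \<Rightarrow>\<^sub>0 'k::field)) \<subseteq> (+) M ` keys f"
  using keys_mult[of "single M c" f] by (auto split: if_splits)

interpretation kv: vector_space "kscale :: 'k::field \<Rightarrow> ('e \<Rightarrow>\<^sub>0 'k) \<Rightarrow> _"
  by unfold_locales (auto intro!: poly_mapping_eqI simp: lookup_add algebra_simps)

lemma module_mult: "module ((*) :: 'r::comm_ring_1 \<Rightarrow> 'r \<Rightarrow> 'r)"
  by unfold_locales (auto simp: algebra_simps)

lemmas ideal_zero = module.subspace_0[OF module_mult]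
  and ideal_add = module.subspace_add[OF module_mult]
  and ideal_diff = module.subspace_diff[OF module_mult]
  and ideal_mult_left = module.subspace_scale[OF module_mult]
  and ideal_sum = module.subspace_sum[OF module_mult]
  and idealI = module.subspaceI[OF module_mult]
  and ideal_gen_least = module.span_minimal[OF module_mult]
  and ideal_gen_base = module.span_base[OF module_mult]
  and ideal_gen_ideal = module.subspace_span[OF module_mult]

interpretation kv2: vector_space_pair "kscale :: 'k::field \<Rightarrow> ('e \<Rightarrow>\<^sub>0 'k) \<Rightarrow> _" "kscale :: 'k::field \<Rightarrow> ('d \<Rightarrow>\<^sub>0 'k) \<Rightarrow> _"
  by unfold_locales

lemma functional_pair:
  "vector_space_pair (kscale :: 'k::field \<Rightarrow> ('e \<Rightarrow>\<^sub>0 'k) \<Rightarrow> _) ((*) :: 'k \<Rightarrow> 'k \<Rightarrow> 'k)"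
  by unfold_locales (simp_all add: distrib_left distrib_right)

lemmas functional_0 = vector_space_pair.linear_0[OF functional_pair]
  and functional_diff = vector_space_pair.linear_diff[OF functional_pair]
  and functional_sum = vector_space_pair.linear_sum[OF functional_pair]
  and functional_scale = vector_space_pair.linear_scale[OF functional_pair]

lemma mdeg_0 [simp]: "mdeg 0 = 0"
  by (simp add: mdeg_def)

lemma mdeg_add: "mdeg (a + b) = mdeg a + mdeg b"
  by (simp add: mdeg_def lookup_add sum.distrib)

lemma mdeg_single [simp]: "mdeg (single v e) = e"
  by (simp add: mdeg_def lookup_single when_def)

lemma lookup_le_mdeg: "lookup m v \<le> mdeg (m :: 'v::finite \<Rightarrow>\<^sub>0 nat)"
  unfolding mdeg_def by (rule member_le_sum) auto

lemma finite_exponents_le: "finite {m :: 'v::finite \<Rightarrow>\<^sub>0 nat. mdeg m \<le> d}"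
proof (rule finite_imageD)
  show "finite (lookup ` {m :: 'v \<Rightarrow>\<^sub>0 nat. mdeg m \<le> d})"
  proof (rule finite_subset)
    show "lookup ` {m :: 'v \<Rightarrow>\<^sub>0 nat. mdeg m \<le> d}
        \<subseteq> {f. \<forall>v. (v \<in> UNIV \<longrightarrow> f v \<in> {..d}) \<and> (v \<notin> UNIV \<longrightarrow> f v = 0)}"
      by (auto intro: order_trans[OF lookup_le_mdeg])
    show "finite {f :: 'v \<Rightarrow> nat. \<forall>v. (v \<in> UNIV \<longrightarrow> f v \<in> {..d}) \<and> (v \<notin> UNIV \<longrightarrow> f v = 0)}"
      by (rule finite_set_of_finite_funs) auto
  qed
  show "inj_on lookup {m :: 'v \<Rightarrow>\<^sub>0 nat. mdeg m \<le> d}"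
    by (auto intro!: inj_onI poly_mapping_eqI)
qed

lemma lookup_xpart [simp]: "lookup (xpart M) i = lookup M (Some i)"
  by (simp add: map_key.rep_eq)

lemma lookup_ext_mono [simp]:
  "lookup (ext_mono m e) None = e" "lookup (ext_mono m e) (Some i) = lookup m i"
  unfolding ext_mono_def by (simp_all add: lookup_Abs_poly_mapping)

lemma option_exponent_eqI:
  "lookup M None = lookup M' None \<Longrightarrow> xpart M = xpart M' \<Longrightarrow> M = M'"
  by (rule poly_mapping_eqI) (metis lookup_xpart not_None_eq)

lemma xpart_ext_mono [simp]: "xpart (ext_mono m e) = m"
  by (rule poly_mapping_eqI) simp

lemma ext_mono_xpart [simp]: "ext_mono (xpart M) (lookup M None) = M"
  by (rule option_exponent_eqI) simp_all

lemma xpart_add [simp]: "xpart (M + M') = xpart M + xpart M'"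
  by (rule poly_mapping_eqI) (simp add: lookup_add)

lemma xpart_0 [simp]: "xpart 0 = 0"
  by (rule poly_mapping_eqI) simp

lemma xpart_single_None [simp]: "xpart (single None e) = 0"
  by (rule poly_mapping_eqI) (simp add: lookup_single when_def)

lemma exponent_split_z:
  "k \<le> lookup M None \<Longrightarrow> M = single None k + (M - single None k :: 'n option \<Rightarrow>\<^sub>0 nat)"
  by (rule poly_mapping_eqI) (auto simp: lookup_add lookup_minus lookup_single when_def)

lemma mdeg_option: "mdeg M = lookup M None + mdeg (xpart M)"
proof -
  have "mdeg M = lookup M None + (\<Sum>v\<in>range Some. lookup M v)"
    unfolding mdeg_def by (subst UNIV_option_conv) simp
  also have "(\<Sum>v\<in>range Some. lookup M v) = mdeg (xpart M)"
    unfolding mdeg_def by (subst sum.reindex) simp_all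
  finally show ?thesis .
qed

lemma mdeg_ext_mono [simp]: "mdeg (ext_mono m e) = e + mdeg m"
  by (simp add: mdeg_option)

section \<open>Homogeneous components\<close>

lemma lookup_hom_component [simp]:
  "lookup (hom_component d f) m = (if mdeg m = d then lookup f m else 0)"
  unfolding hom_component_def by (subst sum_singles_lookup) (auto simp: in_keys_iff)

lemma hom_part_iff: "f \<in> hom_part d \<longleftrightarrow> (\<forall>m. mdeg m \<noteq> d \<longrightarrow> lookup f m = 0)"
  by (auto simp: hom_part_def in_keys_iff)

lemma hom_component_in [simp]: "hom_component d f \<in> hom_part d"
  by (simp add: hom_part_iff)

lemma hom_component_add: "hom_component d (f + g) = hom_component d f + hom_component d g"
  by (rule poly_mapping_eqI) (simp add: lookup_add)

lemma hom_component_0 [simp]: "hom_component d 0 = 0"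
  by (rule poly_mapping_eqI) simp

lemma hom_component_hom: "f \<in> hom_part d \<Longrightarrow> hom_component e f = (if e = d then f else 0)"
  by (rule poly_mapping_eqI) (auto simp: hom_part_iff)

lemma hom_component_sum: "hom_component d (sum f A) = (\<Sum>x\<in>A. hom_component d (f x))"
  by (induction A rule: infinite_finite_induct) (simp_all add: hom_component_add)

lemma sum_hom_components:
  assumes "\<And>m. m \<in> keys f \<Longrightarrow> mdeg m \<in> D" "finite D"
  shows "f = (\<Sum>d\<in>D. hom_component d f)"
  by (rule poly_mapping_eqI) (use assms in \<open>auto simp: lookup_sum in_keys_iff\<close>)

lemma sum_hom_components_keys: "f = (\<Sum>d\<in>mdeg ` keys f. hom_component d f)"
  by (rule sum_hom_components) auto

lemma hom_part_mult: "f \<in> hom_part d \<Longrightarrow> g \<in> hom_part e \<Longrightarrow> f * g \<in> hom_part (d + e)"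
  unfolding hom_part_def using keys_mult[of f g] by (fastforce simp: mdeg_add)

lemma hom_part_0 [simp]: "0 \<in> hom_part d"
  by (simp add: hom_part_iff)

lemma hom_part_add: "f \<in> hom_part d \<Longrightarrow> g \<in> hom_part d \<Longrightarrow> f + g \<in> hom_part d"
  by (simp add: hom_part_iff lookup_add)

lemma hom_part_diff: "f \<in> hom_part d \<Longrightarrow> g \<in> hom_part d \<Longrightarrow> f - g \<in> hom_part d"
  by (simp add: hom_part_iff lookup_minus)

lemma hom_part_kscale: "f \<in> hom_part d \<Longrightarrow> kscale c f \<in> hom_part d"
  by (simp add: hom_part_iff)

lemma single_in_hom_part: "single m c \<in> hom_part d \<longleftrightarrow> mdeg m = d \<or> c = 0"
  by (auto simp: hom_part_def)

lemma subspace_hom_part: "kv.subspace (hom_part d)"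
  by (auto intro!: kv.subspaceI hom_part_add hom_part_kscale)

lemma hom_component_hom_mult:
  assumes "g \<in> hom_part d"
  shows "hom_component (d + e) (g * f) = g * hom_component e f"
proof -
  let ?D = "insert e (mdeg ` keys f)"
  have "f = (\<Sum>i\<in>?D. hom_component i f)"
    by (rule sum_hom_components) auto
  then have "hom_component (d + e) (g * f) = hom_component (d + e) (g * (\<Sum>i\<in>?D. hom_component i f))"
    by simp
  also have "\<dots> = (\<Sum>i\<in>?D. hom_component (d + e) (g * hom_component i f))"
    by (simp only: sum_distrib_left hom_component_sum)
  also have "\<dots> = (\<Sum>i\<in>?D. if i = e then g * hom_component e f else 0)"
    by (rule sum.cong) (auto simp: hom_component_hom[OF hom_part_mult[OF assms hom_component_in]])
  also have "\<dots> = g * hom_component e f" by simp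
  finally show ?thesis .
qed

lemma ideal_kscale: "is_ideal (I :: ('v::finite, 'k::field) mpoly set) \<Longrightarrow> f \<in> I \<Longrightarrow> kscale c f \<in> I"
  by (simp add: kscale_eq_single_mult ideal_mult_left)

lemma ideal_if_terms:
  fixes f :: "('v::finite, 'k::field) mpoly"
  assumes "is_ideal I" "\<And>m. m \<in> keys f \<Longrightarrow> single m (lookup f m) \<in> I"
  shows "f \<in> I"
  using ideal_sum[OF assms(1), of "keys f" "\<lambda>m. single m (lookup f m)"] assms(2)
  by (simp flip: poly_mapping_sum_singles)

lemma ideal_subspace: "is_ideal (I :: ('v::finite, 'k::field) mpoly set) \<Longrightarrow> kv.subspace I"
  by (intro kv.subspaceI) (auto simp: ideal_kscale ideal_zero ideal_add)

lemma var_power: "(var v :: ('v, 'k::field) mpoly) ^ k = single (single v k) 1"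
  by (induction k) (auto simp: var_def mult_single single_0_one simp flip: single_add)

lemma var_power_in: "(var v :: ('v::finite, 'k::field) mpoly) ^ k \<in> hom_part k"
  by (simp add: var_power single_in_hom_part)

section \<open>Relabelling exponents\<close>

text \<open>Dehomogenization, the inclusion into Laurent polynomials and the twists of affine polynomials
  below all rename monomials. They are ring homomorphisms where the renaming is additive, and
  coefficients can be read off where it is injective.\<close>

definition relabel :: "('a \<Rightarrow> 'b) \<Rightarrow> ('a \<Rightarrow>\<^sub>0 'k::comm_monoid_add) \<Rightarrow> ('b \<Rightarrow>\<^sub>0 'k)" where
  "relabel \<sigma> f = (\<Sum>m\<in>keys f. single (\<sigma> m) (lookup f m))"

lemma relabel_superset:
  assumes "finite A" "keys f \<subseteq> A"
  shows "relabel \<sigma> f = (\<Sum>m\<in>A. single (\<sigma> m) (lookup f m))"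
  unfolding relabel_def by (rule sum.mono_neutral_left) (use assms in \<open>auto simp: in_keys_iff\<close>)

lemma relabel_add: "relabel \<sigma> (f + g) = relabel \<sigma> f + relabel \<sigma> g"
proof -
  let ?A = "keys f \<union> keys g"
  have "relabel \<sigma> h = (\<Sum>m\<in>?A. single (\<sigma> m) (lookup h m))" if "h \<in> {f, g, f + g}" for h
    by (rule relabel_superset) (use that keys_add[of f g] in auto)
  then show ?thesis by (simp add: lookup_add single_add sum.distrib)
qed

lemma relabel_0 [simp]: "relabel \<sigma> 0 = 0"
  by (simp add: relabel_def)

lemma relabel_single [simp]: "relabel \<sigma> (single m c) = single (\<sigma> m) c"
  by (cases "c = 0") (auto simp: relabel_def)

lemma relabel_mult:
  assumes "\<And>a b. \<sigma> (a + b) = \<sigma> a + \<sigma> b"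
  shows "relabel \<sigma> (f * g) = relabel \<sigma> f * relabel \<sigma> (g :: 'a::monoid_add \<Rightarrow>\<^sub>0 'k::semiring_0)"
proof (induction f rule: poly_mapping_induct_add)
  case (single m c)
  show ?case
    by (induction g rule: poly_mapping_induct_add)
      (auto simp: mult_single relabel_add distrib_left assms)
qed (auto simp: relabel_add distrib_right)

lemma lookup_relabel_inj:
  assumes "inj_on \<sigma> (insert m (keys f))"
  shows "lookup (relabel \<sigma> f) (\<sigma> m) = lookup f m"
proof -
  have "lookup (relabel \<sigma> f) (\<sigma> m) = (\<Sum>m'\<in>keys f. if m' = m then lookup f m else 0)"
    unfolding relabel_def sum_singles_lookup[OF finite_keys]
    by (rule sum.cong) (use assms in \<open>auto simp: inj_on_def\<close>)
  then show ?thesis by (simp add: in_keys_iff)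
qed

lemma keys_relabel: "keys (relabel \<sigma> f) \<subseteq> \<sigma> ` keys f"
  unfolding relabel_def using keys_sum[of "\<lambda>m. single (\<sigma> m) (lookup f m)" "keys f"]
  by (fastforce split: if_splits)

lemma relabel_kscale: "relabel \<sigma> (kscale c f) = kscale c (relabel \<sigma> f)"
  by (induction f rule: poly_mapping_induct_add)
    (auto simp: relabel_add kv.scale_right_distrib kscale_single)

section \<open>Contraction and the coefficient pairing\<close>

text \<open>The pairing for which the monomials \<open>x^K\<close> and \<open>X^[K]\<close> are dual bases. The coefficient of \<open>X^[V]\<close> in
  \<open>h \<circ> F\<close> is the pairing of \<open>x^V h\<close> with \<open>F\<close>, so being annihilated by an ideal is being orthogonal to it.
  It is symmetric because polynomials and divided powers have the same coefficients.\<close>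

definition pair :: "('e \<Rightarrow>\<^sub>0 'k::field) \<Rightarrow> ('e \<Rightarrow>\<^sub>0 'k) \<Rightarrow> 'k" where
  "pair h F = (\<Sum>m\<in>keys h. lookup h m * lookup F m)"

lemma pair_superset:
  assumes "finite A" "keys h \<subseteq> A"
  shows "pair h F = (\<Sum>m\<in>A. lookup h m * lookup F m)"
  unfolding pair_def by (rule sum.mono_neutral_left) (use assms in \<open>auto simp: in_keys_iff\<close>)

lemma pair_commute: "pair h F = pair F h"
  using pair_superset[of "keys h \<union> keys F" h F] pair_superset[of "keys h \<union> keys F" F h]
  by (simp add: mult.commute)

lemma pair_add_right: "pair h (F + G) = pair h F + pair h G"
  by (simp add: pair_def lookup_add distrib_left sum.distrib)

lemma pair_add_left: "pair (g + h) F = pair g F + pair h F"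
  by (metis pair_commute pair_add_right)

lemma pair_0 [simp]: "pair 0 F = 0" "pair F 0 = 0"
  by (simp_all add: pair_def)

lemma pair_single_left [simp]: "pair (single m c) F = c * lookup F m"
  by (simp add: pair_def)

lemma pair_single_right [simp]: "pair h (single m c) = lookup h m * c"
  by (metis pair_commute pair_single_left mult.commute)

lemma pair_kscale_right: "pair h (kscale c F) = c * pair h F"
  by (simp add: pair_def sum_distrib_left mult_ac)

lemma pair_kscale_left: "pair (kscale c h) F = c * pair h F"
  by (metis pair_commute pair_kscale_right)

lemma linear_pair: "Vector_Spaces.linear kscale (*) (\<lambda>h. pair h F)"
  by unfold_locales (simp_all add: pair_add_left pair_kscale_left distrib_left distrib_right)

lemma exponent_le_iff:
  "(\<forall>v. lookup K v \<le> lookup U v) \<and> U - K = V \<longleftrightarrow> U = V + (K :: 'v \<Rightarrow>\<^sub>0 nat)"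
proof
  assume "(\<forall>v. lookup K v \<le> lookup U v) \<and> U - K = V"
  then show "U = V + K" by (auto intro!: poly_mapping_eqI simp: lookup_add lookup_minus)
next
  assume "U = V + K"
  then show "(\<forall>v. lookup K v \<le> lookup U v) \<and> U - K = V"
    by (auto intro!: poly_mapping_eqI simp: lookup_add lookup_minus)
qed

lemma lookup_contract:
  "lookup (contract h F) V = (\<Sum>K\<in>keys h. lookup h K * lookup F (V + K))"
proof -
  have "(\<Sum>U\<in>keys F. lookup (if \<forall>v. lookup K v \<le> lookup U v
            then single (U - K) (lookup h K * lookup F U) else 0) V)
        = (\<Sum>U\<in>keys F. if U = V + K then lookup h K * lookup F U else 0)" for K
    by (rule sum.cong) (auto simp: lookup_single when_def exponent_le_iff[symmetric])
  also have "\<dots> K = lookup h K * lookup F (V + K)" for K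
    by (simp add: in_keys_iff)
  finally show ?thesis
    unfolding contract_def by (simp add: lookup_sum)
qed

lemma lookup_contract_pair: "lookup (contract h F) V = pair (single V 1 * h) F"
proof -
  have "pair (single V 1 * (\<Sum>K\<in>A. single K (lookup h K))) F
      = (\<Sum>K\<in>A. lookup h K * lookup F (V + K))" if "finite A" for A
    using that by (induction A rule: finite_induct) (auto simp: pair_add_left distrib_left mult_single)
  from this[OF finite_keys[of h]] show ?thesis
    unfolding lookup_contract by (simp flip: poly_mapping_sum_singles)
qed

lemma contract_add_left: "contract (g + h) F = contract g F + contract h F"
  by (rule poly_mapping_eqI) (simp add: lookup_contract_pair lookup_add distrib_left pair_add_left)

lemma contract_add_right: "contract h (F + G) = contract h F + contract h G"
  by (rule poly_mapping_eqI) (simp add: lookup_contract_pair lookup_add pair_add_right)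

text \<open>Contraction is the adjoint of multiplication; hence it is an action of the polynomial ring.\<close>

lemma pair_mult: "pair (g * h) F = pair g (contract h F)"
proof (induction g rule: poly_mapping_induct_add)
  case (single m c)
  have "single m c * h = kscale c (single m 1 * h)"
    by (simp add: kscale_eq_single_mult mult_single flip: mult.assoc)
  then show ?case by (simp add: lookup_contract_pair pair_kscale_left)
qed (simp_all add: distrib_right pair_add_left)

lemma contract_mult: "contract (g * h) F = contract g (contract h F)"
  by (rule poly_mapping_eqI) (simp only: lookup_contract_pair pair_mult flip: mult.assoc)

lemma contract_1 [simp]: "contract 1 F = F"
  by (rule poly_mapping_eqI) (simp add: lookup_contract_pair)

lemma module_contract: "module contract"
  by unfold_locales (simp_all add: contract_add_left contract_add_right contract_mult)

lemmas contract_0_left [simp] = module.scale_zero_left[OF module_contract]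
  and contract_0_right [simp] = module.scale_zero_right[OF module_contract]
  and contract_sum_right = module.scale_sum_right[OF module_contract]
  and contract_sum_left = module.scale_sum_left[OF module_contract]
  and contract_subspace_def = module.subspace_def[OF module_contract]

lemma contract_const: "contract (single 0 c) F = kscale c F"
  by (rule poly_mapping_eqI) (simp add: lookup_contract_pair mult_single)

lemma contract_kscale_right: "contract h (kscale c F) = kscale c (contract h F)"
  by (simp add: mult.commute flip: contract_const contract_mult)

section \<open>Linear functionals\<close>

text \<open>A linear map with kernel \<open>W\<close> stands for the quotient by \<open>W\<close>: subtract a projection onto \<open>W\<close>.\<close>

lemma kernel_exists:
  fixes W :: "('e \<Rightarrow>\<^sub>0 'k::field) set"
  assumes "kv.subspace W"
  obtains p :: "('e \<Rightarrow>\<^sub>0 'k) \<Rightarrow> ('e \<Rightarrow>\<^sub>0 'k)"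
  where "Vector_Spaces.linear kscale kscale p" "\<And>x. p x = 0 \<longleftrightarrow> x \<in> W"
proof -
  obtain g :: "('e \<Rightarrow>\<^sub>0 'k) \<Rightarrow> ('e \<Rightarrow>\<^sub>0 'k)"
    where g: "g ` UNIV \<subseteq> W" "Vector_Spaces.linear kscale kscale g" "\<forall>v\<in>W. g (id v) = v"
    using kv2.linear_exists_left_inverse_on[OF kv.linear_id assms] by auto
  show ?thesis
  proof (rule that[of "\<lambda>x. x - g x"])
    show "Vector_Spaces.linear kscale kscale (\<lambda>x. x - g x)"
      by (intro kv2.linear_compose_sub kv.linear_ident g)
    show "x - g x = 0 \<longleftrightarrow> x \<in> W" for x
      using g(1,3) by (metis eq_id_iff eq_iff_diff_eq_0 range_subsetD)
  qed
qed

text \<open>On \<open>U\<close> the functional \<open>\<phi>\<close> depends only on the class modulo \<open>W\<close>. Taking the class and then a linear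
  choice of a representative in \<open>U\<close> extends it to the whole space.\<close>

lemma extend_functional:
  fixes \<phi> :: "('e \<Rightarrow>\<^sub>0 'k::field) \<Rightarrow> 'k"
  assumes phi: "Vector_Spaces.linear kscale (*) \<phi>"
    and U: "kv.subspace U" and W: "kv.subspace W" and UW: "\<And>x. x \<in> U \<Longrightarrow> x \<in> W \<Longrightarrow> \<phi> x = 0"
  obtains \<psi> where "Vector_Spaces.linear kscale (*) \<psi>" "\<And>x. x \<in> U \<Longrightarrow> \<psi> x = \<phi> x" "\<And>x. x \<in> W \<Longrightarrow> \<psi> x = 0"
proof -
  obtain p :: "('e \<Rightarrow>\<^sub>0 'k) \<Rightarrow> ('e \<Rightarrow>\<^sub>0 'k)"
    where p: "Vector_Spaces.linear kscale kscale p" "\<And>x. p x = 0 \<longleftrightarrow> x \<in> W"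
    using kernel_exists[OF W] by blast
  obtain g where g: "g ` UNIV \<subseteq> U" "Vector_Spaces.linear kscale kscale g" "\<forall>v\<in>p ` U. p (g v) = v"
    using kv2.linear_exists_right_inverse_on[OF p(1) U] by blast
  have gp: "Vector_Spaces.linear kscale kscale (g \<circ> p)"
    by (rule Vector_Spaces.linear_compose[OF p(1) g(2)])
  show ?thesis
  proof (rule that[of "\<phi> \<circ> (g \<circ> p)"])
    show "Vector_Spaces.linear kscale (*) (\<phi> \<circ> (g \<circ> p))"
      by (rule Vector_Spaces.linear_compose[OF gp phi])
    show "(\<phi> \<circ> (g \<circ> p)) x = 0" if "x \<in> W" for x
      using that p(2)[of x] kv2.linear_0[OF g(2)] functional_0[OF phi] by simp
    show "(\<phi> \<circ> (g \<circ> p)) x = \<phi> x" if x: "x \<in> U" for x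
    proof -
      have "p (g (p x) - x) = 0"
        using g(3) x by (simp add: kv2.linear_diff[OF p(1)])
      moreover have "g (p x) - x \<in> U"
        using g(1) x by (intro kv.subspace_diff[OF U]) auto
      ultimately have "\<phi> (g (p x) - x) = 0" using UW p(2) by blast
      then show ?thesis by (simp add: functional_diff[OF phi])
    qed
  qed
qed

lemma separating_functional:
  fixes W :: "('e \<Rightarrow>\<^sub>0 'k::field) set"
  assumes W: "kv.subspace W" and h: "h \<notin> W"
  obtains \<psi> where "Vector_Spaces.linear kscale (*) \<psi>" "\<psi> h \<noteq> 0" "\<And>x. x \<in> W \<Longrightarrow> \<psi> x = 0"
proof -
  have "h \<noteq> 0" using h kv.subspace_0[OF W] by auto
  then obtain m where m: "lookup h m \<noteq> 0" by (metis poly_mapping_eqI lookup_zero)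
  obtain \<psi> where \<psi>: "Vector_Spaces.linear kscale (*) \<psi>" "\<And>x. x \<in> kv.span {h} \<Longrightarrow> \<psi> x = pair x (single m 1)"
    "\<And>x. x \<in> W \<Longrightarrow> \<psi> x = 0"
  proof (rule extend_functional[OF linear_pair[of "single m 1"] kv.subspace_span[of "{h}"] W])
    fix x assume "x \<in> kv.span {h}" "x \<in> W"
    then obtain c where x: "x = kscale c h" "kscale c h \<in> W" by (auto simp: kv.span_singleton)
    have "c = 0"
    proof (rule ccontr)
      assume "c \<noteq> 0"
      then have "h = kscale (inverse c) (kscale c h)" by (simp)
      then show False using h x(2) kv.subspace_scale[OF W] by metis
    qed
    then show "pair x (single m 1) = 0" using x by simp
  qed blast
  show ?thesis
    by (rule that[of \<psi>]) (use \<psi> m kv.span_base[of h "{h}"] in auto)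
qed

text \<open>A functional is determined by its values on monomials. If only finitely many of these matter, they
  are the coefficients of a polynomial.\<close>

lemma functional_is_pairing:
  fixes \<psi> :: "('e \<Rightarrow>\<^sub>0 'k::field) \<Rightarrow> 'k"
  assumes psi: "Vector_Spaces.linear kscale (*) \<psi>" and A: "finite A"
  obtains F where "keys F \<subseteq> A"
    "\<And>h. (\<And>m. m \<in> keys h \<Longrightarrow> m \<notin> A \<Longrightarrow> \<psi> (single m 1) = 0) \<Longrightarrow> \<psi> h = pair h F"
proof -
  define F where "F = (\<Sum>m\<in>A. single m (\<psi> (single m 1)))"
  have F: "lookup F m = (if m \<in> A then \<psi> (single m 1) else 0)" for m
    unfolding F_def by (simp add: sum_singles_lookup A)
  have single: "\<psi> (single m c) = c * \<psi> (single m 1)" for m c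
    using functional_scale[OF psi, of c "single m 1"] by (simp add: kscale_single)
  show ?thesis
  proof (rule that[of F])
    show "keys F \<subseteq> A" by (auto simp: in_keys_iff F split: if_splits)
    fix h :: "'e \<Rightarrow>\<^sub>0 'k" assume *: "\<And>m. m \<in> keys h \<Longrightarrow> m \<notin> A \<Longrightarrow> \<psi> (single m 1) = 0"
    have "\<psi> h = \<psi> (\<Sum>m\<in>keys h. single m (lookup h m))"
      by (simp flip: poly_mapping_sum_singles)
    also have "\<dots> = (\<Sum>m\<in>keys h. lookup h m * \<psi> (single m 1))"
      unfolding functional_sum[OF psi] by (intro sum.cong refl single)
    also have "\<dots> = pair h F"
      unfolding pair_def by (rule sum.cong) (auto simp: F *)
    finally show "\<psi> h = pair h F" .
  qed
qed

section \<open>Powers of ideals generated by variables\<close>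

text \<open>The degree in the variables of \<open>S\<close>. For all variables it is the degree, for the \<open>x\<^sub>i\<close> it is \<open>xdeg\<close>, so
  that the powers of \<open>var_ideal\<close> and of \<open>point_ideal\<close> have a common description.\<close>

definition vdeg :: "'v set \<Rightarrow> ('v::finite \<Rightarrow>\<^sub>0 nat) \<Rightarrow> nat" where
  "vdeg S m = (\<Sum>v\<in>S. lookup m v)"

lemma vdeg_UNIV: "vdeg UNIV m = mdeg m"
  by (simp add: vdeg_def mdeg_def)

lemma vdeg_range_Some: "vdeg (range Some) M = xdeg M"
  unfolding vdeg_def mdeg_def by (subst sum.reindex) simp_all

lemma vdeg_add: "vdeg S (a + b) = vdeg S a + vdeg S b"
  by (simp add: vdeg_def lookup_add sum.distrib)

lemma vdeg_single: "vdeg S (single v e) = (if v \<in> S then e else 0)"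
  by (simp add: vdeg_def lookup_single when_def)

lemma exponent_split_var:
  assumes "Suc k \<le> vdeg S m"
  obtains v m' where "v \<in> S" "m = single v 1 + m'" "k \<le> vdeg S m'"
proof -
  from assms obtain v where v: "v \<in> S" "lookup m v \<noteq> 0"
    unfolding vdeg_def by (metis not_less_eq_eq sum.neutral zero_le)
  define m' where "m' = m - single v 1"
  have m: "m = single v 1 + m'"
    by (rule poly_mapping_eqI) (use v in \<open>auto simp: m'_def lookup_add lookup_minus lookup_single when_def\<close>)
  show ?thesis
    by (rule that[OF v(1) m]) (use assms v(1) m in \<open>simp add: vdeg_add vdeg_single\<close>)
qed

definition vdeg_ge :: "'v::finite set \<Rightarrow> nat \<Rightarrow> ('v, 'k::field) mpoly set" where
  "vdeg_ge S k = {f. \<forall>m\<in>keys f. k \<le> vdeg S m}"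

lemma is_ideal_vdeg_ge: "is_ideal (vdeg_ge S k :: ('v::finite, 'k::field) mpoly set)"
proof (rule idealI)
  show "x + y \<in> vdeg_ge S k" if "x \<in> vdeg_ge S k" "y \<in> vdeg_ge S k" for x y :: "('v, 'k) mpoly"
    using that keys_add[of x y] by (auto simp: vdeg_ge_def)
  show "c * x \<in> vdeg_ge S k" if "x \<in> vdeg_ge S k" for c x :: "('v, 'k) mpoly"
    using that keys_mult[of c x] by (fastforce simp: vdeg_ge_def vdeg_add)
qed (simp add: vdeg_ge_def)

lemma vdeg_ge_mult: "f \<in> vdeg_ge S a \<Longrightarrow> g \<in> vdeg_ge S b \<Longrightarrow> f * g \<in> vdeg_ge S (a + b)"
  using keys_mult[of f g] by (fastforce simp: vdeg_ge_def vdeg_add)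

lemma vdeg_ge_power: "f \<in> vdeg_ge S 1 \<Longrightarrow> f ^ j \<in> vdeg_ge S j"
proof (induction j)
  case (Suc j)
  then show ?case using vdeg_ge_mult[of f S 1 "f ^ j" j] by simp
qed (simp add: vdeg_ge_def)

text \<open>A monomial of degree at least \<open>k + 1\<close> in \<open>S\<close> is a variable of \<open>S\<close> times a monomial of degree at least
  \<open>k\<close>, which is the inductive step for the powers of the ideal.\<close>

lemma vdeg_ge_Suc_le:
  assumes I: "is_ideal I" and gen: "\<And>v f. v \<in> S \<Longrightarrow> f \<in> vdeg_ge S k \<Longrightarrow> var v * f \<in> I"
  shows "(vdeg_ge S (Suc k) :: ('v::finite, 'k::field) mpoly set) \<subseteq> I"
proof
  fix f :: "('v, 'k) mpoly" assume f: "f \<in> vdeg_ge S (Suc k)"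
  show "f \<in> I"
  proof (rule ideal_if_terms[OF I])
    fix m assume "m \<in> keys f"
    with f have "Suc k \<le> vdeg S m" by (auto simp: vdeg_ge_def)
    then obtain v m' where v: "v \<in> S" "m = single v 1 + m'" "k \<le> vdeg S m'"
      by (rule exponent_split_var)
    then have "var v * single m' (lookup f m) \<in> I"
      by (intro gen) (auto simp: vdeg_ge_def)
    then show "single m (lookup f m) \<in> I" by (simp add: v var_def mult_single)
  qed
qed

lemma ideal_gen_vars: "ideal_gen (var ` S) = (vdeg_ge S 1 :: ('v::finite, 'k::field) mpoly set)"
proof
  show "ideal_gen (var ` S) \<subseteq> (vdeg_ge S 1 :: ('v, 'k) mpoly set)"
    by (rule ideal_gen_least[OF _ is_ideal_vdeg_ge]) (auto simp: vdeg_ge_def var_def vdeg_single)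
  show "(vdeg_ge S 1 :: ('v, 'k) mpoly set) \<subseteq> ideal_gen (var ` S)"
    using vdeg_ge_Suc_le[where k = 0, OF ideal_gen_ideal[of "var ` S"]]
    by (metis One_nat_def ideal_gen_base ideal_gen_ideal ideal_mult_left imageI mult.commute)
qed

lemma ideal_power_vars:
  "ideal_power (ideal_gen (var ` S)) k = (vdeg_ge S k :: ('v::finite, 'k::field) mpoly set)"
proof (induction k)
  case 0
  then show ?case by (simp add: vdeg_ge_def)
next
  case (Suc k)
  let ?G = "{a * b | a b. a \<in> vdeg_ge S 1 \<and> b \<in> (vdeg_ge S k :: ('v, 'k) mpoly set)}"
  have "ideal_gen ?G = vdeg_ge S (Suc k)"
  proof
    show "ideal_gen ?G \<subseteq> vdeg_ge S (Suc k)"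
    proof (rule ideal_gen_least[OF _ is_ideal_vdeg_ge], safe)
      fix a b :: "('v, 'k) mpoly" assume "a \<in> vdeg_ge S 1" "b \<in> vdeg_ge S k"
      then show "a * b \<in> vdeg_ge S (Suc k)" using vdeg_ge_mult[of a S 1 b k] by simp
    qed
    show "vdeg_ge S (Suc k) \<subseteq> ideal_gen ?G"
    proof (rule vdeg_ge_Suc_le[OF ideal_gen_ideal])
      fix v and f :: "('v, 'k) mpoly" assume "v \<in> S" "f \<in> vdeg_ge S k"
      then show "var v * f \<in> ideal_gen ?G"
        by (intro ideal_gen_base CollectI exI[of _ "var v"] exI[of _ f])
          (auto simp: vdeg_ge_def var_def vdeg_single)
    qed
  qed
  moreover have "ideal_power (vdeg_ge S 1) k = (vdeg_ge S k :: ('v, 'k) mpoly set)"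
    using Suc.IH by (simp only: ideal_gen_vars)
  ultimately show ?case
    by (simp only: ideal_power.simps ideal_mult_def ideal_gen_vars)
qed

lemma var_ideal_power: "ideal_power var_ideal k = (vdeg_ge UNIV k :: ('v::finite, 'k::field) mpoly set)"
  unfolding var_ideal_def by (rule ideal_power_vars)

lemma point_ideal_power:
  "ideal_power point_ideal k = (vdeg_ge (range Some) k :: ('n::finite option, 'k::field) mpoly set)"
  unfolding point_ideal_def using ideal_power_vars[of "range Some"] by (simp add: image_image)

lemma mdeg_eq_0_iff [simp]: "mdeg m = 0 \<longleftrightarrow> m = (0 :: 'v::finite \<Rightarrow>\<^sub>0 nat)"
proof
  assume "mdeg m = 0"
  then have "lookup m v = 0" for v using lookup_le_mdeg[of m v] by simp
  then show "m = 0" by (intro poly_mapping_eqI) simp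
qed simp

lemma var_ideal_iff: "(f :: ('v::finite, 'k::field) mpoly) \<in> var_ideal \<longleftrightarrow> lookup f 0 = 0"
proof -
  have "1 \<le> mdeg m \<longleftrightarrow> m \<noteq> 0" for m :: "'v \<Rightarrow>\<^sub>0 nat"
    by (simp add: Suc_le_eq flip: neq0_conv)
  then show ?thesis
    unfolding var_ideal_def ideal_gen_vars vdeg_ge_def vdeg_UNIV
    by (force simp: in_keys_iff)
qed

lemma var_in_var_ideal: "(var v :: ('v::finite, 'k::field) mpoly) \<in> var_ideal"
  unfolding var_ideal_def by (rule ideal_gen_base) simp

lemma point_ideal_eq:
  "point_ideal = (vdeg_ge (range Some) 1 :: ('n::finite option, 'k::field) mpoly set)"
  unfolding point_ideal_def using ideal_gen_vars[of "range Some"] by (simp add: image_image)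

lemma point_ideal_iff:
  "(f :: ('n::finite option, 'k::field) mpoly) \<in> point_ideal \<longleftrightarrow> (\<forall>e. lookup f (single None e) = 0)"
proof -
  have "1 \<le> xdeg M \<longleftrightarrow> (\<forall>e. M \<noteq> single None e)" for M :: "'n option \<Rightarrow>\<^sub>0 nat"
  proof
    show "1 \<le> xdeg M \<Longrightarrow> \<forall>e. M \<noteq> single None e" by auto
    assume *: "\<forall>e. M \<noteq> single None e"
    show "1 \<le> xdeg M"
    proof (rule ccontr)
      assume "\<not> 1 \<le> xdeg M"
      then have "xpart M = 0" by (simp flip: mdeg_eq_0_iff)
      then have "M = single None (lookup M None)"
        by (intro option_exponent_eqI) auto
      with * show False by blast
    qed
  qed
  then have "f \<in> point_ideal \<longleftrightarrow> (\<forall>M\<in>keys f. \<forall>e. M \<noteq> single None e)"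
    by (simp add: vdeg_ge_def vdeg_range_Some point_ideal_eq)
  then show ?thesis by (metis in_keys_iff)
qed

section \<open>Prime ideals\<close>

lemma ideal_Union_chain:
  assumes "C \<noteq> {}" "\<And>K. K \<in> C \<Longrightarrow> is_ideal K" "\<And>K K'. K \<in> C \<Longrightarrow> K' \<in> C \<Longrightarrow> K \<subseteq> K' \<or> K' \<subseteq> K"
  shows "is_ideal (\<Union>C)"
proof (rule idealI)
  show "0 \<in> \<Union>C" using assms(1,2) ideal_zero by blast
  show "x + y \<in> \<Union>C" if "x \<in> \<Union>C" "y \<in> \<Union>C" for x y
  proof -
    from that obtain K K' where K: "K \<in> C" "x \<in> K" "K' \<in> C" "y \<in> K'" by blast
    from assms(3)[OF K(1,3)] show ?thesis
      using K ideal_add[OF assms(2)[OF K(1)], of x y] ideal_add[OF assms(2)[OF K(3)], of x y] by blast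
  qed
  show "c * x \<in> \<Union>C" if "x \<in> \<Union>C" for c x
    using that ideal_mult_left[OF assms(2)] by blast
qed

text \<open>Krull: an ideal that is maximal among those containing \<open>J\<close> but no power of \<open>x\<close> is prime. So elements
  contained in all primes over \<open>J\<close> are nilpotent modulo \<open>J\<close>.\<close>

lemma prime_ideal_avoiding:
  fixes J :: "'r::comm_ring_1 set"
  assumes J: "is_ideal J" and x: "\<And>k. x ^ k \<notin> J"
  obtains P where "prime_ideal P" "J \<subseteq> P" "x \<notin> P"
proof -
  let ?A = "{K. is_ideal K \<and> J \<subseteq> K \<and> (\<forall>k. x ^ k \<notin> K)}"
  have "\<exists>P\<in>?A. \<forall>K\<in>?A. P \<subseteq> K \<longrightarrow> K = P"
  proof (rule subset_Zorn_nonempty)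
    show "?A \<noteq> {}" using J x by blast
    fix C assume C: "C \<noteq> {}" "subset.chain ?A C"
    then have "is_ideal (\<Union>C)"
      by (intro ideal_Union_chain) (auto simp: subset.chain_def)
    then show "\<Union>C \<in> ?A" using C by (auto simp: subset.chain_def)
  qed
  then obtain P where PA: "P \<in> ?A" and max: "\<forall>K\<in>?A. P \<subseteq> K \<longrightarrow> K = P" by (rule bexE)
  from PA have P: "is_ideal P" "J \<subseteq> P" "\<And>k. x ^ k \<notin> P" by auto
  \<comment> \<open>By maximality, adjoining an element outside \<open>P\<close> captures a power of \<open>x\<close>.\<close>
  have power: "\<exists>k p r. p \<in> P \<and> x ^ k = p + r * a" if a: "a \<notin> P" for a
  proof -
    let ?K = "{p + r * a | p r. p \<in> P}"
    have K: "is_ideal ?K"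
    proof (rule idealI)
      show "0 \<in> ?K" using ideal_zero[OF P(1)] by (force intro: exI[of _ 0])
      fix y z assume "y \<in> ?K" "z \<in> ?K"
      then obtain p r p' r' where "y = p + r * a" "z = p' + r' * a" "p \<in> P" "p' \<in> P" by auto
      then have "y + z = (p + p') + (r + r') * a" "p + p' \<in> P"
        using ideal_add[OF P(1)] by (auto simp: algebra_simps)
      then show "y + z \<in> ?K" by blast
    next
      fix c y assume "y \<in> ?K"
      then obtain p r where "y = p + r * a" "p \<in> P" by auto
      then have "c * y = c * p + (c * r) * a" "c * p \<in> P"
        using ideal_mult_left[OF P(1), of p c] by (simp_all add: distrib_left mult.assoc)
      then show "c * y \<in> ?K" by blast
    qed
    have sub: "P \<subseteq> ?K"
    proof
      fix p assume "p \<in> P"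
      then show "p \<in> ?K" by (intro CollectI exI[of _ p] exI[of _ 0]) simp
    qed
    have "a \<in> ?K" using ideal_zero[OF P(1)] by (intro CollectI exI[of _ 0] exI[of _ 1]) simp
    then have "?K \<notin> ?A" using bspec[OF max, of ?K] sub a by auto
    then show ?thesis using K sub P(2) by blast
  qed
  have "prime_ideal P"
    unfolding prime_ideal_def
  proof (intro conjI allI impI)
    show "P \<noteq> UNIV" using P(3) by blast
    fix a b assume ab: "a * b \<in> P"
    show "a \<in> P \<or> b \<in> P"
    proof (rule ccontr)
      assume "\<not> (a \<in> P \<or> b \<in> P)"
      then obtain k p r l q t where *: "p \<in> P" "x ^ k = p + r * a" "q \<in> P" "x ^ l = q + t * b"
        using power[of a] power[of b] by blast
      have "x ^ (k + l) = (q + t * b) * p + (r * a) * q + (r * t) * (a * b)"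
        unfolding power_add * by (simp add: algebra_simps)
      then have "x ^ (k + l) \<in> P"
        using * ab by (auto intro!: ideal_add[OF P(1)] ideal_mult_left[OF P(1)])
      with P(3) show False by blast
    qed
  qed (rule P(1))
  moreover have "x \<notin> P" using P(3)[of 1] by simp
  ultimately show ?thesis using that P(2) by blast
qed

lemma prime_ideal_power: "prime_ideal P \<Longrightarrow> x ^ k \<in> P \<Longrightarrow> x \<in> P"
proof (induction k)
  case 0
  then have "1 \<in> P" by simp
  then have "a \<in> P" for a using 0 ideal_mult_left[of P 1 a] by (simp add: prime_ideal_def)
  then show ?case by blast
qed (auto simp: prime_ideal_def)

text \<open>A monomial of degree larger than \<open>\<Sum>v. e v\<close> has some exponent of at least \<open>e v\<close>.\<close>

lemma vdeg_ge_subset_if_var_powers: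
  fixes J :: "('v::finite, 'k::field) mpoly set"
  assumes J: "is_ideal J" and nil: "\<And>v. var v ^ e v \<in> J"
  shows "vdeg_ge UNIV (Suc (\<Sum>v\<in>UNIV. e v)) \<subseteq> J"
proof
  fix f :: "('v, 'k) mpoly" assume f: "f \<in> vdeg_ge UNIV (Suc (\<Sum>v\<in>UNIV. e v))"
  show "f \<in> J"
  proof (rule ideal_if_terms[OF J])
    fix m assume "m \<in> keys f"
    with f have m: "(\<Sum>v\<in>UNIV. e v) < mdeg m" by (auto simp: vdeg_ge_def vdeg_UNIV Suc_le_eq)
    obtain v where v: "e v \<le> lookup m v"
    proof (rule ccontr)
      assume "\<not> thesis"
      then have "\<And>v. lookup m v \<le> e v" using that by (metis nle_le)
      then have "mdeg m \<le> (\<Sum>v\<in>UNIV. e v)" unfolding mdeg_def by (rule sum_mono)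
      with m show False by simp
    qed
    have "m = (m - single v (e v)) + single v (e v)"
      by (rule poly_mapping_eqI) (use v in \<open>auto simp: lookup_add lookup_minus lookup_single when_def\<close>)
    then have "single m (lookup f m) = single (m - single v (e v)) (lookup f m) * var v ^ e v"
      by (simp add: var_power mult_single)
    then show "single m (lookup f m) \<in> J" using ideal_mult_left[OF J nil] by simp
  qed
qed

lemma nilpotent_if_concentrated:
  assumes "concentrated_at_origin (J :: ('n::finite, 'k::field) mpoly set)"
  obtains N where "ideal_power var_ideal N \<subseteq> J"
proof -
  have J: "is_ideal J" and primes: "\<And>P. prime_ideal P \<Longrightarrow> J \<subseteq> P \<Longrightarrow> P = var_ideal"
    using assms by (auto simp: concentrated_at_origin_def)
  have "\<exists>k. var v ^ k \<in> J" for v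
  proof (rule ccontr)
    assume "\<nexists>k. var v ^ k \<in> J"
    then obtain P where P: "prime_ideal P" "J \<subseteq> P" "var v \<notin> P"
      using prime_ideal_avoiding[OF J] by metis
    then show False
      using primes[OF P(1,2)] var_in_var_ideal by blast
  qed
  then obtain e where "\<And>v. var v ^ e v \<in> J" by metis
  from that[of "Suc (\<Sum>v\<in>UNIV. e v)"] show ?thesis
    unfolding var_ideal_power using vdeg_ge_subset_if_var_powers[OF J, of e, OF \<open>\<And>v. var v ^ e v \<in> J\<close>] by blast
qed

lemma prime_var_ideal_if_concentrated:
  "concentrated_at_origin (J :: ('n::finite, 'k::field) mpoly set) \<Longrightarrow>
   prime_ideal (var_ideal :: ('n, 'k) mpoly set) \<and> J \<subseteq> var_ideal"
  unfolding concentrated_at_origin_def by blast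

text \<open>A prime over \<open>J\<close> contains all variables, because \<open>J\<close> contains powers of them, and \<open>var_ideal\<close> is
  maximal, because a polynomial outside it differs from a unit by an element of it.\<close>

lemma concentratedI:
  fixes J :: "('n::finite, 'k::field) mpoly set"
  assumes J: "is_ideal J" and N: "ideal_power var_ideal N \<subseteq> J" and sub: "J \<subseteq> var_ideal"
    and prime: "prime_ideal (var_ideal :: ('n, 'k) mpoly set)"
  shows "concentrated_at_origin J"
proof -
  have "P = var_ideal" if P: "prime_ideal P" "J \<subseteq> P" for P
  proof
    have id: "is_ideal P" using P(1) by (simp add: prime_ideal_def)
    have "var v \<in> P" for v
    proof -
      have "(var v :: ('n, 'k) mpoly) ^ N \<in> ideal_power var_ideal N"
        by (auto simp: var_ideal_power vdeg_ge_def var_power vdeg_UNIV)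
      with N P(2) have "var v ^ N \<in> P" by blast
      then show ?thesis by (rule prime_ideal_power[OF P(1)])
    qed
    then show var: "var_ideal \<subseteq> P" unfolding var_ideal_def
      by (intro ideal_gen_least id) auto
    show "P \<subseteq> var_ideal"
    proof (rule ccontr)
      assume "\<not> P \<subseteq> var_ideal"
      then obtain f where "f \<in> P" "f \<notin> var_ideal" by blast
      then have f: "f \<in> P" "lookup f 0 \<noteq> 0" by (simp_all add: var_ideal_iff)
      have "f - single 0 (lookup f 0) \<in> P"
        using var by (rule subsetD) (simp add: var_ideal_iff lookup_minus)
      from ideal_diff[OF id f(1) this] have "single 0 (lookup f 0) \<in> P" by simp
      from ideal_mult_left[OF id this, of "single 0 (inverse (lookup f 0))"] f(2)
      have "1 \<in> P" by (simp add: mult_single single_0_one)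
      then have "a \<in> P" for a using ideal_mult_left[OF id, of 1 a] by simp
      with P(1) show False by (auto simp: prime_ideal_def)
    qed
  qed
  then show ?thesis
    using J sub prime by (auto simp: concentrated_at_origin_def)
qed

lemma var_ideal_power_antimono: "i \<le> j \<Longrightarrow> ideal_power (var_ideal :: ('v::finite, 'k::field) mpoly set) j \<subseteq> ideal_power var_ideal i"
  by (auto simp: var_ideal_power vdeg_ge_def)

lemma socle_degree:
  fixes J :: "('n::finite, 'k::field) mpoly set"
  assumes N: "ideal_power var_ideal N \<subseteq> J" and proper: "J \<noteq> UNIV"
  shows "ideal_power var_ideal i \<subseteq> J \<longleftrightarrow> socle_degree J < i"
proof -
  let ?P = "\<lambda>i. \<not> ideal_power var_ideal i \<subseteq> J"
  have bound: "i \<le> N" if "?P i" for i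
    using that N var_ideal_power_antimono[of N i] by (meson nle_le order_trans)
  have "?P 0" using proper by auto
  then have "?P (socle_degree J)"
    unfolding socle_degree_def by (rule GreatestI_nat) (rule bound)
  moreover have "i \<le> socle_degree J" if "?P i"
    unfolding socle_degree_def using that bound by (rule Greatest_le_nat)
  ultimately show ?thesis
    using var_ideal_power_antimono[of i "socle_degree J"] by (meson linorder_not_less order_trans)
qed

section \<open>Homogenization and dehomogenization\<close>

text \<open>The degree condition makes both truncation and the exponent of \<open>z\<close> implicit, which is why most
  identities below are proved by comparing these coefficients.\<close>

lemma lookup_homogenize:
  "lookup (homogenize u f) M = (if mdeg M = u then lookup f (xpart M) else 0)"
proof -
  let ?A = "{m \<in> keys f. mdeg m \<le> u}"
  have *: "ext_mono m (u - mdeg m) = M \<longleftrightarrow> m = xpart M \<and> mdeg M = u" if "m \<in> ?A" for m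
    using that mdeg_option[of M] ext_mono_xpart[of M] by auto
  have "lookup (homogenize u f) M = (\<Sum>m\<in>?A. if ext_mono m (u - mdeg m) = M then lookup f m else 0)"
    unfolding homogenize_def by (rule sum_singles_lookup) simp
  also have "\<dots> = (\<Sum>m\<in>?A. if m = xpart M then (if mdeg M = u then lookup f m else 0) else 0)"
    by (rule sum.cong) (auto simp: *)
  also have "\<dots> = (if mdeg M = u then lookup f (xpart M) else 0)"
    using mdeg_option[of M] by (auto simp: in_keys_iff)
  finally show ?thesis .
qed

lemma homogenize_in [simp]: "homogenize u f \<in> hom_part u"
  by (simp add: hom_part_iff lookup_homogenize)

lemma homogenize_add: "homogenize u (f + g) = homogenize u f + homogenize u g"
  by (rule poly_mapping_eqI) (simp add: lookup_homogenize lookup_add)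

lemma homogenize_0 [simp]: "homogenize u 0 = 0"
  by (rule poly_mapping_eqI) (simp add: lookup_homogenize)

lemma homogenize_kscale: "homogenize u (kscale c f) = kscale c (homogenize u f)"
  by (rule poly_mapping_eqI) (simp add: lookup_homogenize)

lemma dehomogenize_relabel: "dehomogenize F = relabel (Poly_Mapping.map_key Some) F"
  by (simp add: dehomogenize_def relabel_def)

lemma dehomogenize_add: "dehomogenize (F + G) = dehomogenize F + dehomogenize G"
  by (simp add: dehomogenize_relabel relabel_add)

lemma dehomogenize_0 [simp]: "dehomogenize 0 = 0"
  by (simp add: dehomogenize_relabel)

lemma dehomogenize_sum: "dehomogenize (sum f A) = (\<Sum>x\<in>A. dehomogenize (f x))"
  by (induction A rule: infinite_finite_induct) (simp_all add: dehomogenize_add)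

lemma dehomogenize_mult: "dehomogenize (F * G) = dehomogenize F * dehomogenize G"
  unfolding dehomogenize_relabel by (rule relabel_mult) simp

lemma dehomogenize_kscale: "dehomogenize (kscale c F) = kscale c (dehomogenize F)"
  unfolding dehomogenize_relabel by (rule relabel_kscale)

lemma dehomogenize_z_power [simp]: "dehomogenize (z_var ^ k) = 1"
  by (simp add: var_power dehomogenize_relabel single_0_one)

lemma inj_on_xpart: "inj_on (Poly_Mapping.map_key Some) {M :: 'n::finite option \<Rightarrow>\<^sub>0 nat. mdeg M = d}"
  by (rule inj_onI) (metis (mono_tags) mem_Collect_eq mdeg_option add_right_cancel option_exponent_eqI)

lemma lookup_dehomogenize_hom:
  assumes "F \<in> hom_part d"
  shows "lookup (dehomogenize F) m = (if mdeg m \<le> d then lookup F (ext_mono m (d - mdeg m)) else 0)"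
proof (cases "mdeg m \<le> d")
  case True
  have "lookup (relabel (Poly_Mapping.map_key Some) F) (xpart (ext_mono m (d - mdeg m)))
      = lookup F (ext_mono m (d - mdeg m))"
    by (rule lookup_relabel_inj, rule inj_on_subset[OF inj_on_xpart[of d]])
      (use assms True in \<open>auto simp: hom_part_def\<close>)
  then show ?thesis using True by (simp add: dehomogenize_relabel)
next
  case False
  have "m \<notin> keys (dehomogenize F)"
  proof
    assume "m \<in> keys (dehomogenize F)"
    then obtain M where "M \<in> keys F" "m = xpart M"
      using keys_relabel[of "Poly_Mapping.map_key Some" F] by (auto simp: dehomogenize_relabel)
    then show False using assms False mdeg_option[of M] by (auto simp: hom_part_def)
  qed
  then show ?thesis using False by (simp add: in_keys_iff)
qed

lemma homogenize_dehomogenize: "F \<in> hom_part d \<Longrightarrow> homogenize d (dehomogenize F) = F"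
  by (rule poly_mapping_eqI)
    (auto simp: lookup_homogenize lookup_dehomogenize_hom hom_part_iff mdeg_option ext_mono_xpart)

lemma dehomogenize_homogenize:
  assumes "\<And>m. m \<in> keys f \<Longrightarrow> mdeg m \<le> u"
  shows "dehomogenize (homogenize u f) = f"
proof (rule poly_mapping_eqI)
  fix m show "lookup (dehomogenize (homogenize u f)) m = lookup f m"
    using assms[of m]
    by (cases "lookup f m = 0")
      (simp_all add: lookup_dehomogenize_hom[OF homogenize_in] lookup_homogenize in_keys_iff)
qed

lemma total_deg_le_iff: "total_deg h \<le> u \<longleftrightarrow> (\<forall>m\<in>keys h. mdeg m \<le> u)"
  unfolding total_deg_def by simp

lemma dehomogenize_surj: "dehomogenize (homogenize (total_deg f) f) = f"
  by (rule dehomogenize_homogenize) (use total_deg_le_iff[of f "total_deg f"] in auto)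

lemma dehomogenize_degree: "F \<in> hom_part d \<Longrightarrow> m \<in> keys (dehomogenize F) \<Longrightarrow> mdeg m \<le> d"
  by (auto simp: in_keys_iff lookup_dehomogenize_hom split: if_splits)

definition deg_le :: "nat \<Rightarrow> ('v::finite, 'k::field) mpoly set" where
  "deg_le d = {f. \<forall>m\<in>keys f. mdeg m \<le> d}"

lemma subspace_deg_le: "kv.subspace (deg_le d :: ('v::finite, 'k::field) mpoly set)"
proof (rule kv.subspaceI)
  show "x + y \<in> deg_le d" if "x \<in> deg_le d" "y \<in> deg_le d" for x y :: "('v, 'k) mpoly"
    using that keys_add[of x y] by (auto simp: deg_le_def)
  show "kscale c x \<in> deg_le d" if "x \<in> deg_le d" for c and x :: "('v, 'k) mpoly"
    using that by (auto simp: deg_le_def in_keys_iff)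
qed (simp add: deg_le_def)

lemma lookup_z_mult:
  "lookup (z_var ^ k * F) M = (if k \<le> lookup M None then lookup F (M - single None k) else 0)"
proof (cases "k \<le> lookup M None")
  case True
  have "lookup (z_var ^ k * F) M = 1 * lookup F (M - single None k)"
    unfolding var_power by (subst (1) exponent_split_z[OF True]) (rule lookup_single_mult)
  then show ?thesis using True by simp
next
  case False
  have "M \<notin> keys (z_var ^ k * F)"
    using keys_single_mult[of "single None k" 1 F] False
    by (auto simp: var_power lookup_add)
  then show ?thesis using False by (simp add: in_keys_iff)
qed

lemma hom_component_hom_mult_cases:
  assumes "g \<in> hom_part i"
  shows "hom_component d (g * f) = (if i \<le> d then g * hom_component (d - i) f else (0 :: ('v::finite, 'k::field) mpoly))"
proof (cases "i \<le> d")
  case True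
  then show ?thesis using hom_component_hom_mult[OF assms, of "d - i" f] by simp
next
  case False
  have "lookup (g * f) m = 0" if "mdeg m = d" for m
  proof (rule ccontr)
    assume "lookup (g * f) m \<noteq> 0"
    then have "m \<in> keys (g * f)" by (simp add: in_keys_iff)
    then obtain a b where "m = a + b" "a \<in> keys g" using keys_mult[of g f] by blast
    then show False using that False assms by (auto simp: mdeg_add hom_part_def)
  qed
  then show ?thesis using False by (auto intro!: poly_mapping_eqI)
qed

section \<open>The homogeneous ideal of an affine ideal\<close>

text \<open>The polynomials whose components vanish on \<open>Spec(R'/J)\<close>. Membership is decided by components, hence
  by coefficients, which the definitions by generators do not provide.\<close>

definition forms_ideal :: "('n::finite, 'k::field) mpoly set \<Rightarrow> ('n option, 'k) mpoly set" where
  "forms_ideal J = {F. \<forall>d. dehomogenize (hom_component d F) \<in> J}"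

lemma forms_ideal_hom: "is_ideal J \<Longrightarrow> F \<in> hom_part d \<Longrightarrow> F \<in> forms_ideal J \<longleftrightarrow> dehomogenize F \<in> J"
  by (auto simp: forms_ideal_def hom_component_hom ideal_zero)

lemma graded_forms_ideal: "is_ideal J \<Longrightarrow> graded (forms_ideal J)"
  by (auto simp: graded_def forms_ideal_def hom_component_hom[OF hom_component_in] ideal_zero)

lemma is_ideal_forms_ideal:
  assumes J: "is_ideal (J :: ('n::finite, 'k::field) mpoly set)"
  shows "is_ideal (forms_ideal J)"
proof (rule idealI)
  show "0 \<in> forms_ideal J" by (simp add: forms_ideal_def ideal_zero[OF J])
  show add: "F + G \<in> forms_ideal J" if "F \<in> forms_ideal J" "G \<in> forms_ideal J" for F G
    using that by (auto simp: forms_ideal_def hom_component_add dehomogenize_add intro: ideal_add[OF J])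
  show "H * F \<in> forms_ideal J" if F: "F \<in> forms_ideal J" for H F
  proof (induction H rule: poly_mapping_induct_add)
    case (single M c)
    have "single M c \<in> hom_part (mdeg M)" by (simp add: single_in_hom_part)
    from hom_component_hom_mult_cases[OF this] show ?case
      using F by (auto simp: forms_ideal_def dehomogenize_mult ideal_zero[OF J] intro: ideal_mult_left[OF J])
  qed (auto simp: distrib_right add, simp add: forms_ideal_def ideal_zero[OF J])
qed

lemma graded_ideal_sum:
  assumes "is_ideal I" "\<And>d. hom_component d F \<in> I"
  shows "F \<in> I"
  using ideal_sum[OF assms(1), of "mdeg ` keys F" "\<lambda>d. hom_component d F"] assms(2)
  by (simp flip: sum_hom_components_keys)

text \<open>Enough forms to contain each homogeneous component generate the ideal; this serves the comparison
  with both sets of generators.\<close>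

lemma forms_ideal_in_span:
  assumes J: "is_ideal (J :: ('n::finite, 'k::field) mpoly set)"
    and G: "\<And>F d. F \<in> hom_part d \<Longrightarrow> dehomogenize F \<in> J \<Longrightarrow> F \<in> G"
  shows "forms_ideal J \<subseteq> ideal_gen G"
proof
  fix F assume F: "F \<in> forms_ideal J"
  show "F \<in> ideal_gen G"
  proof (rule graded_ideal_sum[OF ideal_gen_ideal])
    show "hom_component d F \<in> ideal_gen G" for d
      by (rule ideal_gen_base, rule G[OF hom_component_in]) (use F in \<open>simp add: forms_ideal_def\<close>)
  qed
qed

lemma scheme_ideal_eq:
  assumes J: "is_ideal (J :: ('n::finite, 'k::field) mpoly set)"
  shows "scheme_ideal J = forms_ideal J"
proof
  show "scheme_ideal J \<subseteq> forms_ideal J"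
    unfolding scheme_ideal_def
    by (rule ideal_gen_least[OF _ is_ideal_forms_ideal[OF J]]) (auto simp: forms_ideal_hom[OF J])
  show "forms_ideal J \<subseteq> scheme_ideal J"
    unfolding scheme_ideal_def by (rule forms_ideal_in_span[OF J]) auto
qed

lemma Homog_ideal_eq:
  assumes J: "is_ideal (J :: ('n::finite, 'k::field) mpoly set)"
  shows "Homog_ideal J = forms_ideal J"
proof
  show "Homog_ideal J \<subseteq> forms_ideal J"
    unfolding Homog_ideal_def
    by (rule ideal_gen_least[OF _ is_ideal_forms_ideal[OF J]])
      (auto simp: forms_ideal_hom[OF J homogenize_in] dehomogenize_homogenize total_deg_le_iff)
  show "forms_ideal J \<subseteq> Homog_ideal J"
    unfolding Homog_ideal_def
  proof (rule forms_ideal_in_span[OF J], intro CollectI)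
    fix F :: "('n option, 'k) mpoly" and d
    assume "F \<in> hom_part d" "dehomogenize F \<in> J"
    then show "\<exists>u h. F = homogenize u h \<and> h \<in> J \<and> total_deg h \<le> u"
      by (intro exI[of _ d] exI[of _ "dehomogenize F"])
        (auto simp: homogenize_dehomogenize total_deg_le_iff dehomogenize_degree)
  qed
qed

lemma dehomogenize_forms_ideal:
  assumes J: "is_ideal (J :: ('n::finite, 'k::field) mpoly set)"
  shows "dehomogenize ` forms_ideal J = J"
proof
  show "dehomogenize ` forms_ideal J \<subseteq> J"
  proof safe
    fix F assume F: "F \<in> forms_ideal J"
    have "dehomogenize F = (\<Sum>d\<in>mdeg ` keys F. dehomogenize (hom_component d F))"
      by (simp flip: sum_hom_components_keys dehomogenize_sum)
    also have "\<dots> \<in> J" using F by (intro ideal_sum[OF J]) (simp add: forms_ideal_def)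
    finally show "dehomogenize F \<in> J" .
  qed
  show "J \<subseteq> dehomogenize ` forms_ideal J"
  proof
    fix h assume "h \<in> J"
    then show "h \<in> dehomogenize ` forms_ideal J"
      by (metis dehomogenize_surj forms_ideal_hom[OF J homogenize_in] imageI)
  qed
qed

text \<open>Multiplication by \<open>z\<close> shifts the components but not their dehomogenizations.\<close>

lemma z_power_mult_in_forms_ideal:
  assumes J: "is_ideal (J :: ('n::finite, 'k::field) mpoly set)"
  shows "z_var ^ k * F \<in> forms_ideal J \<longleftrightarrow> F \<in> forms_ideal J"
proof
  assume "z_var ^ k * F \<in> forms_ideal J"
  then have "dehomogenize (hom_component (k + d) (z_var ^ k * F)) \<in> J" for d
    by (simp add: forms_ideal_def)
  then show "F \<in> forms_ideal J"
    by (simp add: forms_ideal_def hom_component_hom_mult[OF var_power_in] dehomogenize_mult)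
qed (rule ideal_mult_left[OF is_ideal_forms_ideal[OF J]])

text \<open>For a form \<open>F\<close> of degree \<open>b\<close>, the form \<open>homogenize a (dehomogenize F)\<close> collects the terms
  of degree at most \<open>a\<close> in the \<open>x\<^sub>i\<close>, divided by the power \<open>z^(b-a)\<close>.\<close>

lemma high_terms:
  assumes F: "F \<in> hom_part b" and ab: "a \<le> b"
  shows "F - z_var ^ (b - a) * homogenize a (dehomogenize F)
    \<in> vdeg_ge (range Some) (Suc a) \<inter> (hom_part b :: ('n::finite option, 'k::field) mpoly set)"
proof
  let ?H = "F - z_var ^ (b - a) * homogenize a (dehomogenize F)"
  have "z_var ^ (b - a) * homogenize a (dehomogenize F) \<in> hom_part (b - a + a)"
    by (intro hom_part_mult var_power_in homogenize_in)
  then show H: "?H \<in> hom_part b" using F ab by (intro hom_part_diff) auto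
  have zero: "lookup ?H M = 0" if M: "mdeg M = b" "xdeg M \<le> a" for M
  proof -
    have N: "b - a \<le> lookup M None" using M mdeg_option[of M] ab by simp
    let ?M = "M - single None (b - a)"
    note eq = exponent_split_z[OF N]
    have x: "xpart ?M = xpart M" by (subst (2) eq) simp
    have deg: "mdeg ?M = a" using arg_cong[OF eq, of mdeg] M ab by (simp add: mdeg_add)
    have "b - xdeg M = lookup M None" using M mdeg_option[of M] by simp
    then have "lookup (dehomogenize F) (xpart M) = lookup F M"
      using M(2) ab by (simp add: lookup_dehomogenize_hom[OF F])
    then show ?thesis using N x deg by (simp add: lookup_minus lookup_z_mult lookup_homogenize)
  qed
  have "a < xdeg M" if M: "M \<in> keys ?H" for M
  proof (rule ccontr)
    assume "\<not> a < xdeg M"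
    moreover have "mdeg M = b" using M H by (simp add: hom_part_def)
    ultimately have "lookup ?H M = 0" by (intro zero) auto
    with M show False unfolding in_keys_iff by blast
  qed
  then show "?H \<in> vdeg_ge (range Some) (Suc a)"
    by (simp add: vdeg_ge_def vdeg_range_Some Suc_le_eq)
qed

lemma exponent_split_degree:
  assumes "a \<le> mdeg (m :: 'v::finite \<Rightarrow>\<^sub>0 nat)"
  obtains m1 m2 where "m = m1 + m2" "mdeg m2 = a"
  using assms
proof (induction a arbitrary: thesis)
  case 0
  from 0(1)[of m 0] show ?case by simp
next
  case (Suc a)
  obtain m1 m2 where m: "m = m1 + m2" "mdeg m2 = a" using Suc.IH Suc.prems(2) Suc_leD by blast
  then have "Suc 0 \<le> vdeg UNIV m1" using Suc.prems(2) by (simp add: vdeg_UNIV mdeg_add)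
  then obtain v m' where "m1 = single v 1 + m'" by (rule exponent_split_var)
  with m Suc.prems(1)[of m' "m2 + single v 1"] show ?case by (simp add: mdeg_add add_ac)
qed

text \<open>Here \<open>\<alpha>\<close> is any upper bound for the socle degree: for the ideals coming from an inverse system
  with bounded degree in the \<open>X\<^sub>i\<close> no more is known.\<close>

locale fat_point =
  fixes J :: "('n::finite, 'k::field) mpoly set" and \<alpha> :: nat
  assumes ideal_J: "is_ideal J"
    and nilpotent: "vdeg_ge UNIV (Suc \<alpha>) \<subseteq> J"
    and sub_origin: "J \<subseteq> var_ideal"
begin

abbreviation "I \<equiv> forms_ideal J"

lemmas ideal_I = is_ideal_forms_ideal[OF ideal_J]
  and graded_I = graded_forms_ideal[OF ideal_J]
  and I_hom = forms_ideal_hom[OF ideal_J]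
  and z_cancel = z_power_mult_in_forms_ideal[OF ideal_J]

lemma single_in_J: "\<alpha> < mdeg m \<Longrightarrow> single m c \<in> J"
  by (rule subsetD[OF nilpotent]) (auto simp: vdeg_ge_def vdeg_UNIV)

lemma point_power_sub: "vdeg_ge (range Some) (Suc \<alpha>) \<subseteq> I"
proof
  fix F assume F: "F \<in> (vdeg_ge (range Some) (Suc \<alpha>) :: ('n option, 'k) mpoly set)"
  have "dehomogenize (hom_component d F) \<in> vdeg_ge UNIV (Suc \<alpha>)" for d
    unfolding vdeg_ge_def
  proof (intro CollectI ballI)
    fix m assume "m \<in> keys (dehomogenize (hom_component d F))"
    then obtain M where "M \<in> keys (hom_component d F)" "m = xpart M"
      using keys_relabel[of "Poly_Mapping.map_key Some" "hom_component d F"]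
      by (auto simp: dehomogenize_relabel)
    then show "Suc \<alpha> \<le> vdeg UNIV m"
      using F by (auto simp: vdeg_ge_def in_keys_iff vdeg_range_Some vdeg_UNIV split: if_splits)
  qed
  then show "F \<in> I" using nilpotent by (auto simp: forms_ideal_def)
qed

lemma I_sub_point: "I \<subseteq> point_ideal"
proof
  fix F assume F: "F \<in> I"
  have "lookup F (single None e) = 0" for e
  proof -
    have eq: "ext_mono 0 e = (single None e :: 'n option \<Rightarrow>\<^sub>0 nat)"
      by (rule option_exponent_eqI) auto
    have "dehomogenize (hom_component e F) \<in> var_ideal"
      using F sub_origin by (auto simp: forms_ideal_def)
    then have "lookup (dehomogenize (hom_component e F)) 0 = 0" by (simp only: var_ideal_iff)
    then show ?thesis by (simp add: lookup_dehomogenize_hom[OF hom_component_in] eq)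
  qed
  then show "F \<in> point_ideal" by (simp add: point_ideal_iff)
qed

lemma one_notin_I: "1 \<notin> I"
proof
  assume "1 \<in> I"
  then have "lookup (1 :: ('n option, 'k) mpoly) (single None 0) = 0"
    using I_sub_point point_ideal_iff by blast
  then show False by (simp add: lookup_one)
qed

text \<open>Otherwise the leading term of \<open>q\<close> times the component of \<open>a\<close> of largest degree outside \<open>I\<close> would be
  in \<open>I\<close>, and cancelling \<open>z\<close> gives a contradiction.\<close>

lemma z_polynomial_nonzerodivisor:
  assumes q: "\<And>M. M \<in> keys q \<Longrightarrow> xpart M = 0" "q \<noteq> 0" and qa: "q * a \<in> I"
  shows "a \<in> I"
proof (rule ccontr)
  assume a: "a \<notin> I"
  let ?D = "{d. hom_component d a \<notin> I}"
  have "?D \<subseteq> mdeg ` keys a"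
  proof safe
    fix d assume "hom_component d a \<notin> I"
    then have "hom_component d a \<noteq> 0" using ideal_zero[OF ideal_I] by metis
    then obtain m where "lookup (hom_component d a) m \<noteq> 0" by (metis poly_mapping_eqI lookup_zero)
    then show "d \<in> mdeg ` keys a" by (auto simp: in_keys_iff split: if_splits)
  qed
  then have finD: "finite ?D" by (rule finite_subset) simp
  have neD: "?D \<noteq> {}" using a graded_ideal_sum[OF ideal_I] by blast
  define D where "D = Max ?D"
  have D: "hom_component D a \<notin> I" "\<And>d. D < d \<Longrightarrow> hom_component d a \<in> I"
    using Max_in[OF finD neD] Max_ge[OF finD] unfolding D_def by (auto simp: not_less[symmetric])
  define N where "N = Max ((\<lambda>M. lookup M None) ` keys q)"
  have ne: "keys q \<noteq> {}" using q(2) by (auto intro: poly_mapping_eqI simp: in_keys_iff)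
  have "N \<in> (\<lambda>M. lookup M None) ` keys q"
    unfolding N_def by (rule Max_in) (use ne in auto)
  then obtain M0 where M0: "M0 \<in> keys q" "lookup M0 None = N" by auto
  have le: "lookup M None \<le> N" if "M \<in> keys q" for M
    unfolding N_def using that by (intro Max_ge) auto
  have M: "M = single None (lookup M None)" if "M \<in> keys q" for M
    using q(1)[OF that] by (intro option_exponent_eqI) auto
  have summand: "hom_component (N + D) (single M (lookup q M) * a)
      = single M (lookup q M) * hom_component (N + D - lookup M None) a" if "M \<in> keys q" for M
  proof -
    have "single M (lookup q M) \<in> hom_part (lookup M None)"
      using q(1)[OF that] mdeg_option[of M] by (simp add: single_in_hom_part)
    from hom_component_hom_mult_cases[OF this] show ?thesis using le[OF that] by simp
  qed
  have "hom_component (N + D) (q * a) = hom_component (N + D) ((\<Sum>M\<in>keys q. single M (lookup q M)) * a)"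
    by (simp flip: poly_mapping_sum_singles)
  also have "\<dots> = (\<Sum>M\<in>keys q. single M (lookup q M) * hom_component (N + D - lookup M None) a)"
    unfolding sum_distrib_right hom_component_sum by (rule sum.cong[OF refl summand])
  also have "\<dots> = single M0 (lookup q M0) * hom_component D a +
      (\<Sum>M\<in>keys q - {M0}. single M (lookup q M) * hom_component (N + D - lookup M None) a)"
    using M0 by (simp add: sum.remove[of _ M0])
  finally have eq: "hom_component (N + D) (q * a) = \<dots>" .
  have rest: "(\<Sum>M\<in>keys q - {M0}. single M (lookup q M) * hom_component (N + D - lookup M None) a) \<in> I"
  proof (intro ideal_sum[OF ideal_I] ideal_mult_left[OF ideal_I] D(2))
    fix M' assume M': "M' \<in> keys q - {M0}"
    then have "lookup M' None \<noteq> N" using M[of M'] M[of M0] M0 by auto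
    then show "D < N + D - lookup M' None" using le[of M'] M' by simp
  qed
  have "hom_component (N + D) (q * a) \<in> I" using qa graded_I by (simp add: graded_def)
  from ideal_diff[OF ideal_I this rest] have "single M0 (lookup q M0) * hom_component D a \<in> I"
    unfolding eq by simp
  then have "single 0 (inverse (lookup q M0)) * (single M0 (lookup q M0) * hom_component D a) \<in> I"
    by (rule ideal_mult_left[OF ideal_I])
  moreover have "single 0 (inverse (lookup q M0)) * (single M0 (lookup q M0) * hom_component D a)
      = z_var ^ N * hom_component D a"
    using M0 M[of M0] by (simp add: var_power mult_single in_keys_iff flip: mult.assoc)
  ultimately show False using D(1) by (simp add: z_cancel)
qed

text \<open>Write \<open>b\<close> as a nonzero polynomial \<open>p\<close> in \<open>z\<close> minus \<open>m\<close> with \<open>m \<in> m\<^sub>p\<close>. Modulo \<open>I\<close> multiplication by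
  \<open>b\<close> kills \<open>a\<close>, so \<open>p\<close> and \<open>m\<close> act on \<open>a\<close> in the same way, and \<open>m\<close> is nilpotent. Hence a power of \<open>p\<close>
  kills \<open>a\<close>, and \<open>a\<close> lies in \<open>I\<close>.\<close>

lemma nonzerodivisor:
  assumes b: "b \<notin> point_ideal" and ab: "a * b \<in> I"
  shows "a \<in> I"
proof -
  \<comment> \<open>The part of \<open>b\<close> in \<open>z\<close> alone, which is nonzero since \<open>b\<close> is not in \<open>m\<^sub>p\<close>.\<close>
  define p where "p = (\<Sum>M\<in>{M \<in> keys b. xpart M = 0}. single M (lookup b M))"
  have p: "lookup p M = (if xpart M = 0 then lookup b M else 0)" for M
    unfolding p_def by (subst sum_singles_lookup) (auto simp: in_keys_iff)
  have keys_p: "\<And>M. M \<in> keys p \<Longrightarrow> xpart M = 0" by (auto simp: in_keys_iff p split: if_splits)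
  have "p \<noteq> 0"
  proof
    assume "p = 0"
    then have "lookup b (single None e) = 0" for e using p[of "single None e"] by simp
    with b show False by (simp add: point_ideal_iff)
  qed
  define m where "m = p - b"
  have m: "m ^ j \<in> vdeg_ge (range Some) j" for j
    by (rule vdeg_ge_power)
      (auto simp: vdeg_ge_def m_def in_keys_iff lookup_minus p vdeg_range_Some Suc_le_eq
        simp flip: neq0_conv split: if_splits)
  have "p ^ j * a - m ^ j * a \<in> I" for j
  proof (induction j)
    case (Suc j)
    have "p ^ Suc j * a - m ^ Suc j * a = p * (p ^ j * a - m ^ j * a) + m ^ j * (a * b)"
      by (simp add: m_def algebra_simps)
    also have "\<dots> \<in> I" by (intro ideal_add[OF ideal_I] ideal_mult_left[OF ideal_I] Suc ab)
    finally show ?case .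
  qed (simp add: ideal_zero[OF ideal_I])
  moreover have "m ^ Suc \<alpha> * a \<in> I"
    using ideal_mult_left[OF ideal_I subsetD[OF point_power_sub m], of a] by (simp only: mult.commute)
  ultimately have "p ^ Suc \<alpha> * a \<in> I"
    using ideal_add[OF ideal_I, of "p ^ Suc \<alpha> * a - m ^ Suc \<alpha> * a" "m ^ Suc \<alpha> * a"] by (simp del: power_Suc)
  moreover have "p ^ j * a \<in> I \<Longrightarrow> a \<in> I" for j
  proof (induction j)
    case (Suc j)
    then show ?case
      using z_polynomial_nonzerodivisor[OF keys_p \<open>p \<noteq> 0\<close>, of "p ^ j * a"] by (simp add: mult.assoc)
  qed simp
  ultimately show ?thesis by blast
qed

lemma radical_I: "radical I = point_ideal"
proof
  show "point_ideal \<subseteq> radical I"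
  proof
    fix f :: "('n option, 'k) mpoly" assume f: "f \<in> point_ideal"
    then have "f ^ j \<in> vdeg_ge (range Some) j" for j
      unfolding point_ideal_eq by (rule vdeg_ge_power)
    then show "f \<in> radical I" using point_power_sub by (auto simp: radical_def)
  qed
  show "radical I \<subseteq> point_ideal"
  proof
    fix f assume "f \<in> radical I"
    then obtain k where k: "f ^ k \<in> I" by (auto simp: radical_def)
    show "f \<in> point_ideal"
    proof (rule ccontr)
      assume f: "f \<notin> point_ideal"
      from k show False
      proof (induction k)
        case (Suc k)
        from Suc.prems have "f ^ k * f \<in> I" by (simp add: mult.commute)
        from Suc.IH[OF nonzerodivisor[OF f this]] show ?case .
      qed (use one_notin_I in simp)
    qed
  qed
qed

lemma primary_I: "primary_ideal I"
  unfolding primary_ideal_def radical_I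
  using ideal_I one_notin_I nonzerodivisor by blast

text \<open>If a component \<open>Q\<close> had the irrelevant ideal as radical, a power of \<open>z\<close> would carry the intersection of
  the other components into \<open>I\<close>; cancelling it shows that \<open>Q\<close> is redundant.\<close>

lemma saturated_I: "saturated I"
  unfolding saturated_def
proof (intro conjI allI impI ballI ideal_I graded_I)
  fix D Q assume D: "primary_decomposition I D" and Q: "Q \<in> D"
  show "radical Q \<noteq> var_ideal"
  proof
    assume "radical Q = var_ideal"
    then have "z_var \<in> radical Q" using var_in_var_ideal by blast
    then obtain k where k: "z_var ^ k \<in> Q" by (auto simp: radical_def)
    have ids: "is_ideal Q'" if "Q' \<in> D" for Q'
      using D that by (auto simp: primary_decomposition_def primary_ideal_def)
    have Inter: "\<Inter>D = I" and irredundant: "\<not> \<Inter>(D - {Q}) \<subseteq> Q"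
      using D Q by (simp_all add: primary_decomposition_def)
    from irredundant obtain a where a: "a \<in> \<Inter>(D - {Q})" "a \<notin> Q" by blast
    have "z_var ^ k * a \<in> Q'" if "Q' \<in> D" for Q'
    proof (cases "Q' = Q")
      case True
      then show ?thesis using ideal_mult_left[OF ids[OF Q] k, of a] by (simp add: mult.commute)
    next
      case False
      then show ?thesis using a(1) that ideal_mult_left[OF ids[OF that]] by blast
    qed
    then have "z_var ^ k * a \<in> I" unfolding Inter[symmetric] by blast
    then have "a \<in> I" by (simp add: z_cancel)
    then show False using Q a(2) unfolding Inter[symmetric] by blast
  qed
qed

lemma piece_I_quotient:
  assumes "a \<le> b"
  shows "piece I a = {h \<in> hom_part a. z_var ^ (b - a) * h \<in> piece I b}"
  using assms hom_part_mult[OF var_power_in[of None "b - a"], of _ a] by (auto simp: piece_def z_cancel)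

lemma piece_I_quotient_all:
  assumes "a \<le> b"
  shows "piece I a = {h \<in> hom_part a. \<forall>g\<in>hom_part (b - a). g * h \<in> piece I b}"
proof
  show "piece I a \<subseteq> {h \<in> hom_part a. \<forall>g\<in>hom_part (b - a). g * h \<in> piece I b}"
    using assms hom_part_mult[of _ "b - a" _ a] ideal_mult_left[OF ideal_I] by (fastforce simp: piece_def)
  show "{h \<in> hom_part a. \<forall>g\<in>hom_part (b - a). g * h \<in> piece I b} \<subseteq> piece I a"
    using var_power_in by (subst piece_I_quotient[OF assms]) auto
qed

text \<open>Subtracting its high terms from a form shows that it is a multiple of a power of \<open>z\<close> modulo \<open>I\<close>.\<close>

lemma reduce_degree:
  assumes "F \<in> hom_part b" "\<alpha> \<le> a" "a \<le> b"
  obtains G H where "F = z_var ^ (b - a) * G + H" "G \<in> hom_part a" "F \<in> I \<longleftrightarrow> G \<in> I"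
    "H \<in> vdeg_ge (range Some) (Suc a)" "H \<in> hom_part b" "H \<in> I"
proof
  let ?G = "homogenize a (dehomogenize F)"
  let ?H = "F - z_var ^ (b - a) * ?G"
  show H: "?H \<in> vdeg_ge (range Some) (Suc a)" "?H \<in> hom_part b"
    using high_terms[OF assms(1,3)] by auto
  show I: "?H \<in> I"
    by (rule subsetD[OF point_power_sub]) (use H(1) assms(2) in \<open>auto simp: vdeg_ge_def\<close>)
  have "F \<in> I \<longleftrightarrow> z_var ^ (b - a) * ?G \<in> I"
    using ideal_add[OF ideal_I I, of "z_var ^ (b - a) * ?G"] ideal_diff[OF ideal_I _ I, of F] by auto
  then show "F \<in> I \<longleftrightarrow> ?G \<in> I" by (simp add: z_cancel)
qed simp_all

lemma piece_I_decomposition: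
  assumes b: "\<alpha> \<le> b"
  shows "piece I b = z_var ^ (b - \<alpha>) *o piece I \<alpha> + piece (ideal_power point_ideal (\<alpha> + 1)) b"
proof (intro subset_antisym subsetI)
  fix F assume F: "F \<in> piece I b"
  then obtain G H where "F = z_var ^ (b - \<alpha>) * G + H" "G \<in> piece I \<alpha>"
    "H \<in> vdeg_ge (range Some) (Suc \<alpha>)" "H \<in> hom_part b"
    using reduce_degree[of F b \<alpha>] b unfolding piece_def by (metis Int_iff order_refl)
  then show "F \<in> z_var ^ (b - \<alpha>) *o piece I \<alpha> + piece (ideal_power point_ideal (\<alpha> + 1)) b"
    unfolding point_ideal_power Suc_eq_plus1[symmetric]
    by (auto simp: piece_def intro!: set_plus_intro set_times_intro2)
next
  fix F assume "F \<in> z_var ^ (b - \<alpha>) *o piece I \<alpha> + piece (ideal_power point_ideal (\<alpha> + 1)) b"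
  then obtain G H where F: "F = z_var ^ (b - \<alpha>) * G + H" "G \<in> I" "G \<in> hom_part \<alpha>"
    "H \<in> vdeg_ge (range Some) (Suc \<alpha>)" "H \<in> hom_part b"
    unfolding point_ideal_power Suc_eq_plus1[symmetric]
    by (auto simp: set_plus_def elt_set_times_def piece_def)
  have "z_var ^ (b - \<alpha>) * G \<in> hom_part b"
    using hom_part_mult[OF var_power_in[of None "b - \<alpha>"] F(3)] b by simp
  then show "F \<in> piece I b"
    unfolding piece_def F(1) using F(2-5) point_power_sub
    by (auto intro!: ideal_add[OF ideal_I] hom_part_add simp: z_cancel)
qed

text \<open>The multiples of a power of \<open>z\<close> come from degree \<open>a\<close>, and a monomial with more than \<open>a\<close> factors \<open>x\<^sub>i\<close>
  is divisible by one of degree \<open>a\<close> in the \<open>x\<^sub>i\<close> alone; that lies in \<open>I\<close> because \<open>a\<close> exceeds \<open>\<alpha>\<close>.\<close>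

lemma piece_I_generated:
  assumes a: "\<alpha> + 1 \<le> a" and ab: "a \<le> b"
  shows "piece I b = kv.span {g * h | g h. g \<in> hom_part (b - a) \<and> h \<in> piece I a}" (is "_ = kv.span ?S")
proof
  show "kv.span ?S \<subseteq> piece I b"
  proof (rule kv.span_minimal)
    show "?S \<subseteq> piece I b"
      using hom_part_mult[of _ "b - a" _ a] ab ideal_mult_left[OF ideal_I] by (fastforce simp: piece_def)
    show "kv.subspace (piece I b)"
      unfolding piece_def by (intro kv.subspace_inter ideal_subspace ideal_I subspace_hom_part)
  qed
  show "piece I b \<subseteq> kv.span ?S"
  proof
    fix F assume F: "F \<in> piece I b"
    then obtain G H where GH: "F = z_var ^ (b - a) * G + H" "G \<in> piece I a"
      "H \<in> vdeg_ge (range Some) (Suc a)" "H \<in> hom_part b"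
      using reduce_degree[of F b a] a ab unfolding piece_def by (metis Int_iff add_leD1)
    have "z_var ^ (b - a) * G \<in> kv.span ?S"
      using GH(2) var_power_in by (intro kv.span_base) blast
    moreover have "(\<Sum>M\<in>keys H. single M (lookup H M)) \<in> kv.span ?S"
    proof (intro kv.span_sum kv.span_base)
      fix M assume M: "M \<in> keys H"
      then have deg: "Suc a \<le> xdeg M" "mdeg M = b"
        using GH(3,4) by (auto simp: vdeg_ge_def vdeg_range_Some hom_part_def)
      then obtain m1 m2 where m: "xpart M = m1 + m2" "mdeg m2 = a"
        using exponent_split_degree[of a "xpart M"] by auto
      have split: "M = ext_mono m1 (lookup M None) + ext_mono m2 0"
        by (rule option_exponent_eqI) (simp_all add: m lookup_add)
      have "single (ext_mono m2 0) 1 \<in> vdeg_ge (range Some) (Suc \<alpha>)"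
        using a m(2) by (simp add: vdeg_ge_def vdeg_range_Some)
      then have "single (ext_mono m2 0) 1 \<in> piece I a"
        using point_power_sub m(2) by (auto simp: piece_def single_in_hom_part)
      moreover have "single (ext_mono m1 (lookup M None)) (lookup H M) \<in> hom_part (b - a)"
      proof -
        have "lookup M None + mdeg m1 = b - a" using deg m mdeg_option[of M] by (simp add: mdeg_add)
        then show ?thesis by (simp add: single_in_hom_part)
      qed
      moreover have "single M (lookup H M)
          = single (ext_mono m1 (lookup M None)) (lookup H M) * single (ext_mono m2 0) 1"
        by (subst (1) split) (simp add: mult_single)
      ultimately show "single M (lookup H M) \<in> ?S" by blast
    qed
    ultimately show "F \<in> kv.span ?S"
      unfolding GH(1) by (intro kv.span_add) (simp_all flip: poly_mapping_sum_singles)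
  qed
qed

end

section \<open>Inverse systems\<close>

lemma lookup_contract_relabel:
  "lookup (contract (relabel \<sigma> h) f) V = (\<Sum>K\<in>keys h. lookup h K * lookup f (V + \<sigma> K))"
  unfolding relabel_def contract_sum_left
  by (simp add: lookup_sum lookup_contract_pair mult_single)

text \<open>Homogenization intertwines the two contraction actions. Since \<open>z\<close> dehomogenizes to \<open>1\<close>, it lowers the
  degree in which \<open>f\<close> is homogenized.\<close>

lemma contract_homogenize:
  assumes h: "h \<in> hom_part d"
  shows "contract h (homogenize u f) = (if d \<le> u then homogenize (u - d) (contract (dehomogenize h) f) else 0)"
proof (rule poly_mapping_eqI)
  fix V
  have "lookup (contract h (homogenize u f)) V
      = (\<Sum>K\<in>keys h. if mdeg V + d = u then lookup h K * lookup f (xpart V + xpart K) else 0)"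
    unfolding lookup_contract
    by (rule sum.cong) (use h in \<open>auto simp: lookup_homogenize mdeg_add hom_part_def\<close>)
  also have "\<dots> = (if mdeg V + d = u then lookup (contract (dehomogenize h) f) (xpart V) else 0)"
    by (simp add: dehomogenize_relabel lookup_contract_relabel)
  finally show "lookup (contract h (homogenize u f)) V
      = lookup (if d \<le> u then homogenize (u - d) (contract (dehomogenize h) f) else 0) V"
    by (auto simp: lookup_homogenize)
qed

lemma contract_z_power_homogenize:
  "a \<le> b \<Longrightarrow> contract (z_var ^ (b - a)) (homogenize b f) = homogenize a f"
  by (simp add: contract_homogenize[OF var_power_in])

lemma pair_eq_lookup_contract: "pair h F = lookup (contract h F) 0"
  by (simp add: lookup_contract_pair single_0_one)

lemma perp_iff_pair:
  assumes "is_ideal J"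
  shows "F \<in> perp J \<longleftrightarrow> (\<forall>h\<in>J. pair h F = 0)"
proof
  assume "\<forall>h\<in>J. pair h F = 0"
  then show "F \<in> perp J"
    unfolding perp_def using ideal_mult_left[OF assms]
    by (auto intro!: poly_mapping_eqI simp: lookup_contract_pair)
qed (simp add: perp_def pair_eq_lookup_contract)

lemma subspace_perp: "kv.subspace (perp J)"
  by (rule kv.subspaceI) (auto simp: perp_def contract_add_right contract_kscale_right)

lemma hom_component_contract:
  assumes "h \<in> hom_part d"
  shows "hom_component e (contract h F) = contract h (hom_component (e + d) F)"
proof (rule poly_mapping_eqI)
  fix V
  have "lookup (contract h (hom_component (e + d) F)) V
      = (\<Sum>K\<in>keys h. if mdeg V = e then lookup h K * lookup F (V + K) else 0)"
    unfolding lookup_contract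
    by (rule sum.cong) (use assms in \<open>auto simp: mdeg_add hom_part_def\<close>)
  then show "lookup (hom_component e (contract h F)) V = lookup (contract h (hom_component (e + d) F)) V"
    by (simp add: lookup_contract)
qed

lemma hom_component_contract_hom:
  assumes F: "F \<in> hom_part u" and j: "j \<le> u"
  shows "hom_component (u - j) (contract h F) = contract (hom_component j h) F"
proof (induction h rule: poly_mapping_induct_add)
  case (single m c)
  have "single m c \<in> hom_part (mdeg m)" by (simp add: single_in_hom_part)
  then show ?case
    using j by (auto simp: hom_component_contract hom_component_hom[OF F] hom_component_hom)
qed (simp_all add: hom_component_add contract_add_left)

lemma contract_hom_zero:
  assumes "h \<in> hom_part d" "F \<in> hom_part u" "u < d"
  shows "contract h F = 0"
proof (rule poly_mapping_eqI)
  fix V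
  have zero: "lookup h K * lookup F (V + K) = 0" if "K \<in> keys h" for K
  proof -
    have "mdeg K = d" using assms(1) that by (simp add: hom_part_def)
    then show ?thesis using assms(2,3) by (simp add: hom_part_iff mdeg_add)
  qed
  show "lookup (contract h F) V = lookup 0 V"
    unfolding lookup_contract lookup_zero by (rule sum.neutral) (use zero in blast)
qed

text \<open>A form of degree \<open>d\<close> contracts the component of degree \<open>e + d\<close> to the component of degree
  \<open>e\<close>, so that annihilation can be tested on components.\<close>

lemma contract_hom_eq_0_iff:
  assumes "h \<in> hom_part d"
  shows "contract h F = 0 \<longleftrightarrow> (\<forall>u. contract h (hom_component u F) = 0)"
proof
  assume *: "contract h F = 0"
  show "\<forall>u. contract h (hom_component u F) = 0"
  proof
    fix u show "contract h (hom_component u F) = 0"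
    proof (cases "d \<le> u")
      case True
      then show ?thesis using hom_component_contract[OF assms, of "u - d" F] * by simp
    qed (simp add: contract_hom_zero[OF assms hom_component_in])
  qed
next
  assume *: "\<forall>u. contract h (hom_component u F) = 0"
  have "contract h F = contract h (\<Sum>u\<in>mdeg ` keys F. hom_component u F)"
    by (simp flip: sum_hom_components_keys)
  then show "contract h F = 0" by (simp add: contract_sum_right *)
qed

lemma contract_zero_if_components:
  "(\<And>d. contract (hom_component d h) F = 0) \<Longrightarrow> contract h F = 0"
  using contract_sum_left[of "\<lambda>d. hom_component d h" "mdeg ` keys h" F]
  by (simp flip: sum_hom_components_keys)

lemma graded_perp:
  assumes "graded I" "F \<in> perp I"
  shows "hom_component u F \<in> perp I"
  unfolding perp_def
proof safe
  fix h assume "h \<in> I"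
  then have "contract (hom_component d h) F = 0" for d
    using assms by (auto simp: graded_def perp_def)
  then have "\<forall>u. contract (hom_component d h) (hom_component u F) = 0" for d
    by (rule contract_hom_eq_0_iff[OF hom_component_in, THEN iffD1])
  then have "contract (hom_component d h) (hom_component u F) = 0" for d by blast
  then show "contract h (hom_component u F) = 0" by (rule contract_zero_if_components)
qed

lemma kv_subspace_components:
  assumes "kv.subspace V" "\<And>u. hom_component u F \<in> V"
  shows "F \<in> V"
  using kv.subspace_sum[OF assms(1), of "mdeg ` keys F" "\<lambda>d. hom_component d F"] assms(2)
  by (simp flip: sum_hom_components_keys)

lemma Homog_part_subspace:
  assumes "kv.subspace L'"
  shows "Homog_part L' u = homogenize u ` L'"
proof -
  have lin: "Vector_Spaces.linear kscale kscale (homogenize u)"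
    by unfold_locales (simp_all add: homogenize_add homogenize_kscale)
  then show ?thesis
    unfolding Homog_part_def
    by (simp only: kv2.linear_span_image[OF lin] kv.span_eq_iff[THEN iffD2, OF assms])
qed

text \<open>Raising the exponent of \<open>Z\<close> by \<open>b - a\<close> is, on coefficients, multiplication by \<open>z^(b-a)\<close> for the
  product of polynomials (not of divided powers), and lowering it is contraction.\<close>

lemma Z_shift_up:
  fixes F :: "('n::finite option, 'k::field) dpow"
  assumes "a \<le> b"
  shows "Z_shift a b F = z_var ^ (b - a) * F"
proof -
  have "Poly_Mapping.update None (lookup m None + b - a) m = single None (b - a) + m"
    for m :: "'n option \<Rightarrow>\<^sub>0 nat"
    by (rule poly_mapping_eqI) (use assms in \<open>auto simp: lookup_update lookup_add lookup_single when_def\<close>)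
  moreover have "{m \<in> keys F. a \<le> lookup m None + b} = keys F" using assms by auto
  ultimately have "Z_shift a b F = z_var ^ (b - a) * (\<Sum>m\<in>keys F. single m (lookup F m))"
    by (simp add: Z_shift_def sum_distrib_left var_power mult_single)
  then show ?thesis by (simp flip: poly_mapping_sum_singles)
qed

lemma Z_shift_down:
  fixes F :: "('n::finite option, 'k::field) dpow"
  assumes "b \<le> a"
  shows "Z_shift a b F = contract (z_var ^ (a - b)) F"
proof (rule poly_mapping_eqI)
  fix M :: "'n option \<Rightarrow>\<^sub>0 nat"
  have upd: "Poly_Mapping.update None (lookup m None + b - a) m = M \<longleftrightarrow> m = M + single None (a - b)"
    if "a \<le> lookup m None + b" for m
  proof
    assume "Poly_Mapping.update None (lookup m None + b - a) m = M"
    then have "lookup M v = (if v = None then lookup m None + b - a else lookup m v)" for v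
      by (auto simp: lookup_update)
    then show "m = M + single None (a - b)"
      using assms that by (auto intro!: poly_mapping_eqI simp: lookup_add lookup_single when_def)
  next
    assume "m = M + single None (a - b)"
    then show "Poly_Mapping.update None (lookup m None + b - a) m = M"
      using assms by (auto intro!: poly_mapping_eqI simp: lookup_update lookup_add lookup_single when_def)
  qed
  let ?A = "{m \<in> keys F. a \<le> lookup m None + b}"
  have "lookup (Z_shift a b F) M = (\<Sum>m\<in>?A. if m = M + single None (a - b) then lookup F m else 0)"
    unfolding Z_shift_def by (subst sum_singles_lookup, simp, rule sum.cong) (auto simp: upd)
  also have "\<dots> = lookup F (M + single None (a - b))"
    using assms by (auto simp: in_keys_iff lookup_add)
  also have "\<dots> = lookup (contract (z_var ^ (a - b)) F) M"
    by (simp add: lookup_contract_pair var_power mult_single)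
  finally show "lookup (Z_shift a b F) M = lookup (contract (z_var ^ (a - b)) F) M" .
qed

lemma linear_Z_shift: "Vector_Spaces.linear kscale kscale (Z_shift a b :: ('n::finite option, 'k::field) dpow \<Rightarrow> _)"
proof (cases "a \<le> b")
  case True
  have "(z_var ^ (b - a) * kscale c x :: ('n option, 'k) dpow) = kscale c (z_var ^ (b - a) * x)" for c x
    by (simp add: kscale_eq_single_mult mult_ac)
  then show ?thesis
    by unfold_locales (simp_all add: Z_shift_up[OF True] distrib_left)
next
  case False
  then show ?thesis
    by unfold_locales (simp_all add: Z_shift_down contract_add_right contract_kscale_right)
qed

lemma linear_contract: "Vector_Spaces.linear kscale kscale (contract h :: ('v::finite, 'k::field) dpow \<Rightarrow> _)"
  by unfold_locales (simp_all add: contract_add_right contract_kscale_right)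

text \<open>All binomial coefficients are \<open>1\<close>, since the two factors have no variable in common.\<close>

lemma dp_mult_single: "dp_mult (single (ext_mono m 0) c) (single (single None e) 1)
    = (single (ext_mono m e) c :: ('n::finite option, 'k::field) dpow)"
proof (cases "c = 0")
  case False
  have add: "ext_mono m 0 + single None e = ext_mono m e"
    by (rule option_exponent_eqI) (simp_all add: lookup_add)
  have "(lookup (ext_mono m 0) v + lookup (single None e) v) choose lookup (ext_mono m 0) v = 1" for v
    by (cases v) (simp_all add: lookup_single when_def)
  then show ?thesis using False by (simp add: dp_mult_def add)
qed (simp add: dp_mult_def)

text \<open>A product with a power of \<open>Z\<close> does not change the degree in the \<open>X\<^sub>i\<close>; conversely each monomial
  splits into its parts in the \<open>X\<^sub>i\<close> and in \<open>Z\<close>.\<close>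

lemma dp_bounded_eq:
  "dp_subspace_mult (dp_le \<alpha>) dp_Z
    = {F :: ('n::finite option, 'k::field) dpow. \<forall>M\<in>keys F. xdeg M \<le> \<alpha>}" (is "_ = ?B")
proof
  have sub: "kv.subspace ?B"
  proof (rule kv.subspaceI)
    show "x + y \<in> ?B" if "x \<in> ?B" "y \<in> ?B" for x y
      using that keys_add[of x y] by auto
    show "kscale c x \<in> ?B" if "x \<in> ?B" for c x
      using that by (auto simp: in_keys_iff)
  qed simp
  have "dp_mult F G \<in> ?B" if F: "F \<in> dp_le \<alpha>" and G: "G \<in> dp_Z" for F G :: "('n option, 'k) dpow"
  proof -
    have "single (U + V) c \<in> ?B" if "U \<in> keys F" "V \<in> keys G" for U V c
    proof -
      have "xpart V = 0" using G that(2) by (auto intro!: poly_mapping_eqI simp: dp_Z_def)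
      moreover have "xdeg U \<le> \<alpha>" using F that(1) mdeg_option[of U] by (auto simp: dp_le_def)
      ultimately show ?thesis by simp
    qed
    then show ?thesis
      unfolding dp_mult_def by (intro kv.subspace_sum[OF sub]) blast
  qed
  then show "dp_subspace_mult (dp_le \<alpha>) dp_Z \<subseteq> ?B"
    unfolding dp_subspace_mult_def by (intro kv.span_minimal[OF _ sub]) blast
  show "?B \<subseteq> dp_subspace_mult (dp_le \<alpha>) dp_Z"
  proof
    fix F assume F: "F \<in> ?B"
    have "(\<Sum>M\<in>keys F. single M (lookup F M)) \<in> dp_subspace_mult (dp_le \<alpha>) dp_Z"
      unfolding dp_subspace_mult_def
    proof (intro kv.span_sum kv.span_base CollectI exI conjI)
      fix M assume M: "M \<in> keys F"
      show "single M (lookup F M)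
          = dp_mult (single (ext_mono (xpart M) 0) (lookup F M)) (single (single None (lookup M None)) 1)"
        by (simp add: dp_mult_single)
      show "single (ext_mono (xpart M) 0) (lookup F M) \<in> dp_le \<alpha>"
        using F M by (auto simp: dp_le_def)
      show "single (single None (lookup M None)) 1 \<in> dp_Z"
        by (auto simp: dp_Z_def lookup_single when_def)
    qed
    then show "F \<in> dp_subspace_mult (dp_le \<alpha>) dp_Z" by (simp flip: poly_mapping_sum_singles)
  qed
qed

context fat_point
begin

abbreviation "L \<equiv> perp I"

lemma perp_degree: "f \<in> perp J \<Longrightarrow> m \<in> keys f \<Longrightarrow> mdeg m \<le> \<alpha>"
proof (rule ccontr)
  assume f: "f \<in> perp J" "m \<in> keys f" "\<not> mdeg m \<le> \<alpha>"
  then have "single m 1 \<in> J" by (simp add: single_in_J)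
  then have "pair (single m 1) f = 0" using f(1) unfolding perp_iff_pair[OF ideal_J] by blast
  with f(2) show False by (simp add: in_keys_iff)
qed

lemma homogenize_perp: "f \<in> perp J \<Longrightarrow> homogenize u f \<in> L"
  unfolding perp_def
proof safe
  fix h assume f: "\<forall>h\<in>J. contract h f = 0" and h: "h \<in> I"
  show "contract h (homogenize u f) = 0"
    by (rule contract_zero_if_components)
      (use f h in \<open>simp add: contract_homogenize[OF hom_component_in] forms_ideal_def\<close>)
qed

text \<open>A form in \<open>L\<close> of degree \<open>u\<close> is a functional on the polynomials of degree at most \<open>u\<close> that
  vanishes on \<open>J\<close>. It extends to a functional vanishing on all of \<open>J\<close>, which is an element of
  \<open>perp J\<close> because \<open>J\<close> contains all monomials of large degree.\<close>

lemma perp_I_is_homogenized: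
  assumes F: "F \<in> hom_part u" "F \<in> L"
  obtains f where "f \<in> perp J" "F = homogenize u f"
proof -
  let ?U = "deg_le u :: ('n, 'k) mpoly set"
  have pair_eq: "pair h (dehomogenize F) = pair (homogenize u h) F" if h: "h \<in> ?U" for h
  proof -
    have deg: "\<forall>m\<in>keys h. mdeg m \<le> u" using h by (simp add: deg_le_def)
    then have "{m \<in> keys h. mdeg m \<le> u} = keys h" by auto
    then have "homogenize u h = (\<Sum>m\<in>keys h. single (ext_mono m (u - mdeg m)) (lookup h m))"
      by (simp add: homogenize_def)
    moreover have "pair (\<Sum>m\<in>A. single (ext_mono m (u - mdeg m)) (lookup h m)) F
        = (\<Sum>m\<in>A. lookup h m * lookup F (ext_mono m (u - mdeg m)))" for A
      by (induction A rule: infinite_finite_induct) (simp_all add: pair_add_left)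
    ultimately show ?thesis
      unfolding pair_def[of h] by (auto intro!: sum.cong simp: lookup_dehomogenize_hom[OF F(1)] deg)
  qed
  obtain \<psi> where \<psi>: "Vector_Spaces.linear kscale (*) \<psi>" "\<And>h. h \<in> ?U \<Longrightarrow> \<psi> h = pair h (dehomogenize F)"
    "\<And>h. h \<in> J \<Longrightarrow> \<psi> h = 0"
  proof (rule extend_functional[OF linear_pair[of "dehomogenize F"] subspace_deg_le ideal_subspace[OF ideal_J]])
    fix h assume h: "h \<in> ?U" "h \<in> J"
    have "homogenize u h \<in> I"
      using h by (simp add: I_hom[OF homogenize_in] dehomogenize_homogenize deg_le_def)
    then have "pair (homogenize u h) F = 0"
      using F(2) by (simp add: perp_iff_pair[OF ideal_I])
    then show "pair h (dehomogenize F) = 0" by (simp add: pair_eq[OF h(1)])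
  qed blast
  obtain f where f: "keys f \<subseteq> {m. mdeg m \<le> \<alpha>}"
    "\<And>h. (\<And>m. m \<in> keys h \<Longrightarrow> m \<notin> {m. mdeg m \<le> \<alpha>} \<Longrightarrow> \<psi> (single m 1) = 0) \<Longrightarrow> \<psi> h = pair h f"
    using functional_is_pairing[OF \<psi>(1) finite_exponents_le[of \<alpha>]] by blast
  have psi: "\<psi> h = pair h f" for h
    by (rule f(2)) (simp add: \<psi>(3) single_in_J)
  show ?thesis
  proof (rule that)
    show "f \<in> perp J" unfolding perp_iff_pair[OF ideal_J] using \<psi>(3) by (simp flip: psi)
    have "lookup f m = lookup (dehomogenize F) m" if "mdeg m \<le> u" for m
      using \<psi>(2)[of "single m 1"] that psi[of "single m 1"] by (simp add: deg_le_def)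
    then have "homogenize u f = homogenize u (dehomogenize F)"
      by (intro poly_mapping_eqI) (auto simp: lookup_homogenize mdeg_option)
    then show "F = homogenize u f" by (simp add: homogenize_dehomogenize[OF F(1)])
  qed
qed

lemma piece_L: "piece L u = homogenize u ` perp J"
  using perp_I_is_homogenized[of _ u] homogenize_perp by (auto simp: piece_def)

lemma L_eq: "Homog_dp (perp J) = L"
proof (intro subset_antisym subsetI)
  fix F assume "F \<in> Homog_dp (perp J)"
  then have "hom_component u F \<in> homogenize u ` perp J" for u
    by (simp add: Homog_dp_def Homog_part_subspace[OF subspace_perp])
  then have "hom_component u F \<in> L" for u
    using homogenize_perp by (metis imageE)
  then show "F \<in> L" by (rule kv_subspace_components[OF subspace_perp])
next
  fix F assume "F \<in> L"
  then have "hom_component u F \<in> piece L u" for u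
    using graded_perp[OF graded_I] by (simp add: piece_def)
  then show "F \<in> Homog_dp (perp J)"
    by (simp add: Homog_dp_def Homog_part_subspace[OF subspace_perp] piece_L)
qed

lemma piece_L_contract: "a \<le> b \<Longrightarrow> piece L a = contract (z_var ^ (b - a)) ` piece L b"
  by (simp add: piece_L image_image contract_z_power_homogenize)

lemma dp_Z_sub_L: "dp_Z \<subseteq> L"
proof
  fix F assume F: "F \<in> (dp_Z :: ('n option, 'k) dpow set)"
  have one: "single 0 c \<in> perp J" for c
    using sub_origin var_ideal_iff by (fastforce simp: perp_iff_pair[OF ideal_J])
  have comp: "hom_component u F = homogenize u (single 0 (lookup F (single None u)))" for u
  proof (rule poly_mapping_eqI)
    fix M
    have "lookup F M = lookup (single 0 (lookup F (single None u))) (xpart M)" if "mdeg M = u"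
    proof (cases "xpart M = 0")
      case True
      then have "M = single None u" using that mdeg_option[of M] by (intro option_exponent_eqI) auto
      then show ?thesis by simp
    next
      case False
      have "M \<notin> keys F"
      proof
        assume "M \<in> keys F"
        then have "xpart M = 0" using F by (intro poly_mapping_eqI) (auto simp: dp_Z_def)
        with False show False ..
      qed
      then show ?thesis using False by (simp add: in_keys_iff lookup_single)
    qed
    then show "lookup (hom_component u F) M
        = lookup (homogenize u (single 0 (lookup F (single None u)))) M"
      by (simp add: lookup_homogenize)
  qed
  show "F \<in> L"
    by (rule kv_subspace_components[OF subspace_perp]) (simp only: comp homogenize_perp[OF one])
qed

lemma L_bounded: "L \<subseteq> dp_subspace_mult (dp_le \<alpha>) dp_Z"
  unfolding dp_bounded_eq
proof safe
  fix F M assume F: "F \<in> L" "M \<in> keys F"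
  then have "hom_component (mdeg M) F \<in> piece L (mdeg M)"
    using graded_perp[OF graded_I] by (simp add: piece_def)
  then obtain f where f: "f \<in> perp J" "hom_component (mdeg M) F = homogenize (mdeg M) f"
    by (auto simp: piece_L)
  have "lookup F M = lookup f (xpart M)"
    using arg_cong[OF f(2), of "\<lambda>G. lookup G M"] by (simp add: lookup_homogenize)
  then show "xdeg M \<le> \<alpha>" using F(2) perp_degree[OF f(1), of "xpart M"] by (simp add: in_keys_iff)
qed

text \<open>For \<open>a \<ge> \<alpha>\<close> no term of \<open>f\<close> is lost in degree \<open>a\<close>, as \<open>f\<close> has degree at most \<open>\<alpha>\<close>.\<close>

lemma Z_shift_homogenize:
  assumes "\<alpha> \<le> a" "f \<in> perp J"
  shows "Z_shift a b (homogenize a f) = homogenize b f"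
proof (cases "a \<le> b")
  case True
  show ?thesis
  proof (rule poly_mapping_eqI)
    fix M
    show "lookup (Z_shift a b (homogenize a f)) M = lookup (homogenize b f) M"
    proof (cases "b - a \<le> lookup M None")
      case N: True
      note eq = exponent_split_z[OF N]
      have "xpart (M - single None (b - a)) = xpart M" by (subst (2) eq) simp
      moreover have "mdeg (M - single None (b - a)) = a \<longleftrightarrow> mdeg M = b"
        using arg_cong[OF eq, of mdeg] True N mdeg_option[of M] by (auto simp: mdeg_add)
      ultimately show ?thesis using N
        by (simp add: Z_shift_up[OF True] lookup_z_mult lookup_homogenize)
    next
      case False
      have "lookup f (xpart M) = 0" if "mdeg M = b"
        using perp_degree[OF assms(2), of "xpart M"] False that mdeg_option[of M] assms(1)
        by (force simp: in_keys_iff)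
      then show ?thesis using False
        by (simp add: Z_shift_up[OF True] lookup_z_mult lookup_homogenize)
    qed
  qed
qed (simp add: Z_shift_down contract_z_power_homogenize)

lemma piece_L_Z_shift: "\<alpha> \<le> a \<Longrightarrow> piece L b = Z_shift a b ` piece L a"
  by (auto simp: piece_L Z_shift_homogenize image_image)

lemma Z_shift_inverse:
  assumes "\<alpha> \<le> a" "a \<le> b"
  shows "\<And>F. F \<in> piece L a \<Longrightarrow> contract (z_var ^ (b - a)) (Z_shift a b F) = F"
    and "\<And>G. G \<in> piece L b \<Longrightarrow> Z_shift a b (contract (z_var ^ (b - a)) G) = G"
  using assms by (auto simp: piece_L Z_shift_homogenize contract_z_power_homogenize)

lemma Z_shift_bij:
  assumes "\<alpha> \<le> a" "a \<le> b"
  shows "bij_betw (Z_shift a b) (piece L a) (piece L b)"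
    and "bij_betw (contract (z_var ^ (b - a))) (piece L b) (piece L a)"
proof -
  have "Z_shift a b ` piece L a \<subseteq> piece L b" "contract (z_var ^ (b - a)) ` piece L b \<subseteq> piece L a"
    using piece_L_Z_shift[OF assms(1), of b] piece_L_contract[OF assms(2)] by simp_all
  note * = Z_shift_inverse[OF assms] this
  show "bij_betw (Z_shift a b) (piece L a) (piece L b)"
    by (rule bij_betw_byWitness[of _ "contract (z_var ^ (b - a))"]) (use * in blast)+
  show "bij_betw (contract (z_var ^ (b - a))) (piece L b) (piece L a)"
    by (rule bij_betw_byWitness[of _ "Z_shift a b"]) (use * in blast)+
qed

lemma dehomogenize_piece_L: "\<alpha> \<le> b \<Longrightarrow> dehomogenize ` piece L b = perp J"
proof -
  assume b: "\<alpha> \<le> b"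
  have "dehomogenize (homogenize b f) = f" if "f \<in> perp J" for f
    by (rule dehomogenize_homogenize) (use perp_degree[OF that] b in fastforce)
  then show ?thesis by (force simp: piece_L image_image)
qed

end

section \<open>Macaulay duality\<close>

lemma inverse_system_subspace: "inverse_system W \<Longrightarrow> kv.subspace W"
  unfolding inverse_system_def contract_subspace_def
  by (intro kv.subspaceI) (auto simp flip: contract_const)

text \<open>As \<open>W\<close> contains the components of its elements, and different components of \<open>h\<close> contract a form to
  forms of different degrees, \<open>h\<close> annihilates \<open>W\<close> iff its components do.\<close>

lemma Ann_iff:
  assumes "inverse_system W"
  shows "h \<in> Ann W \<longleftrightarrow> (\<forall>w\<in>W. contract h w = 0)"
proof safe
  fix w assume hw: "h \<in> Ann W" "w \<in> W"
  show "contract h w = 0" by (rule contract_zero_if_components) (use hw in \<open>simp add: Ann_def\<close>)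
next
  assume *: "\<forall>w\<in>W. contract h w = 0"
  have "contract (hom_component j h) w = 0" if w: "w \<in> W" for j w
  proof (rule contract_hom_eq_0_iff[OF hom_component_in, THEN iffD2], rule allI)
    fix u
    have "hom_component u w \<in> W" using w assms by (simp add: inverse_system_def graded_def)
    then have h0: "contract h (hom_component u w) = 0" using * by blast
    show "contract (hom_component j h) (hom_component u w) = 0"
    proof (cases "j \<le> u")
      case True
      from hom_component_contract_hom[OF hom_component_in this, of h w] h0 show ?thesis by simp
    qed (simp add: contract_hom_zero[OF hom_component_in hom_component_in])
  qed
  then show "h \<in> Ann W" by (simp add: Ann_def)
qed

lemma graded_Ann: "graded (Ann W)"
  by (auto simp: graded_def Ann_def hom_component_hom[OF hom_component_in])

lemma is_ideal_Ann: "inverse_system W \<Longrightarrow> is_ideal (Ann W)"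
  by (rule idealI) (auto simp: Ann_iff contract_add_left contract_mult)

text \<open>In each degree only finitely many monomials occur, so that a functional separating a form from
  the inverse system is contraction by a form.\<close>

lemma perp_Ann:
  fixes W :: "('v::finite, 'k::field) dpow set"
  assumes W: "inverse_system W"
  shows "perp (Ann W) = W"
proof (intro subset_antisym subsetI)
  fix F assume F: "F \<in> perp (Ann W)"
  note sub = inverse_system_subspace[OF W]
  show "F \<in> W"
  proof (rule kv_subspace_components[OF sub], rule ccontr)
    fix u assume "hom_component u F \<notin> W"
    then obtain \<psi> where \<psi>: "Vector_Spaces.linear kscale (*) \<psi>" "\<psi> (hom_component u F) \<noteq> 0"
      "\<And>w. w \<in> W \<Longrightarrow> \<psi> w = 0" using separating_functional[OF sub] by metis
    obtain h where h: "keys h \<subseteq> {m. mdeg m = u}"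
      "\<And>w. (\<And>m. m \<in> keys w \<Longrightarrow> m \<notin> {m. mdeg m = u} \<Longrightarrow> \<psi> (single m 1) = 0) \<Longrightarrow> \<psi> w = pair w h"
      using functional_is_pairing[OF \<psi>(1), of "{m. mdeg m = u}"]
        finite_subset[OF _ finite_exponents_le[of u]] by (metis (mono_tags, lifting) mem_Collect_eq order_refl subsetI)
    have psi: "\<psi> (hom_component u w) = pair h w" for w
    proof -
      have "\<psi> (hom_component u w) = pair (hom_component u w) h"
        by (rule h(2)) (auto simp: in_keys_iff split: if_splits)
      also have "\<dots> = pair h (hom_component u w)" by (rule pair_commute)
      also have "\<dots> = pair h w"
        unfolding pair_def by (rule sum.cong) (use h(1) in auto)
      finally show ?thesis .
    qed
    have "contract h w = 0" if w: "w \<in> W" for w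
    proof (rule poly_mapping_eqI)
      fix V
      have "contract (single V 1) w \<in> W"
        using W w by (simp add: inverse_system_def contract_subspace_def)
      then have "hom_component u (contract (single V 1) w) \<in> W"
        using W by (simp add: inverse_system_def graded_def)
      then have "pair h (contract (single V 1) w) = 0" using \<psi>(3) by (simp flip: psi)
      then show "lookup (contract h w) V = lookup 0 V"
        by (simp add: lookup_contract_pair pair_mult[symmetric] mult.commute)
    qed
    then have "h \<in> Ann W" by (simp add: Ann_iff[OF W])
    then have "contract h (hom_component u F) = 0"
      using graded_perp[OF graded_Ann F] by (simp add: perp_def)
    then have "pair h (hom_component u F) = 0" by (simp add: pair_eq_lookup_contract)
    with \<psi>(2) psi[of "hom_component u F"] show False
      by (simp add: hom_component_hom[OF hom_component_in])
  qed
next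
  fix F assume "F \<in> W"
  then show "F \<in> perp (Ann W)" by (simp add: perp_def Ann_iff[OF W])
qed

lemma dehomogenize_ideal:
  assumes "is_ideal (K :: ('n::finite option, 'k::field) mpoly set)"
  shows "is_ideal (dehomogenize ` K)"
proof (rule idealI)
  show "0 \<in> dehomogenize ` K" using ideal_zero[OF assms] by (force intro: image_eqI[of _ _ 0])
  show "x + y \<in> dehomogenize ` K" if "x \<in> dehomogenize ` K" "y \<in> dehomogenize ` K" for x y
    using that ideal_add[OF assms] by (force simp flip: dehomogenize_add)
  fix c :: "('n, 'k) mpoly" and x assume "x \<in> dehomogenize ` K"
  moreover have "c = dehomogenize (homogenize (total_deg c) c)" by (simp only: dehomogenize_surj)
  ultimately show "c * x \<in> dehomogenize ` K"
    using ideal_mult_left[OF assms] by (metis (no_types, lifting) dehomogenize_mult image_iff)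
qed

lemma dehomogenize_point_ideal: "F \<in> point_ideal \<Longrightarrow> dehomogenize F \<in> var_ideal"
proof -
  assume F: "F \<in> point_ideal"
  have "0 \<notin> keys (dehomogenize F)"
  proof
    assume "0 \<in> keys (dehomogenize F)"
    then obtain M where M: "M \<in> keys F" "xpart M = 0"
      using keys_relabel[of "Poly_Mapping.map_key Some" F] by (auto simp: dehomogenize_relabel)
    then have "M = single None (lookup M None)" by (intro option_exponent_eqI) auto
    then show False using M(1) F by (metis in_keys_iff point_ideal_iff)
  qed
  then show ?thesis by (simp add: var_ideal_iff in_keys_iff)
qed

text \<open>The powers \<open>Z^[e]\<close> force the coefficients of the \<open>z^e\<close> in the annihilator to vanish, and the bound on
  the degree in the \<open>X\<^sub>i\<close> puts all forms of larger degree in the \<open>x\<^sub>i\<close> into the annihilator.\<close>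

lemma fat_point_of_inverse_system:
  fixes W :: "('n::finite option, 'k::field) dpow set"
  assumes W: "inverse_system W" and Z: "dp_Z \<subseteq> W" and bound: "W \<subseteq> dp_subspace_mult (dp_le \<alpha>) dp_Z"
  shows "fat_point (dehomogenize ` Ann W) \<alpha>"
proof
  show "is_ideal (dehomogenize ` Ann W)" by (rule dehomogenize_ideal[OF is_ideal_Ann[OF W]])
  show "dehomogenize ` Ann W \<subseteq> var_ideal"
  proof safe
    fix h assume h: "h \<in> Ann W"
    have "lookup h (single None e) = 0" for e
    proof -
      have "single (single None e) 1 \<in> W"
        using Z by (rule subsetD) (auto simp: dp_Z_def lookup_single when_def)
      then have "contract h (single (single None e) 1) = 0" using h by (simp add: Ann_iff[OF W])
      then have "pair h (single (single None e) 1) = 0" by (simp add: pair_eq_lookup_contract)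
      then show ?thesis by simp
    qed
    then show "dehomogenize h \<in> var_ideal" by (simp add: dehomogenize_point_ideal point_ideal_iff)
  qed
  show "vdeg_ge UNIV (Suc \<alpha>) \<subseteq> dehomogenize ` Ann W"
  proof
    fix f assume f: "f \<in> (vdeg_ge UNIV (Suc \<alpha>) :: ('n, 'k) mpoly set)"
    let ?F = "homogenize (total_deg f) f"
    have "contract ?F w = 0" if w: "w \<in> W" for w
    proof (rule poly_mapping_eqI)
      fix V
      have zero: "lookup ?F K * lookup w (V + K) = 0" for K
      proof (rule ccontr)
        assume "lookup ?F K * lookup w (V + K) \<noteq> 0"
        then have "xpart K \<in> keys f" "V + K \<in> keys w"
          by (auto simp: lookup_homogenize in_keys_iff split: if_splits)
        moreover from this(2) have "xdeg (V + K) \<le> \<alpha>"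
          using w bound unfolding dp_bounded_eq by blast
        ultimately show False using f by (auto simp: vdeg_ge_def vdeg_UNIV mdeg_add)
      qed
      show "lookup (contract ?F w) V = lookup 0 V"
        unfolding lookup_contract lookup_zero by (rule sum.neutral) (use zero in blast)
    qed
    then have "?F \<in> Ann W" by (simp add: Ann_iff[OF W])
    then show "f \<in> dehomogenize ` Ann W" by (metis dehomogenize_surj imageI)
  qed
qed

text \<open>Surjectivity of contraction by powers of \<open>z\<close> says, dually, that \<open>z\<close> is a nonzerodivisor modulo
  the annihilator, and this is what determines the annihilator by its dehomogenization.\<close>

lemma Ann_eq_forms_ideal:
  fixes W :: "('n::finite option, 'k::field) dpow set"
  assumes W: "inverse_system W"
    and surj: "\<And>a b. a \<le> b \<Longrightarrow> piece W a = contract (z_var ^ (b - a)) ` piece W b"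
  shows "Ann W = forms_ideal (dehomogenize ` Ann W)"
proof (intro subset_antisym subsetI)
  fix F assume "F \<in> Ann W"
  then show "F \<in> forms_ideal (dehomogenize ` Ann W)"
    using graded_Ann[of W] by (auto simp: forms_ideal_def graded_def)
next
  note I = is_ideal_Ann[OF W]
  fix F assume F: "F \<in> forms_ideal (dehomogenize ` Ann W)"
  show "F \<in> Ann W"
  proof (rule graded_ideal_sum[OF I])
    fix d
    from F obtain h where h: "h \<in> Ann W" "dehomogenize (hom_component d F) = dehomogenize h"
      by (auto simp: forms_ideal_def)
    \<comment> \<open>A degree in which both \<open>h\<close> and the component of \<open>F\<close> can be homogenized, where they must agree.\<close>
    define N where "N = Max (insert d (mdeg ` keys h))"
    have N: "d \<le> N" "\<And>j. j \<in> mdeg ` keys h \<Longrightarrow> j \<le> N" by (auto simp: N_def)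
    let ?H = "\<Sum>j\<in>mdeg ` keys h. z_var ^ (N - j) * hom_component j h"
    have H: "?H \<in> Ann W"
      using h(1) graded_Ann[of W] by (intro ideal_sum[OF I] ideal_mult_left[OF I]) (simp add: graded_def)
    have homH: "?H \<in> hom_part N"
    proof (rule kv.subspace_sum[OF subspace_hom_part])
      fix j assume "j \<in> mdeg ` keys h"
      then show "z_var ^ (N - j) * hom_component j h \<in> hom_part N"
        using hom_part_mult[OF var_power_in[of None "N - j"] hom_component_in[of j h]] N(2) by simp
    qed
    have dehH: "dehomogenize ?H = dehomogenize h"
    proof -
      have "dehomogenize ?H = dehomogenize (\<Sum>j\<in>mdeg ` keys h. hom_component j h)"
        by (simp add: dehomogenize_sum dehomogenize_mult)
      then show ?thesis by (simp flip: sum_hom_components_keys)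
    qed
    have homF: "z_var ^ (N - d) * hom_component d F \<in> hom_part N"
      using hom_part_mult[OF var_power_in[of None "N - d"] hom_component_in[of d F]] N(1) by simp
    have eq: "dehomogenize (z_var ^ (N - d) * hom_component d F) = dehomogenize ?H"
      by (simp only: dehomogenize_mult[of "z_var ^ (N - d)"] h(2) dehH dehomogenize_z_power mult_1)
    have zF: "z_var ^ (N - d) * hom_component d F \<in> Ann W"
      using H by (subst homogenize_dehomogenize[OF homF, symmetric], subst eq,
          subst homogenize_dehomogenize[OF homH])
    have "contract (hom_component d F) w = 0" if w: "w \<in> W" for w
    proof (rule contract_hom_eq_0_iff[OF hom_component_in, THEN iffD2], rule allI)
      fix u
      have "hom_component u w \<in> piece W u"
        using w W by (simp add: piece_def inverse_system_def graded_def)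
      also have "\<dots> = contract (z_var ^ (N - d)) ` piece W (u + (N - d))"
        using surj[of u "u + (N - d)"] by simp
      finally obtain w' where w': "w' \<in> W" "hom_component u w = contract (z_var ^ (N - d)) w'"
        by (auto simp: piece_def)
      have "contract (hom_component d F * z_var ^ (N - d)) w' = 0"
        using zF w'(1) by (simp add: Ann_iff[OF W] mult.commute)
      then show "contract (hom_component d F) (hom_component u w) = 0"
        by (simp add: w'(2) contract_mult)
    qed
    then show "hom_component d F \<in> Ann W" by (simp add: Ann_iff[OF W])
  qed
qed

section \<open>Multiplication by powers of \<open>z\<close> on the quotient ring\<close>

lemma coset_eq_iff:
  assumes I: "is_ideal I"
  shows "h +o I = h' +o I \<longleftrightarrow> h - h' \<in> I"
proof
  assume "h +o I = h' +o I"
  moreover have "h + 0 \<in> h +o I" by (rule set_plus_intro2[OF ideal_zero[OF I]])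
  ultimately obtain i where "i \<in> I" "h = h' + i" by (auto simp: elt_set_plus_def)
  then show "h - h' \<in> I" by simp
next
  assume h: "h - h' \<in> I"
  have "h + i \<in> h' +o I" if "i \<in> I" for i
    using set_plus_intro2[OF ideal_add[OF I h that], of h'] by simp
  moreover have "h' + i \<in> h +o I" if "i \<in> I" for i
    using set_plus_intro2[OF ideal_diff[OF I that h], of h] by (simp add: algebra_simps)
  ultimately show "h +o I = h' +o I" by (auto simp: elt_set_plus_def)
qed

lemma coset_add:
  assumes I: "is_ideal I"
  shows "(h +o I) + (h' +o I) = (h + h') +o I"
proof -
  have "I + I = I"
    using ideal_add[OF I] ideal_zero[OF I] by (force simp: set_plus_def)
  then show ?thesis by (metis set_plus_rearrange)
qed

lemma quot_mult_coset:
  fixes I :: "('v, 'k::field) mpoly set"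
  assumes I: "is_ideal I"
  shows "quot_mult I g (h +o I) = (g * h) +o I"
proof -
  have "g *o I + I = I"
    using ideal_add[OF I] ideal_mult_left[OF I] ideal_zero[OF I]
    by (auto simp: set_plus_def elt_set_times_def)
  then show ?thesis
    unfolding quot_mult_def set_times_plus_distrib by (simp add: set_plus_rearrange3)
qed

context fat_point
begin

lemma quot_z_linear:
  assumes ab: "a \<le> b"
  shows "quot_linear I a b (quot_mult I (z_var ^ (b - a)))"
  unfolding quot_linear_def quot_piece_def
proof (intro conjI allI ballI subsetI)
  fix C assume "C \<in> quot_mult I (z_var ^ (b - a)) ` (\<lambda>h. h +o I) ` hom_part a"
  then obtain h where h: "h \<in> hom_part a" "C = (z_var ^ (b - a) * h) +o I"
    by (auto simp: quot_mult_coset[OF ideal_I])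
  moreover have "z_var ^ (b - a) * h \<in> hom_part b"
    using hom_part_mult[OF var_power_in[of None "b - a"] h(1)] ab by simp
  ultimately show "C \<in> (\<lambda>h. h +o I) ` hom_part b" by blast
next
  let ?f = "quot_mult I (z_var ^ (b - a))"
  show "?f (C + D) = ?f C + ?f D"
    if "C \<in> (\<lambda>h. h +o I) ` hom_part a" "D \<in> (\<lambda>h. h +o I) ` hom_part a" for C D
    using that by (auto simp only: quot_mult_coset[OF ideal_I] coset_add[OF ideal_I] distrib_left)
  show "?f (quot_mult I (const c) C) = quot_mult I (const c) (?f C)"
    if "C \<in> (\<lambda>h. h +o I) ` hom_part a" for c C
    using that by (auto simp only: quot_mult_coset[OF ideal_I] mult.left_commute)
qed

lemma quot_z_inj: "inj_on (quot_mult I (z_var ^ k)) (quot_piece I a)"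
proof (rule inj_onI)
  fix C C' assume "C \<in> quot_piece I a" "C' \<in> quot_piece I a"
    "quot_mult I (z_var ^ k) C = quot_mult I (z_var ^ k) C'"
  then obtain h h' where h: "C = h +o I" "C' = h' +o I" "(z_var ^ k * h) +o I = (z_var ^ k * h') +o I"
    by (auto simp: quot_piece_def quot_mult_coset[OF ideal_I])
  then have "z_var ^ k * (h - h') \<in> I" by (simp add: coset_eq_iff[OF ideal_I] right_diff_distrib)
  then show "C = C'" by (simp add: h coset_eq_iff[OF ideal_I] z_cancel)
qed

lemma quot_z_bij:
  assumes "\<alpha> \<le> a" "a \<le> b"
  shows "bij_betw (quot_mult I (z_var ^ (b - a))) (quot_piece I a) (quot_piece I b)"
  unfolding bij_betw_def
proof (intro conjI quot_z_inj subset_antisym)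
  show "quot_mult I (z_var ^ (b - a)) ` quot_piece I a \<subseteq> quot_piece I b"
    using quot_z_linear[OF assms(2)] by (simp add: quot_linear_def)
  show "quot_piece I b \<subseteq> quot_mult I (z_var ^ (b - a)) ` quot_piece I a"
  proof
    fix C assume "C \<in> quot_piece I b"
    then obtain F where F: "F \<in> hom_part b" "C = F +o I" by (auto simp: quot_piece_def)
    obtain G H where GH: "F = z_var ^ (b - a) * G + H" "G \<in> hom_part a" "H \<in> I"
      using reduce_degree[OF F(1) assms] by metis
    have "C = (z_var ^ (b - a) * G) +o I"
      using GH(3) by (simp add: F(2) coset_eq_iff[OF ideal_I] GH(1))
    then show "C \<in> quot_mult I (z_var ^ (b - a)) ` quot_piece I a"
      using GH(2) by (auto simp: quot_piece_def image_image quot_mult_coset[OF ideal_I])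
  qed
qed

end

section \<open>The Hilbert function\<close>

text \<open>Dimensions of quotients are computed by any linear map with the right kernel.\<close>

lemma basis_mod_image:
  fixes p :: "('e \<Rightarrow>\<^sub>0 'k::field) \<Rightarrow> ('d \<Rightarrow>\<^sub>0 'k)"
  assumes p: "Vector_Spaces.linear kscale kscale p" and V: "kv.subspace V"
    and ker: "\<And>x. x \<in> V \<Longrightarrow> p x = 0 \<longleftrightarrow> x \<in> W" and B: "basis_mod V W B"
  shows "card B = kv.dim (p ` V)"
proof -
  note psum = kv2.linear_sum[OF p] and pscale = kv2.linear_scale[OF p] and pdiff = kv2.linear_diff[OF p]
  have BV: "B \<subseteq> V"
    and ind: "\<And>S c. finite S \<Longrightarrow> S \<subseteq> B \<Longrightarrow> (\<Sum>b\<in>S. kscale (c b) b) \<in> W \<Longrightarrow> \<forall>b\<in>S. c b = 0"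
    and spn: "\<And>v. v \<in> V \<Longrightarrow> \<exists>S c. finite S \<and> S \<subseteq> B \<and> v - (\<Sum>b\<in>S. kscale (c b) b) \<in> W"
    using B unfolding basis_mod_def by blast+
  have inV: "(\<Sum>b\<in>S. kscale (c b) b) \<in> V" if "S \<subseteq> B" for S c
    using that BV by (intro kv.subspace_sum[OF V] kv.subspace_scale[OF V]) auto
  have p0: "(\<Sum>b\<in>S. kscale (c b) b) \<in> W" if "S \<subseteq> B" "(\<Sum>b\<in>S. kscale (c b) (p b)) = 0" for S c
    using ker[OF inV[OF that(1), of c]] that(2) by (simp add: psum pscale)
  have inj: "inj_on p B"
  proof (rule inj_onI, rule ccontr)
    fix b b' assume b: "b \<in> B" "b' \<in> B" "p b = p b'" "b \<noteq> b'"
    define c where "c x = (if x = b then 1 else - 1 :: 'k)" for x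
    have "(\<Sum>x\<in>{b, b'}. kscale (c x) (p x)) = 0" using b(3,4) by (simp add: c_def)
    then have "(\<Sum>x\<in>{b, b'}. kscale (c x) x) \<in> W" using b by (intro p0) auto
    then have "\<forall>x\<in>{b, b'}. c x = 0" using b by (intro ind) auto
    then have "c b = 0" by blast
    then show False by (simp add: c_def)
  qed
  have "kv.independent (p ` B)"
    unfolding kv.independent_explicit_finite_subsets
  proof (intro allI impI ballI)
    fix S u v assume S: "S \<subseteq> p ` B" "finite S" "(\<Sum>v\<in>S. kscale (u v) v) = 0" "v \<in> S"
    then obtain T where T: "T \<subseteq> B" "finite T" "S = p ` T" by (meson finite_subset_image)
    have "(\<Sum>b\<in>T. kscale (u (p b)) (p b)) = 0"
      using S(3) unfolding T(3) by (simp add: sum.reindex[OF inj_on_subset[OF inj T(1)]])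
    from ind[OF T(2,1) p0[OF T(1) this]] S(4) T(3) show "u v = 0" by auto
  qed
  moreover have "p ` V \<subseteq> kv.span (p ` B)"
  proof safe
    fix v assume v: "v \<in> V"
    obtain S c where S: "finite S" "S \<subseteq> B" "v - (\<Sum>b\<in>S. kscale (c b) b) \<in> W"
      using spn[OF v] by blast
    have "p (v - (\<Sum>b\<in>S. kscale (c b) b)) = 0"
      using ker[of "v - (\<Sum>b\<in>S. kscale (c b) b)"] S(3) kv.subspace_diff[OF V v inV[OF S(2)]] by blast
    then have "p v = (\<Sum>b\<in>S. kscale (c b) (p b))" by (simp add: pdiff psum pscale)
    also have "\<dots> \<in> kv.span (p ` B)"
      using S(2) by (intro kv.span_sum kv.span_scale kv.span_base) auto
    finally show "p v \<in> kv.span (p ` B)" .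
  qed
  ultimately have "card (p ` B) = kv.dim (p ` V)"
    using BV by (intro kv.basis_card_eq_dim) auto
  then show ?thesis by (simp add: card_image[OF inj])
qed

lemma basis_mod_exists:
  fixes p :: "('e \<Rightarrow>\<^sub>0 'k::field) \<Rightarrow> ('d \<Rightarrow>\<^sub>0 'k)"
  assumes p: "Vector_Spaces.linear kscale kscale p" and V: "kv.subspace V"
    and ker: "\<And>x. x \<in> V \<Longrightarrow> p x = 0 \<longleftrightarrow> x \<in> W" and WV: "W \<subseteq> V"
  obtains B where "basis_mod V W B"
proof -
  note psum = kv2.linear_sum[OF p] and pscale = kv2.linear_scale[OF p] and pdiff = kv2.linear_diff[OF p]
  obtain C where C: "C \<subseteq> p ` V" "kv.independent C" "p ` V \<subseteq> kv.span C"
    using kv.basis_exists[of "p ` V"] by metis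
  then have "\<forall>c\<in>C. \<exists>v\<in>V. p v = c" by blast
  then obtain g where g: "\<And>c. c \<in> C \<Longrightarrow> g c \<in> V" "\<And>c. c \<in> C \<Longrightarrow> p (g c) = c" by metis
  have "basis_mod V W (g ` C)"
    unfolding basis_mod_def
  proof (intro conjI allI impI ballI)
    show "g ` C \<subseteq> V" using g by blast
    fix S c b assume S: "finite S \<and> S \<subseteq> g ` C \<and> (\<Sum>b\<in>S. kscale (c b) b) \<in> W" and b: "b \<in> S"
    have inj: "inj_on p S"
    proof (rule inj_onI)
      fix x y assume xy: "x \<in> S" "y \<in> S" "p x = p y"
      obtain a b where "a \<in> C" "x = g a" "b \<in> C" "y = g b" using xy(1,2) S by blast
      then show "x = y" using xy(3) g(2) by simp
    qed
    have "(\<Sum>b\<in>S. kscale (c b) b) \<in> W" using S by blast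
    then have "p (\<Sum>b\<in>S. kscale (c b) b) = 0" using ker WV by (meson subsetD)
    then have "(\<Sum>b\<in>S. kscale (c b) (p b)) = 0" by (simp add: psum pscale)
    moreover have "(\<Sum>x\<in>p ` S. kscale (c (the_inv_into S p x)) x) = (\<Sum>b\<in>S. kscale (c b) (p b))"
      unfolding sum.reindex[OF inj] by (rule sum.cong) (simp_all add: the_inv_into_f_f[OF inj])
    ultimately have zero: "(\<Sum>x\<in>p ` S. kscale (c (the_inv_into S p x)) x) = 0"
      by (rule trans[rotated])
    have "p ` S \<subseteq> C" using S g by auto
    from kv.independentD[OF C(2) _ this zero, of "p b"] S b
    have "c (the_inv_into S p (p b)) = 0" by simp
    then show "c b = 0" using b by (simp add: the_inv_into_f_f[OF inj])
  next
    fix v assume v: "v \<in> V"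
    then have "p v \<in> kv.span C" using C(3) by blast
    then obtain T r where T: "finite T" "T \<subseteq> C" "p v = (\<Sum>a\<in>T. kscale (r a) a)"
      unfolding kv.span_explicit by blast
    have inj: "inj_on g T" by (rule inj_on_inverseI[of _ p]) (use T(2) g(2) in blast)
    have sum: "(\<Sum>b\<in>g ` T. kscale (r (p b)) b) = (\<Sum>a\<in>T. kscale (r a) (g a))"
      unfolding sum.reindex[OF inj] by (rule sum.cong) (use T(2) g(2) in auto)
    have "(\<Sum>a\<in>T. kscale (r a) (p (g a))) = (\<Sum>a\<in>T. kscale (r a) a)"
      by (rule sum.cong) (use T(2) g(2) in auto)
    then have "p (v - (\<Sum>b\<in>g ` T. kscale (r (p b)) b)) = 0"
      unfolding sum by (simp add: pdiff psum pscale T(3))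
    moreover have "v - (\<Sum>b\<in>g ` T. kscale (r (p b)) b) \<in> V"
      using T(2) g(1) by (intro kv.subspace_diff[OF V v] kv.subspace_sum[OF V] kv.subspace_scale[OF V]) auto
    ultimately have "v - (\<Sum>b\<in>g ` T. kscale (r (p b)) b) \<in> W" using ker by blast
    then show "\<exists>S c. finite S \<and> S \<subseteq> g ` C \<and> v - (\<Sum>b\<in>S. kscale (c b) b) \<in> W"
      using T(1,2) by (intro exI[of _ "g ` T"] exI[of _ "\<lambda>b. r (p b)"]) auto
  qed
  then show ?thesis by (rule that)
qed

lemma dim_quot_eq_dim:
  fixes p :: "('e \<Rightarrow>\<^sub>0 'k::field) \<Rightarrow> ('d \<Rightarrow>\<^sub>0 'k)"
  assumes "Vector_Spaces.linear kscale kscale p" "kv.subspace V"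
    "\<And>x. x \<in> V \<Longrightarrow> p x = 0 \<longleftrightarrow> x \<in> W" "W \<subseteq> V"
  shows "dim_quot V W = kv.dim (p ` V)"
proof -
  have "basis_mod V W (SOME B. basis_mod V W B)"
    using basis_mod_exists[OF assms] by (metis someI_ex)
  from basis_mod_image[OF assms(1-3) this] show ?thesis by (simp add: dim_quot_def)
qed

text \<open>The ambient space may be infinite-dimensional, so finiteness enters through a spanning set of \<open>V\<close>.\<close>

lemma subspace_eq_if_dim_eq:
  fixes U V :: "('e \<Rightarrow>\<^sub>0 'k::field) set"
  assumes U: "kv.subspace U" and UV: "U \<subseteq> V" and T: "finite T" "V \<subseteq> kv.span T"
    and dim: "kv.dim U = kv.dim V"
  shows "U = V"
proof (rule ccontr)
  assume "U \<noteq> V"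
  then obtain v where v: "v \<in> V" "v \<notin> U" using UV by blast
  obtain B where B: "B \<subseteq> U" "kv.independent B" "U \<subseteq> kv.span B" "card B = kv.dim U"
    using kv.basis_exists[of U] by metis
  obtain C where C: "C \<subseteq> V" "kv.independent C" "V \<subseteq> kv.span C" "card C = kv.dim V"
    using kv.basis_exists[of V] by metis
  have finC: "finite C" using kv.independent_span_bound[OF T(1) C(2)] C(1) T(2) by blast
  have "v \<notin> kv.span B" using v(2) B(1) kv.span_minimal[OF B(1) U] by blast
  then have ind: "kv.independent (insert v B)" "v \<notin> B"
    using B(2) kv.independent_insertI kv.span_base by blast+
  have "insert v B \<subseteq> kv.span C" using v(1) B(1) UV C(3) by blast
  from kv.independent_span_bound[OF finC ind(1) this]
  show False using ind(2) B(4) C(4) dim by auto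
qed

lemma dehomogenize_hom_part: "dehomogenize ` hom_part d = (deg_le d :: ('n::finite, 'k::field) mpoly set)"
proof
  show "dehomogenize ` hom_part d \<subseteq> (deg_le d :: ('n, 'k) mpoly set)"
    by (auto simp: deg_le_def dehomogenize_degree)
  show "(deg_le d :: ('n, 'k) mpoly set) \<subseteq> dehomogenize ` hom_part d"
  proof
    fix f :: "('n, 'k) mpoly" assume "f \<in> deg_le d"
    then have "f = dehomogenize (homogenize d f)" by (simp add: dehomogenize_homogenize deg_le_def)
    then show "f \<in> dehomogenize ` hom_part d" by (rule image_eqI) simp
  qed
qed

context fat_point
begin

text \<open>A linear map with kernel \<open>J\<close>: its range is a copy of \<open>R'/J\<close> inside the polynomials.\<close>

definition residue :: "('n, 'k) mpoly \<Rightarrow> ('n, 'k) mpoly" where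
  "residue = (SOME p. Vector_Spaces.linear kscale kscale p \<and> (\<forall>x. p x = 0 \<longleftrightarrow> x \<in> J))"

lemma residue: "Vector_Spaces.linear kscale kscale residue" "residue x = 0 \<longleftrightarrow> x \<in> J"
proof -
  have "\<exists>p :: ('n, 'k) mpoly \<Rightarrow> ('n, 'k) mpoly.
      Vector_Spaces.linear kscale kscale p \<and> (\<forall>x. p x = 0 \<longleftrightarrow> x \<in> J)"
    using kernel_exists[OF ideal_subspace[OF ideal_J]] by metis
  from someI_ex[OF this] show "Vector_Spaces.linear kscale kscale residue" "residue x = 0 \<longleftrightarrow> x \<in> J"
    unfolding residue_def by blast+
qed

lemma residue_eq_iff: "residue f = residue g \<longleftrightarrow> f - g \<in> J"
  using kv2.linear_diff[OF residue(1), of f g] residue(2)[of "f - g"] by simp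

text \<open>Forms of degree \<open>i\<close> dehomogenize to the polynomials of degree at most \<open>i\<close>, and such a form is in \<open>I\<close>
  iff its dehomogenization is in \<open>J\<close>.\<close>

lemma hilbert_I: "hilbert I i = kv.dim (residue ` deg_le i)"
proof -
  have lin: "Vector_Spaces.linear kscale kscale (dehomogenize :: ('n option, 'k) mpoly \<Rightarrow> _)"
    by unfold_locales (simp_all add: dehomogenize_add dehomogenize_kscale)
  have "hilbert I i = kv.dim ((residue \<circ> dehomogenize) ` hom_part i)"
    unfolding hilbert_def
    by (rule dim_quot_eq_dim[OF Vector_Spaces.linear_compose[OF lin residue(1)] subspace_hom_part])
      (auto simp: residue(2) piece_def I_hom)
  then show ?thesis by (simp only: image_comp[symmetric] dehomogenize_hom_part)
qed

lemma dim_quot_J: "dim_quot UNIV J = kv.dim (range residue)"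
  by (rule dim_quot_eq_dim[OF residue(1)]) (simp_all add: residue(2))

lemma residue_finite_dim: "\<exists>T. finite T \<and> range residue \<subseteq> kv.span T"
proof (intro exI conjI)
  let ?T = "(\<lambda>m. residue (single m 1)) ` {m. mdeg m \<le> \<alpha>}"
  show "finite ?T" by (intro finite_imageI finite_exponents_le)
  show "range residue \<subseteq> kv.span ?T"
  proof safe
    fix f
    have mono: "residue (single m c) \<in> kv.span ?T" for m c
    proof (cases "mdeg m \<le> \<alpha>")
      case True
      have "residue (single m c) = kscale c (residue (single m 1))"
        using kv2.linear_scale[OF residue(1), of c "single m 1"] by (simp add: kscale_single)
      moreover have "kscale c (residue (single m 1)) \<in> kv.span ?T"
        by (rule kv.span_scale, rule kv.span_base) (use True in auto)
      ultimately show ?thesis by simp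
    next
      case False
      then have "residue (single m c) = 0" by (simp add: residue(2) single_in_J)
      then show ?thesis by (simp add: kv.span_zero)
    qed
    have "residue f = (\<Sum>m\<in>keys f. residue (single m (lookup f m)))"
      by (simp flip: poly_mapping_sum_singles kv2.linear_sum[OF residue(1)])
    then show "residue f \<in> kv.span ?T" using mono by (auto intro: kv.span_sum)
  qed
qed

text \<open>As \<open>R'/J\<close> is finite-dimensional, equality of dimensions means that the polynomials of degree at
  most \<open>d\<close> represent all residue classes.\<close>

lemma hilbert_eq_iff:
  "hilbert I d = dim_quot UNIV J \<longleftrightarrow> (\<forall>f. \<exists>g\<in>deg_le d. f - g \<in> J)"
proof
  assume "hilbert I d = dim_quot UNIV J"
  then have dim: "kv.dim (residue ` deg_le d) = kv.dim (range residue)"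
    by (simp add: hilbert_I dim_quot_J)
  obtain T where T: "finite T" "range residue \<subseteq> kv.span T" using residue_finite_dim by blast
  have "residue ` deg_le d = range residue"
    by (rule subspace_eq_if_dim_eq[OF kv2.linear_subspace_image[OF residue(1) subspace_deg_le] _ T dim]) auto
  then show "\<forall>f. \<exists>g\<in>deg_le d. f - g \<in> J"
    by (metis imageE rangeI residue_eq_iff)
next
  assume "\<forall>f. \<exists>g\<in>deg_le d. f - g \<in> J"
  then have "residue ` deg_le d = range residue"
    by (auto simp: image_iff residue_eq_iff)
  then show "hilbert I d = dim_quot UNIV J" by (simp add: hilbert_I dim_quot_J)
qed

lemma represented_degree:
  assumes "\<alpha> \<le> d"
  shows "\<exists>g\<in>deg_le d. f - g \<in> J"
proof
  define g where "g = (\<Sum>m\<in>{m \<in> keys f. mdeg m \<le> d}. single m (lookup f m))"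
  have g: "lookup g m = (if mdeg m \<le> d then lookup f m else 0)" for m
    unfolding g_def by (subst sum_singles_lookup) (auto simp: in_keys_iff)
  show "g \<in> deg_le d" by (auto simp: deg_le_def in_keys_iff g split: if_splits)
  show "f - g \<in> J"
    by (rule subsetD[OF nilpotent])
      (use assms in \<open>auto simp: vdeg_ge_def vdeg_UNIV in_keys_iff lookup_minus g split: if_splits\<close>)
qed

lemma hilbert_eventually: "\<alpha> \<le> d \<Longrightarrow> hilbert I d = dim_quot UNIV J"
  using hilbert_eq_iff represented_degree by blast

lemma Proj_degree_I: "Proj_degree I = dim_quot UNIV J"
  unfolding Proj_degree_def
proof (rule the_equality)
  show ev: "\<forall>\<^sub>F i in sequentially. hilbert I i = dim_quot UNIV J"
    using hilbert_eventually by (auto simp: eventually_sequentially)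
  show "d = dim_quot UNIV J" if "\<forall>\<^sub>F i in sequentially. hilbert I i = d" for d
  proof -
    have "\<forall>\<^sub>F i in sequentially. d = dim_quot UNIV J"
      using eventually_conj[OF that ev] by (rule eventually_mono) auto
    then show ?thesis by simp
  qed
qed

lemma represented_tau: "\<exists>g\<in>deg_le (tau I). f - g \<in> J"
proof -
  have "hilbert I (tau I) = Proj_degree I"
    unfolding tau_def by (rule LeastI[of _ \<alpha>]) (simp add: Proj_degree_I hilbert_eventually)
  then show ?thesis using hilbert_eq_iff[of "tau I"] by (simp add: Proj_degree_I)
qed

lemma tau_le_if_represented: "(\<And>f. \<exists>g\<in>deg_le d. f - g \<in> J) \<Longrightarrow> tau I \<le> d"
  unfolding tau_def by (rule Least_le) (simp add: Proj_degree_I hilbert_eq_iff)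

lemma tau_le: "tau I \<le> \<alpha>"
  by (rule tau_le_if_represented[OF represented_degree]) simp

text \<open>The powers of the maximal ideal decrease strictly modulo \<open>J\<close> until they vanish: if the
  monomial \<open>y^m\<close> of degree \<open>\<alpha>\<close> is not in \<open>J\<close>, a divisor of degree \<open>i\<close> of \<open>y^m\<close> is not congruent
  to an element of order \<open>i + 1\<close>.\<close>

lemma length_ge:
  assumes "\<not> ideal_power var_ideal \<alpha> \<subseteq> J"
  shows "\<alpha> + 1 \<le> dim_quot UNIV J"
proof -
  obtain f where f: "f \<in> vdeg_ge UNIV \<alpha>" "f \<notin> J" using assms by (auto simp: var_ideal_power)
  obtain m c where m: "single m c \<notin> J" "\<alpha> \<le> mdeg m"
  proof (rule ccontr)
    assume *: "\<not> thesis"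
    have "f \<in> J"
      by (rule ideal_if_terms[OF ideal_J]) (use * that f(1) in \<open>auto simp: vdeg_ge_def vdeg_UNIV\<close>)
    with f(2) show False ..
  qed
  then have deg: "mdeg m = \<alpha>" using single_in_J[of m c] by (metis le_neq_implies_less)
  have step: "\<exists>h\<in>vdeg_ge UNIV i. residue h \<notin> residue ` vdeg_ge UNIV (Suc i)" if i: "i \<le> \<alpha>" for i
  proof -
    obtain m1 m2 where m12: "m = m1 + m2" "mdeg m2 = i"
      using exponent_split_degree[of i m] i deg by auto
    have "single m2 1 - g \<notin> J" if g: "g \<in> vdeg_ge UNIV (Suc i)" for g
    proof
      assume *: "single m2 1 - g \<in> J"
      have "single m1 c \<in> vdeg_ge UNIV (\<alpha> - i)"
        using m12 deg by (auto simp: vdeg_ge_def vdeg_UNIV mdeg_add)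
      from vdeg_ge_mult[OF this g] have "single m1 c * g \<in> vdeg_ge UNIV (Suc \<alpha>)" using i by simp
      then have "single m1 c * g \<in> J" using nilpotent by blast
      from ideal_add[OF ideal_J ideal_mult_left[OF ideal_J *, of "single m1 c"] this]
      have "single m c \<in> J" by (simp add: right_diff_distrib mult_single m12(1))
      with m(1) show False ..
    qed
    moreover have "single m2 1 \<in> vdeg_ge UNIV i" by (simp add: vdeg_ge_def vdeg_UNIV m12(2))
    ultimately show ?thesis
      by (intro bexI[of _ "single m2 1"]) (auto simp: image_iff residue_eq_iff)
  qed
  have "\<exists>S. kv.independent S \<and> finite S \<and> card S = k \<and> S \<subseteq> residue ` vdeg_ge UNIV (Suc \<alpha> - k)"
    if "k \<le> Suc \<alpha>" for k
    using that
  proof (induction k)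
    case 0
    then show ?case by (intro exI[of _ "{}"]) (simp add: kv.independent_empty)
  next
    case (Suc k)
    then obtain S where S: "kv.independent S" "finite S" "card S = k"
      "S \<subseteq> residue ` vdeg_ge UNIV (Suc \<alpha> - k)" by auto
    have k: "Suc \<alpha> - k = Suc (\<alpha> - k)" using Suc.prems by simp
    obtain h where h: "h \<in> vdeg_ge UNIV (\<alpha> - k)" "residue h \<notin> residue ` vdeg_ge UNIV (Suc (\<alpha> - k))"
      using step[of "\<alpha> - k"] by auto
    have "kv.subspace (residue ` vdeg_ge UNIV (Suc (\<alpha> - k)))"
      by (intro kv2.linear_subspace_image[OF residue(1)] ideal_subspace is_ideal_vdeg_ge)
    from kv.span_minimal[OF S(4)[unfolded k] this]
    have "residue h \<notin> kv.span S" using h(2) by blast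
    then have "kv.independent (insert (residue h) S)" "residue h \<notin> S"
      using S(1) kv.independent_insertI kv.span_base by blast+
    moreover have "residue ` vdeg_ge UNIV (Suc (\<alpha> - k)) \<subseteq> residue ` vdeg_ge UNIV (\<alpha> - k)"
      by (rule image_mono) (auto simp: vdeg_ge_def)
    then have "insert (residue h) S \<subseteq> residue ` vdeg_ge UNIV (Suc \<alpha> - Suc k)"
      using S(4) h(1) unfolding k by auto
    ultimately show ?case using S(2,3) by (intro exI[of _ "insert (residue h) S"]) simp
  qed
  from this[of "Suc \<alpha>", OF order_refl]
  obtain S where S: "kv.independent S" "card S = Suc \<alpha>" "S \<subseteq> range residue" by blast
  obtain C where C: "C \<subseteq> range residue" "kv.independent C" "range residue \<subseteq> kv.span C"
    "card C = kv.dim (range residue)" using kv.basis_exists[of "range residue"] by metis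
  obtain T where T: "finite T" "range residue \<subseteq> kv.span T" using residue_finite_dim by blast
  have "finite C" using kv.independent_span_bound[OF T(1) C(2)] C(1) T(2) by blast
  from kv.independent_span_bound[OF this S(1)] S C show ?thesis
    by (auto simp: dim_quot_J)
qed

lemma Proj_eq_Spec_I: "Proj_eq_Spec I J"
  unfolding Proj_eq_Spec_def
proof (intro conjI ballI ideal_I graded_I dehomogenize_forms_ideal[OF ideal_J])
  fix P assume "P \<in> Proj_points I"
  then have P: "prime_ideal P" "I \<subseteq> P" "\<not> var_ideal \<subseteq> P" by (auto simp: Proj_points_def)
  have "var (Some i) \<in> P" for i
  proof -
    have "(var (Some i) :: ('n option, 'k) mpoly) ^ Suc \<alpha> \<in> vdeg_ge (range Some) (Suc \<alpha>)"
      by (simp add: var_power vdeg_ge_def vdeg_single del: power_Suc)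
    then show ?thesis using point_power_sub P(2) prime_ideal_power[OF P(1)] by blast
  qed
  moreover have "\<not> range var \<subseteq> P"
    using P(1,3) ideal_gen_least[of "range var" P] by (auto simp: var_ideal_def prime_ideal_def)
  ultimately show "z_var \<notin> P" by (metis image_subsetI not_None_eq)
qed

end

section \<open>Laurent polynomials\<close>

abbreviation "intexp (m :: 'v \<Rightarrow>\<^sub>0 nat) \<equiv> Poly_Mapping.map int m"

lemma lookup_intexp [simp]: "lookup (intexp m) v = int (lookup m v)"
  by (simp add: map.rep_eq when_def)

lemma intexp_add: "intexp (a + b) = intexp a + intexp b"
  by (rule poly_mapping_eqI) (simp add: lookup_add)

lemma intexp_inj [simp]: "intexp a = intexp b \<longleftrightarrow> a = b"
  by (metis poly_mapping_eqI lookup_intexp of_nat_eq_iff)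

lemma mdeg_intexp [simp]: "mdeg (intexp m) = int (mdeg m)"
  by (simp add: mdeg_def)

lemma to_laurent_relabel: "to_laurent f = relabel (Poly_Mapping.map int) f"
  by (simp add: to_laurent_def relabel_def)

lemma to_laurent_0 [simp]: "to_laurent 0 = 0"
  by (simp add: to_laurent_relabel)

lemma to_laurent_single [simp]: "to_laurent (single m c) = single (intexp m) c"
  by (simp add: to_laurent_relabel)

lemma lookup_to_laurent [simp]: "lookup (to_laurent f) (intexp m) = lookup f m"
  unfolding to_laurent_relabel by (rule lookup_relabel_inj) (simp add: inj_on_def)

lemma keys_to_laurent: "e \<in> keys (to_laurent f) \<Longrightarrow> \<exists>m\<in>keys f. e = intexp m"
  using keys_relabel[of "Poly_Mapping.map int" f] by (auto simp: to_laurent_relabel)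

lemma to_laurent_surj:
  assumes "\<And>e v. e \<in> keys g \<Longrightarrow> 0 \<le> lookup e v"
  obtains f where "g = to_laurent f"
proof -
  have int: "intexp (Poly_Mapping.map nat e) = e" if "e \<in> keys g" for e
  proof (rule poly_mapping_eqI)
    fix v show "lookup (intexp (Poly_Mapping.map nat e)) v = lookup e v"
      using assms[OF that, of v] by (simp add: map.rep_eq when_def)
  qed
  have "to_laurent (\<Sum>e\<in>A. single (Poly_Mapping.map nat e) (lookup g e))
      = (\<Sum>e\<in>A. single (intexp (Poly_Mapping.map nat e)) (lookup g e))" for A
    by (induction A rule: infinite_finite_induct) (simp_all add: to_laurent_relabel relabel_add)
  also have "\<dots> (keys g) = (\<Sum>e\<in>keys g. single e (lookup g e))"
    by (rule sum.cong) (simp_all add: int)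
  also have "\<dots> = g" by (rule poly_mapping_sum_singles[symmetric])
  finally show ?thesis by (rule that[OF sym])
qed

lemma laurent_monomial_cancel:
  fixes f g :: "('v \<Rightarrow>\<^sub>0 int) \<Rightarrow>\<^sub>0 'k::field"
  shows "single E 1 * f = single E 1 * g \<longleftrightarrow> f = g"
proof
  assume "single E 1 * f = single E 1 * g"
  then have "single (- E) 1 * (single E 1 * f) = single (- E) 1 * (single E 1 * g)" by simp
  then show "f = g" by (simp add: mult_single single_0_one flip: mult.assoc)
qed simp

lemma hom_part_laurent_shift:
  fixes f :: "('v::finite \<Rightarrow>\<^sub>0 int) \<Rightarrow>\<^sub>0 'k::field"
  assumes "f \<in> hom_part d"
  shows "single E 1 * f \<in> hom_part (mdeg E + d)"
  using keys_single_mult[of E 1 f] assms by (auto simp: hom_part_def mdeg_add)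

lemma to_laurent_hom_part: "to_laurent f \<in> hom_part (int D) \<Longrightarrow> f \<in> hom_part D"
  by (auto simp: hom_part_iff) (metis lookup_to_laurent mdeg_intexp of_nat_eq_iff)

text \<open>Regularity over the open set where the variables in \<open>t\<close> are invertible.\<close>

definition poles_in :: "'v list \<Rightarrow> ('v, 'k::field) laurent \<Rightarrow> bool" where
  "poles_in t f \<longleftrightarrow> (\<forall>e\<in>keys f. \<forall>v. lookup e v < 0 \<longrightarrow> v \<in> set t)"

lemma prod_vars_power:
  obtains E :: "'v::finite \<Rightarrow>\<^sub>0 nat"
  where "prod_list (map var t) ^ N = (single E 1 :: ('v, 'k::field) mpoly)"
    "\<forall>v. lookup E v = N * count_list t v"
proof -
  have "\<exists>E. prod_list (map var t) = (single E 1 :: ('v, 'k) mpoly) \<and> (\<forall>v. lookup E v = count_list t v)"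
  proof (induction t)
    case Nil
    show ?case by (intro exI[of _ 0]) (simp add: single_0_one)
  next
    case (Cons w t)
    then obtain E where "prod_list (map var t) = (single E 1 :: ('v, 'k) mpoly)"
      "\<And>v. lookup E v = count_list t v" by blast
    moreover have "var w * (single E 1 :: ('v, 'k) mpoly) = single (single w 1 + E) 1"
      by (simp add: var_def mult_single)
    ultimately show ?case
      by (intro exI[of _ "single w 1 + E"]) (auto simp: lookup_add lookup_single when_def)
  qed
  then obtain E where E: "prod_list (map var t) = (single E 1 :: ('v, 'k) mpoly)"
    "\<And>v. lookup E v = count_list t v" by blast
  have "\<exists>E'. (single E 1 :: ('v, 'k) mpoly) ^ N = single E' 1 \<and> (\<forall>v. lookup E' v = N * lookup E v)"
  proof (induction N)
    case 0
    show ?case by (intro exI[of _ 0]) (simp add: single_0_one)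
  next
    case (Suc N)
    then obtain E' where "(single E 1 :: ('v, 'k) mpoly) ^ N = single E' 1" "\<And>v. lookup E' v = N * lookup E v"
      by blast
    then show ?case by (intro exI[of _ "E + E'"]) (auto simp: mult_single lookup_add)
  qed
  then show ?thesis using that E by metis
qed

lemma sections_hom: "f \<in> sections K d t \<Longrightarrow> f \<in> hom_part d"
  by (simp add: sections_def)

lemma sections_poles:
  assumes "f \<in> sections K d t"
  shows "poles_in t f"
  unfolding poles_in_def
proof (intro ballI allI impI)
  fix e v assume e: "e \<in> keys f" "lookup e v < 0"
  obtain N F where NF: "to_laurent (prod_list (map var t) ^ N) * f = to_laurent F"
    using assms by (auto simp: sections_def)
  obtain E where E: "prod_list (map var t) ^ N = (single E 1 :: ('a, 'b) mpoly)"
    "\<forall>v. lookup E v = N * count_list t v" by (rule prod_vars_power)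
  have "lookup (to_laurent F) (intexp E + e) = lookup f e"
    unfolding NF[symmetric] E(1) to_laurent_single by (simp add: lookup_single_mult)
  then have "intexp E + e \<in> keys (to_laurent F)" using e(1) by (simp add: in_keys_iff)
  then obtain m where "intexp E + e = intexp m" using keys_to_laurent by blast
  then have "int (lookup E v) + lookup e v = int (lookup m v)"
    by (metis lookup_add lookup_intexp)
  then have "lookup E v \<noteq> 0" using e(2) by auto
  then show "v \<in> set t" using spec[OF E(2), of v] by (metis count_list_0_iff mult_0_right)
qed

text \<open>Besides clearing the poles, the bound \<open>l\<close> brings the polynomial into a given power of \<open>m\<^sub>p\<close> if \<open>t\<close>
  contains some \<open>x\<^sub>i\<close>.\<close>

lemma clear_poles:
  fixes f :: "('v::finite, 'k::field) laurent"
  assumes "poles_in t f"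
  obtains N F where "to_laurent (prod_list (map var t) ^ N) * f = to_laurent F" "l \<le> N"
    "\<And>m v. m \<in> keys F \<Longrightarrow> v \<in> set t \<Longrightarrow> l \<le> lookup m v"
proof -
  \<comment> \<open>The sum bounds all negative exponents at once, and \<open>l\<close> is added on top.\<close>
  define N where "N = l + nat (\<Sum>e\<in>keys f. \<Sum>v\<in>UNIV. \<bar>lookup e v\<bar>)"
  have N: "int l - lookup e v \<le> int N" if "e \<in> keys f" for e v
  proof -
    have "\<bar>lookup e v\<bar> \<le> (\<Sum>v\<in>UNIV. \<bar>lookup e v\<bar>)" by (rule member_le_sum) auto
    also have "\<dots> \<le> (\<Sum>e\<in>keys f. \<Sum>v\<in>UNIV. \<bar>lookup e v\<bar>)"
      by (rule member_le_sum[OF that]) (auto intro: sum_nonneg)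
    finally show ?thesis unfolding N_def by linarith
  qed
  obtain E where E: "prod_list (map var t) ^ N = (single E 1 :: ('v, 'k) mpoly)"
    "\<forall>v. lookup E v = N * count_list t v" by (rule prod_vars_power)
  have key: "\<exists>e0\<in>keys f. e = intexp E + e0" if "e \<in> keys (single (intexp E) 1 * f)" for e
    using keys_single_mult[of "intexp E" 1 f] that by blast
  have large: "int l \<le> int (lookup E v) + lookup e v" if "e \<in> keys f" "v \<in> set t" for e v
  proof -
    have "1 \<le> count_list t v" using that(2) by (metis One_nat_def Suc_leI count_list_0_iff not_gr0)
    then have "N \<le> lookup E v" unfolding spec[OF E(2)] by (metis mult.right_neutral mult_le_mono2)
    then show ?thesis using N[OF that(1), of v] by linarith
  qed
  obtain F where F: "single (intexp E) 1 * f = to_laurent F"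
  proof (rule to_laurent_surj)
    fix e v assume "e \<in> keys (single (intexp E) 1 * f)"
    then obtain e0 where e0: "e0 \<in> keys f" "e = intexp E + e0" using key by blast
    show "0 \<le> lookup e v"
    proof (cases "v \<in> set t")
      case True
      show ?thesis using large[OF e0(1) True] by (simp add: e0(2) lookup_add)
    next
      case False
      then have "0 \<le> lookup e0 v" using assms e0(1) by (meson not_le poles_in_def)
      then show ?thesis by (simp add: e0(2) lookup_add)
    qed
  qed blast
  show ?thesis
  proof (rule that)
    show "to_laurent (prod_list (map var t) ^ N) * f = to_laurent F" by (simp add: E(1) F)
    show "l \<le> N" by (simp add: N_def)
    fix m v assume "m \<in> keys F" "v \<in> set t"
    have "lookup (to_laurent F) (intexp m) \<noteq> 0" using \<open>m \<in> keys F\<close> by (simp add: in_keys_iff)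
    then have "intexp m \<in> keys (single (intexp E) 1 * f)" by (simp add: F in_keys_iff)
    then obtain e0 where e0: "e0 \<in> keys f" "intexp m = intexp E + e0" using key by blast
    then have "int (lookup m v) = int (lookup E v) + lookup e0 v" by (metis lookup_add lookup_intexp)
    then show "l \<le> lookup m v" using large[OF e0(1) \<open>v \<in> set t\<close>] by linarith
  qed
qed

lemma zero_in_sections: "is_ideal K \<Longrightarrow> 0 \<in> sections K d t"
  using ideal_zero[of K] by (auto simp: sections_def intro!: image_eqI[of _ _ 0])

section \<open>Vanishing of the cohomology of twists of the structure sheaf\<close>

lemma lookup_sign_mult: "lookup ((- 1) ^ j * f) e = (- 1) ^ j * lookup f (e :: 'v \<Rightarrow>\<^sub>0 int)"
  for f :: "('v, 'k::field) laurent"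
  by (cases "even j") simp_all

lemma cech_diff_Cons:
  "cech_diff c (v # t) = c t - (\<Sum>j<length t. (- 1) ^ j * c (v # take j t @ drop (Suc j) t))"
  by (simp add: cech_diff_def sum.lessThan_Suc_shift sum_negf del: sum.lessThan_Suc)

text \<open>For each Laurent monomial \<open>x^e\<close>, the part of the complex in multidegree \<open>e\<close> is that of a simplex
  modulo those faces that do not contain the variables with negative exponent, and a variable with
  nonnegative exponent defines a contracting homotopy. If all exponents are negative, the degree
  of the monomial is too small.\<close>

lemma cech_homotopy:
  fixes c :: "'v::finite list \<Rightarrow> ('v, 'k::field) laurent"
  assumes c: "cech_cochain K d i c" and cocycle: "\<And>t. length t = i + 2 \<Longrightarrow> cech_diff c t = 0"
    and i: "1 \<le> i" and d: "- int i \<le> d"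
  obtains b where "\<And>t. length t = i \<Longrightarrow> b t \<in> hom_part d \<and> poles_in t (b t) \<and> (\<not> distinct t \<longrightarrow> b t = 0)"
    "\<And>xs x y ys. length (xs @ x # y # ys) = i \<Longrightarrow> b (xs @ y # x # ys) = - b (xs @ x # y # ys)"
    "\<And>t. length t = i + 1 \<Longrightarrow> c t = cech_diff b t"
proof -
  \<comment> \<open>The variable to which the homotopy extends a list depends on the multidegree, so the bounding
    cochain is assembled from coefficients.\<close>
  define w where "w e = (SOME v. 0 \<le> lookup e v)" for e :: "'v \<Rightarrow>\<^sub>0 int"
  have w: "0 \<le> lookup e (w e)" if "\<exists>v. 0 \<le> lookup e v" for e
    unfolding w_def using that by (rule someI_ex)
  let ?g = "\<lambda>t e. if \<exists>v. 0 \<le> lookup e v then lookup (c (w e # t)) e else 0"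
  define b where "b t = Poly_Mapping.Abs_poly_mapping (?g t)" for t
  have b: "lookup (b t) e = ?g t e" for t e
  proof -
    have "{e. ?g t e \<noteq> 0} \<subseteq> (\<Union>v\<in>UNIV. keys (c (v # t)))"
      by (auto simp: in_keys_iff)
    then have "finite {e. ?g t e \<noteq> 0}" by (rule finite_subset) simp
    then show ?thesis unfolding b_def by (simp add: lookup_Abs_poly_mapping)
  qed
  have csec: "c t \<in> sections K d t" and cdist: "\<not> distinct t \<Longrightarrow> c t = 0" if "length t = Suc i" for t
    using c that by (auto simp: cech_cochain_def)
  have csym: "c (xs @ y # x # ys) = - c (xs @ x # y # ys)" if "length (xs @ x # y # ys) = Suc i" for xs x y ys
    using c that unfolding cech_cochain_def by blast
  show ?thesis
  proof (rule that)
    fix t :: "'v list" assume t: "length t = i"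
    have key: "e \<in> keys (c (w e # t)) \<and> (\<exists>v. 0 \<le> lookup e v)" if "e \<in> keys (b t)" for e
      using that by (auto simp: in_keys_iff b split: if_splits)
    have "b t \<in> hom_part d"
      unfolding hom_part_def
    proof (intro CollectI ballI)
      fix e assume "e \<in> keys (b t)"
      then show "mdeg e = d"
        using key[of e] sections_hom[OF csec[of "w e # t"]] t by (simp add: hom_part_def)
    qed
    moreover have "poles_in t (b t)"
      unfolding poles_in_def
    proof (intro ballI allI impI)
      fix e v assume e: "e \<in> keys (b t)" "lookup e v < 0"
      have "poles_in (w e # t) (c (w e # t))"
        by (rule sections_poles[OF csec]) (simp add: t)
      then have "v \<in> set (w e # t)" using key[OF e(1)] e(2) unfolding poles_in_def by blast
      moreover have "v \<noteq> w e" using w[of e] key[OF e(1)] e(2) by auto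
      ultimately show "v \<in> set t" by simp
    qed
    moreover have "b t = 0" if "\<not> distinct t"
      using cdist[of "w _ # t"] t that by (intro poly_mapping_eqI) (simp add: b)
    ultimately show "b t \<in> hom_part d \<and> poles_in t (b t) \<and> (\<not> distinct t \<longrightarrow> b t = 0)" by blast
  next
    fix xs ys :: "'v list" and x y assume l: "length (xs @ x # y # ys) = i"
    show "b (xs @ y # x # ys) = - b (xs @ x # y # ys)"
    proof (rule poly_mapping_eqI)
      fix e
      have "c ((w e # xs) @ y # x # ys) = - c ((w e # xs) @ x # y # ys)"
        by (rule csym) (use l in simp)
      then show "lookup (b (xs @ y # x # ys)) e = lookup (- b (xs @ x # y # ys)) e"
        by (simp add: b)
    qed
  next
    fix t :: "'v list" assume t: "length t = i + 1"
    show "c t = cech_diff b t"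
    proof (rule poly_mapping_eqI)
      fix e
      show "lookup (c t) e = lookup (cech_diff b t) e"
      proof (cases "\<exists>v. 0 \<le> lookup e v")
        case True
        have "cech_diff c (w e # t) = 0" by (rule cocycle) (simp add: t)
        then have "c t = (\<Sum>j<length t. (- 1) ^ j * c (w e # take j t @ drop (Suc j) t))"
          by (simp add: cech_diff_Cons)
        then have "lookup (c t) e
            = (\<Sum>j<length t. (- 1) ^ j * lookup (c (w e # take j t @ drop (Suc j) t)) e)"
          by (simp add: lookup_sum lookup_sign_mult)
        then show ?thesis using True by (simp add: cech_diff_def lookup_sum lookup_sign_mult b)
      next
        case False
        have "lookup (c t) e = 0"
        proof (rule ccontr)
          assume *: "lookup (c t) e \<noteq> 0"
          then have e: "e \<in> keys (c t)" by (simp add: in_keys_iff)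
          have ct: "c t \<in> sections K d t" using csec t by simp
          have "set t = UNIV"
            using sections_poles[OF ct] e False unfolding poles_in_def by (auto simp: not_le)
          moreover have "distinct t"
          proof (rule ccontr)
            assume "\<not> distinct t"
            then have "c t = 0" using cdist t by simp
            with * show False by simp
          qed
          ultimately have card: "card (UNIV :: 'v set) = i + 1" using t by (metis distinct_card)
          have "mdeg e = d" using sections_hom[OF ct] e by (simp add: hom_part_def)
          moreover have "mdeg e \<le> (\<Sum>v\<in>(UNIV :: 'v set). - 1)"
            unfolding mdeg_def by (rule sum_mono) (use False in \<open>simp add: not_le int_one_le_iff_zero_less\<close>, smt)
          ultimately show False using d card by simp
        qed
        then show ?thesis using False by (simp add: cech_diff_def lookup_sum lookup_sign_mult b)
      qed
    qed
  qed
qed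

section \<open>The sections of the ideal sheaf\<close>

definition laurent_exp :: "int \<Rightarrow> ('n::finite \<Rightarrow>\<^sub>0 nat) \<Rightarrow> ('n option \<Rightarrow>\<^sub>0 int)" where
  "laurent_exp d m = intexp (ext_mono m 0) + single None (d - int (mdeg m))"

text \<open>\<open>z^d \<phi>(x\<^sub>1/z, \<dots>, x\<^sub>n/z)\<close> as a Laurent polynomial.\<close>

definition twist :: "int \<Rightarrow> ('n::finite, 'k::field) mpoly \<Rightarrow> ('n option, 'k) laurent" where
  "twist d \<phi> = relabel (laurent_exp d) \<phi>"

lemma mdeg_laurent_exp: "mdeg (laurent_exp d m) = d"
  by (simp add: laurent_exp_def mdeg_add)

lemma lookup_laurent_exp_Some [simp]: "lookup (laurent_exp d m) (Some i) = int (lookup m i)"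
  by (simp add: laurent_exp_def lookup_add lookup_single when_def)

lemma twist_hom: "twist d \<phi> \<in> hom_part d"
  unfolding twist_def hom_part_def using keys_relabel[of "laurent_exp d" \<phi>]
  by (auto simp: mdeg_laurent_exp)

lemma twist_poles: "poles_in [None] (twist d \<phi>)"
  unfolding twist_def poles_in_def using keys_relabel[of "laurent_exp d" \<phi>]
  by (metis imageE list.set_intros(1) lookup_laurent_exp_Some not_None_eq not_less of_nat_0_le_iff subsetD)

lemma twist_add: "twist d (f + g) = twist d f + twist d g"
  by (simp add: twist_def relabel_add)

lemma twist_0 [simp]: "twist d 0 = 0"
  by (simp add: twist_def)

lemma twist_diff: "twist d (f - g) = twist d f - twist d g"
  using twist_add[of d "f - g" g] by simp

lemma relabel_shift:
  assumes "\<And>m. m \<in> keys f \<Longrightarrow> \<tau> m = E + \<sigma> m"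
  shows "relabel \<tau> f = single E 1 * relabel \<sigma> (f :: 'a \<Rightarrow>\<^sub>0 'k::field)"
  unfolding relabel_def sum_distrib_left
  by (rule sum.cong) (simp_all add: assms mult_single)

lemma twist_shift: "twist (d + int N) \<phi> = single (single None (int N)) 1 * twist d \<phi>"
  unfolding twist_def
proof (rule relabel_shift)
  fix m :: "'a \<Rightarrow>\<^sub>0 nat"
  have "d + int N - int (mdeg m) = int N + (d - int (mdeg m))" by simp
  then show "laurent_exp (d + int N) m = single None (int N) + laurent_exp d m"
    unfolding laurent_exp_def by (simp only: single_add add_ac)
qed

lemma to_laurent_homogenize:
  assumes "\<phi> \<in> deg_le D"
  shows "to_laurent (homogenize D \<phi>) = twist (int D) \<phi>"
proof -
  have exp: "intexp (ext_mono m (D - mdeg m)) = laurent_exp (int D) m" if "m \<in> keys \<phi>" for m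
  proof (rule poly_mapping_eqI)
    fix v show "lookup (intexp (ext_mono m (D - mdeg m))) v = lookup (laurent_exp (int D) m) v"
      using assms that by (cases v) (auto simp: laurent_exp_def lookup_add lookup_single deg_le_def of_nat_diff)
  qed
  have "{m \<in> keys \<phi>. mdeg m \<le> D} = keys \<phi>" using assms by (auto simp: deg_le_def)
  then have "homogenize D \<phi> = (\<Sum>m\<in>keys \<phi>. single (ext_mono m (D - mdeg m)) (lookup \<phi> m))"
    by (simp add: homogenize_def)
  moreover have "to_laurent (\<Sum>m\<in>A. single (\<sigma> m) (lookup \<phi> m)) = (\<Sum>m\<in>A. single (intexp (\<sigma> m)) (lookup \<phi> m))"
    for A and \<sigma> :: "('a \<Rightarrow>\<^sub>0 nat) \<Rightarrow> 'a option \<Rightarrow>\<^sub>0 nat"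
    by (induction A rule: infinite_finite_induct) (simp_all add: to_laurent_relabel relabel_add)
  ultimately have "to_laurent (homogenize D \<phi>)
      = (\<Sum>m\<in>keys \<phi>. single (intexp (ext_mono m (D - mdeg m))) (lookup \<phi> m))" by simp
  also have "\<dots> = twist (int D) \<phi>"
    unfolding twist_def relabel_def by (rule sum.cong) (simp_all add: exp)
  finally show ?thesis .
qed

lemma z_power_laurent: "to_laurent (prod_list (map var [None]) ^ N) = single (single None (int N)) 1"
proof -
  have "intexp (single None N) = single None (int N)"
    by (rule poly_mapping_eqI) (simp add: lookup_single when_def)
  then show ?thesis by (simp add: var_power)
qed

text \<open>A Laurent form of degree \<open>d\<close> with poles along \<open>z = 0\<close> only is \<open>z^d \<phi>(x/z)\<close>: after clearing the poles
  it is a form, which is the homogenization of its dehomogenization.\<close>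

lemma twist_of_cleared:
  fixes f :: "('n::finite option, 'k::field) laurent"
  assumes f: "f \<in> hom_part d" and F: "single (single None (int N)) 1 * f = to_laurent F"
  shows "f = twist d (dehomogenize F)"
proof (cases "F = 0")
  case True
  then have "single (single None (int N)) 1 * f = single (single None (int N)) 1 * 0" using F by simp
  then show ?thesis using True unfolding laurent_monomial_cancel by simp
next
  case False
  have hom: "to_laurent F \<in> hom_part (int N + d)"
    using hom_part_laurent_shift[OF f, of "single None (int N)"] by (simp add: F)
  obtain m where "m \<in> keys F" using False by (metis poly_mapping_eqI in_keys_iff lookup_zero)
  then have "intexp m \<in> keys (to_laurent F)" by (simp add: in_keys_iff)
  then have D: "int N + d = int (mdeg m)" using hom by (auto simp: hom_part_def)
  let ?D = "mdeg m"
  have FD: "F \<in> hom_part ?D" using hom unfolding D by (rule to_laurent_hom_part)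
  have "dehomogenize F \<in> deg_le ?D" using FD by (auto simp: deg_le_def dehomogenize_degree)
  then have "to_laurent F = twist (int ?D) (dehomogenize F)"
    using to_laurent_homogenize homogenize_dehomogenize[OF FD] by metis
  also have "\<dots> = single (single None (int N)) 1 * twist d (dehomogenize F)"
    using twist_shift[of d N] by (simp add: D[symmetric] add.commute)
  finally show ?thesis unfolding F[symmetric] laurent_monomial_cancel .
qed

context fat_point
begin

text \<open>Where some \<open>x\<^sub>i\<close> is invertible, multiplication by its powers moves everything into \<open>m\<^sub>p^(\<alpha>+1) \<subseteq> I\<close>: away
  from the point the ideal sheaf is the structure sheaf.\<close>

lemma sections_away:
  assumes f: "f \<in> hom_part d" "poles_in t f" and i: "Some i \<in> set t"
  shows "f \<in> sections I d t"
proof -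
  obtain N F where F: "to_laurent (prod_list (map var t) ^ N) * f = to_laurent F"
    "\<And>m v. m \<in> keys F \<Longrightarrow> v \<in> set t \<Longrightarrow> Suc \<alpha> \<le> lookup m v"
    using clear_poles[OF f(2), of "Suc \<alpha>"] by metis
  have "F \<in> vdeg_ge (range Some) (Suc \<alpha>)"
    unfolding vdeg_ge_def vdeg_range_Some
  proof (intro CollectI ballI)
    fix m assume "m \<in> keys F"
    from F(2)[OF this i] show "Suc \<alpha> \<le> xdeg m"
      using lookup_le_mdeg[of "xpart m" i] by simp
  qed
  then show ?thesis using f(1) F(1) point_power_sub by (auto simp: sections_def)
qed

text \<open>Clearing the poles along \<open>z = 0\<close> does not change the dehomogenization, which decides membership in \<open>I\<close>.\<close>

lemma sections_chart: "sections I d [None] = twist d ` J"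
proof (intro subset_antisym subsetI)
  fix f assume "f \<in> sections I d [None]"
  then obtain N F where f: "f \<in> hom_part d" "F \<in> I"
    "to_laurent (prod_list (map var [None]) ^ N) * f = to_laurent F"
    by (auto simp: sections_def)
  from twist_of_cleared[OF f(1) f(3)[unfolded z_power_laurent]]
  show "f \<in> twist d ` J" using f(2) dehomogenize_forms_ideal[OF ideal_J] by blast
next
  fix f assume "f \<in> twist d ` J"
  then obtain \<phi> where \<phi>: "\<phi> \<in> J" "f = twist d \<phi>" by blast
  \<comment> \<open>The twist \<open>d\<close> may be negative; adding \<open>N\<close> makes the degree at least that of \<open>\<phi>\<close>.\<close>
  define N where "N = total_deg \<phi> + nat \<bar>d\<bar>"
  define D where "D = nat (d + int N)"
  have D: "d + int N = int D" "total_deg \<phi> \<le> D" by (auto simp: D_def N_def)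
  then have deg: "\<phi> \<in> deg_le D" by (simp add: deg_le_def total_deg_le_iff)
  have "to_laurent (prod_list (map var [None]) ^ N) * f = twist (d + int N) \<phi>"
    unfolding z_power_laurent \<phi>(2) twist_shift ..
  also have "\<dots> = to_laurent (homogenize D \<phi>)" unfolding D(1) to_laurent_homogenize[OF deg] ..
  moreover have "homogenize D \<phi> \<in> I"
    using \<phi>(1) deg by (simp add: I_hom[OF homogenize_in] dehomogenize_homogenize deg_le_def)
  ultimately show "f \<in> sections I d [None]"
    using twist_hom unfolding \<phi>(2) sections_def by auto
qed

text \<open>A list of at least two distinct variables contains some \<open>x\<^sub>i\<close>, so the homotopy for the structure
  sheaf has values in the ideal sheaf.\<close>

lemma cohomology_vanishes_ge_2:
  assumes i: "2 \<le> i" and d: "- int i \<le> d"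
  shows "cohomology_vanishes I d i"
  unfolding cohomology_vanishes_def
proof (intro allI impI, elim conjE)
  fix c assume c: "cech_cochain I d i c" and cocycle: "\<forall>t. length t = i + 2 \<longrightarrow> cech_diff c t = 0"
  obtain b where b: "\<And>t. length t = i \<Longrightarrow> b t \<in> hom_part d \<and> poles_in t (b t) \<and> (\<not> distinct t \<longrightarrow> b t = 0)"
    "\<And>xs x y ys. length (xs @ x # y # ys) = i \<Longrightarrow> b (xs @ y # x # ys) = - b (xs @ x # y # ys)"
    "\<And>t. length t = i + 1 \<Longrightarrow> c t = cech_diff b t"
    by (rule cech_homotopy[OF c, of thesis]) (use cocycle i d in auto)
  have "b t \<in> sections I d t" if t: "length t = i" for t
  proof (cases "distinct t")
    case True
    then have "card (set t) = i" using t by (simp add: distinct_card)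
    then have "\<not> set t \<subseteq> {None}" using i card_mono[of "{None :: 'n option}" "set t"] by auto
    then obtain j where "Some j \<in> set t" by (metis not_None_eq singletonI subsetI)
    then show ?thesis using b(1)[OF t] sections_away by blast
  next
    case False
    then show ?thesis using b(1)[OF t] zero_in_sections[OF ideal_I] by simp
  qed
  moreover have "Suc (i - 1) = i" using i by simp
  ultimately have "cech_cochain I d (i - 1) b"
    unfolding cech_cochain_def using b(1,2) by (simp only:) blast
  then show "\<exists>b. cech_cochain I d (i - 1) b \<and> (\<forall>t. length t = i + 1 \<longrightarrow> c t = cech_diff b t)"
    using b(3) by blast
qed

lemma cech_diff_2: "cech_diff b [u, v] = b [v] - b [u]"
  by (simp add: cech_diff_def numeral_2_eq_2)

lemma cech_diff_3: "cech_diff c [u, v, w] = c [v, w] - c [u, w] + c [u, v]"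
  by (simp add: cech_diff_def numeral_3_eq_3)

text \<open>A \<open>1\<close>-cocycle of the ideal sheaf is a coboundary of the structure sheaf. Its bounding cochain
  lies in the ideal sheaf after subtracting a form of degree \<open>d\<close> with the right residue class at
  the point.\<close>

lemma cohomology_vanishes_1:
  assumes rep: "\<And>f. \<exists>g\<in>deg_le d. f - g \<in> J"
  shows "cohomology_vanishes I (int d) 1"
  unfolding cohomology_vanishes_def
proof (intro allI impI, elim conjE)
  fix c assume c: "cech_cochain I (int d) 1 c" and cocycle: "\<forall>t. length t = 1 + 2 \<longrightarrow> cech_diff c t = 0"
  obtain b where b: "\<And>t. length t = 1 \<Longrightarrow> b t \<in> hom_part (int d) \<and> poles_in t (b t) \<and> (\<not> distinct t \<longrightarrow> b t = 0)"
    "\<And>t. length t = 1 + 1 \<Longrightarrow> c t = cech_diff b t"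
    by (rule cech_homotopy[OF c, of thesis]) (use cocycle in auto)
  have "poles_in [None] (b [None])" using b(1) by simp
  then obtain N F where F: "to_laurent (prod_list (map var [None]) ^ N) * b [None] = to_laurent F"
    using clear_poles by metis
  define \<phi> where "\<phi> = dehomogenize F"
  have \<phi>: "b [None] = twist (int d) \<phi>"
    unfolding \<phi>_def by (rule twist_of_cleared[OF _ F[unfolded z_power_laurent]]) (use b(1) in simp)
  obtain g where g: "g \<in> deg_le d" "\<phi> - g \<in> J" using rep by blast
  define G where "G = twist (int d) g"
  have G: "G = to_laurent (homogenize d g)" unfolding G_def to_laurent_homogenize[OF g(1)] ..
  define b' where "b' t = b t - G" for t
  have "b' t \<in> sections I (int d) t" if t: "length t = 1" for t
  proof -
    obtain v where v: "t = [v]" using t by (metis One_nat_def length_0_conv length_Suc_conv)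
    show ?thesis
    proof (cases v)
      case None
      have "b' [None] = twist (int d) (\<phi> - g)" by (simp add: b'_def \<phi> G_def twist_diff)
      then show ?thesis using g(2) by (simp add: v None sections_chart)
    next
      case (Some i)
      have "poles_in t (b' t)"
        unfolding poles_in_def
      proof (intro ballI allI impI)
        fix e u assume e: "e \<in> keys (b' t)" "lookup e u < 0"
        then have "e \<notin> keys G"
          using keys_to_laurent[of e "homogenize d g"] by (auto simp: G)
        then have "e \<in> keys (b t)" using e(1) by (auto simp: b'_def in_keys_iff lookup_minus)
        then show "u \<in> set t" using b(1)[OF t] e(2) by (auto simp: poles_in_def)
      qed
      moreover have "b' t \<in> hom_part (int d)"
        unfolding b'_def G_def using b(1)[OF t] twist_hom by (intro hom_part_diff) auto
      ultimately show ?thesis by (intro sections_away[of _ _ _ i]) (simp_all add: v Some)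
    qed
  qed
  then have "cech_cochain I (int d) (1 - 1) b'"
    by (auto simp: cech_cochain_def length_Suc_conv)
  moreover have "c t = cech_diff b' t" if t: "length t = 1 + 1" for t
  proof -
    obtain u v where "t = [u, v]" using t by (auto simp: length_Suc_conv numeral_2_eq_2)
    then show ?thesis using b(2)[OF t] by (simp add: cech_diff_2 b'_def)
  qed
  ultimately show "\<exists>b. cech_cochain I (int d) (1 - 1) b \<and> (\<forall>t. length t = 1 + 1 \<longrightarrow> c t = cech_diff b t)"
    by blast
qed

text \<open>Conversely a polynomial \<open>\<phi>\<close>, as a section near the point extended by \<open>0\<close>, has a coboundary
  with values in the ideal sheaf. If this is bounded by a cochain of the ideal sheaf, then the
  difference is a form of degree \<open>d\<close> with residue class \<open>\<phi>\<close>.\<close>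

lemma represented_if_cohomology_vanishes:
  assumes van: "cohomology_vanishes I d 1"
  obtains D where "d = int D" "\<forall>f. \<exists>g\<in>deg_le D. f - g \<in> J"
proof -
  have main: "\<exists>F. keys (to_laurent F) \<subseteq> {e. mdeg e = d} \<and> \<phi> - dehomogenize F \<in> J" for \<phi>
  proof -
    \<comment> \<open>A cochain of the structure sheaf; only its coboundary has values in the ideal sheaf.\<close>
    define b0 where "b0 t = (if t = [None] then twist d \<phi> else 0 :: ('n option, 'k) laurent)"
      for t :: "'n option list"
    define c where "c t = cech_diff b0 t" for t
    have c2: "c [u, v] = b0 [v] - b0 [u]" for u v by (simp add: c_def cech_diff_2)
    have cases2: "\<exists>u v. t = [u, v]" if "length t = Suc 1" for t :: "'n option list"
      using that by (auto simp: length_Suc_conv)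
    have cochain: "cech_cochain I d 1 c"
      unfolding cech_cochain_def
    proof (intro conjI allI impI)
      fix t :: "'n option list" assume t: "length t = Suc 1"
      obtain u v where uv: "t = [u, v]" using cases2[OF t] by blast
      show "c t \<in> sections I d t"
      proof (cases "u = v")
        case True
        then show ?thesis using zero_in_sections[OF ideal_I] by (simp add: uv c2)
      next
        case False
        then obtain i where i: "Some i \<in> set t" using uv by (cases u; cases v) auto
        show ?thesis
        proof (cases "None \<in> set t")
          case True
          then have "c t = twist d \<phi> \<or> c t = - twist d \<phi>"
            using False by (auto simp: uv c2 b0_def)
          moreover have "keys (- twist d \<phi>) = keys (twist d \<phi>)" by (simp add: keys_def)
          ultimately have "keys (c t) = keys (twist d \<phi>)" by auto
          then have "c t \<in> hom_part d" "poles_in t (c t)"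
            using twist_hom[of d \<phi>] twist_poles[of d \<phi>] True by (auto simp: hom_part_def poles_in_def)
          then show ?thesis using i by (rule sections_away)
        next
          case False
          then have "c t = 0" by (auto simp: uv c2 b0_def)
          then show ?thesis using zero_in_sections[OF ideal_I] by simp
        qed
      qed
      show "c t = 0" if "\<not> distinct t" using that by (simp add: uv c2)
    next
      fix xs ys :: "'n option list" and x y assume "length (xs @ x # y # ys) = Suc 1"
      then have "xs = []" "ys = []" by auto
      then show "c (xs @ y # x # ys) = - c (xs @ x # y # ys)" by (simp add: c2)
    qed
    have "cech_diff c t = 0" if t: "length t = 1 + 2" for t
    proof -
      obtain u v w where "t = [u, v, w]" using t by (auto simp: length_Suc_conv numeral_3_eq_3)
      then show ?thesis by (simp add: cech_diff_3 c2)
    qed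
    then obtain b where b: "cech_cochain I d 0 b" "\<And>t. length t = 1 + 1 \<Longrightarrow> c t = cech_diff b t"
      using van cochain unfolding cohomology_vanishes_def by fastforce
    have sec: "b [v] \<in> sections I d [v]" for v using b(1) by (simp add: cech_cochain_def)
    \<comment> \<open>The difference of the two bounding cochains is a cocycle: one section \<open>g\<close> over all charts. It has
      poles only along \<open>z = 0\<close> and only along \<open>x\<^sub>i = 0\<close>, hence none.\<close>
    define g where "g = twist d \<phi> - b [None]"
    have g: "g = - b [Some i]" for i
      using b(2)[of "[None, Some i]"] by (simp add: g_def c2 cech_diff_2 b0_def algebra_simps)
    obtain \<psi> where \<psi>: "\<psi> \<in> J" "b [None] = twist d \<psi>" using sec[of None] by (auto simp: sections_chart)
    have gt: "g = twist d (\<phi> - \<psi>)" by (simp add: g_def \<psi>(2) twist_diff)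
    obtain F where F: "g = to_laurent F"
    proof (rule to_laurent_surj)
      fix e v assume e: "e \<in> keys g"
      fix i
      have "keys g = keys (b [Some undefined])" by (simp add: g[of undefined] keys_def)
      then have "e \<in> keys (b [Some undefined])" using e by simp
      then have "lookup e v < 0 \<Longrightarrow> v = Some undefined"
        using sections_poles[OF sec[of "Some undefined"]] by (auto simp: poles_in_def)
      moreover have "lookup e v < 0 \<Longrightarrow> v = None"
        using twist_poles[of d "\<phi> - \<psi>"] e unfolding gt by (auto simp: poles_in_def)
      ultimately show "0 \<le> lookup e v" by (metis not_le option.distinct(1))
    qed blast
    have "g = twist d (dehomogenize F)"
      by (rule twist_of_cleared[where N = 0]) (simp_all add: F[symmetric] gt twist_hom single_0_one)
    then have "b [None] = twist d (\<phi> - dehomogenize F)" by (simp add: g_def twist_diff algebra_simps)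
    then have eq: "twist d (\<phi> - dehomogenize F) = twist d \<psi>" using \<psi>(2) by simp
    have inj: "inj (laurent_exp d :: ('n \<Rightarrow>\<^sub>0 nat) \<Rightarrow> _)"
      by (rule injI) (metis poly_mapping_eqI lookup_laurent_exp_Some of_nat_eq_iff)
    have "\<phi> - dehomogenize F = \<psi>"
    proof (rule poly_mapping_eqI)
      fix m
      have "lookup (twist d f) (laurent_exp d m) = lookup f m" for f :: "('n, 'k) mpoly"
        unfolding twist_def by (rule lookup_relabel_inj) (rule inj_on_subset[OF inj], simp)
      then show "lookup (\<phi> - dehomogenize F) m = lookup \<psi> m" using eq by metis
    qed
    moreover have "keys (to_laurent F) \<subseteq> {e. mdeg e = d}"
      using twist_hom[of d "\<phi> - \<psi>"] by (auto simp: F[symmetric] gt hom_part_def)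
    ultimately show ?thesis using \<psi>(1) by blast
  qed
  have one: "1 \<notin> J"
  proof
    assume "1 \<in> J"
    then have "lookup (1 :: ('n, 'k) mpoly) 0 = 0" using sub_origin by (auto simp: var_ideal_iff)
    then show False by (simp add: lookup_one)
  qed
  obtain F where F: "keys (to_laurent F) \<subseteq> {e. mdeg e = d}" "1 - dehomogenize F \<in> J" using main by blast
  have "F \<noteq> 0" using F(2) one by auto
  then obtain m where "lookup F m \<noteq> 0" by (metis poly_mapping_eqI lookup_zero)
  then have "intexp m \<in> keys (to_laurent F)" by (simp add: in_keys_iff)
  then have d: "d = int (mdeg m)" using F(1) by auto
  show ?thesis
  proof (rule that[OF d], rule allI)
    fix f
    obtain F where F: "keys (to_laurent F) \<subseteq> {e. mdeg e = d}" "f - dehomogenize F \<in> J" using main by blast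
    then have "F \<in> hom_part (mdeg m)" by (intro to_laurent_hom_part) (auto simp: hom_part_def d)
    then have "dehomogenize F \<in> deg_le (mdeg m)" by (auto simp: deg_le_def dehomogenize_degree)
    then show "\<exists>g\<in>deg_le (mdeg m). f - g \<in> J" using F(2) by blast
  qed
qed

text \<open>Since \<open>\<tau> + 1 - i \<ge> - i\<close>, the condition for \<open>\<tau> + 1\<close> holds in all cohomological degrees, and already
  the condition on \<open>H^1\<close> forces \<open>m - 1 \<ge> \<tau>\<close>.\<close>

lemma regularity_I: "regularity I = int (tau I) + 1"
  unfolding regularity_def
proof (rule Least_equality)
  show "m_regular I (int (tau I) + 1)"
    unfolding m_regular_def
  proof (intro allI impI)
    fix i :: nat assume i: "1 \<le> i"
    show "cohomology_vanishes I (int (tau I) + 1 - int i) i"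
    proof (cases "i = 1")
      case True
      then show ?thesis using cohomology_vanishes_1[OF represented_tau] by simp
    next
      case False
      then show ?thesis using i by (intro cohomology_vanishes_ge_2) auto
    qed
  qed
  fix m assume "m_regular I m"
  then have "cohomology_vanishes I (m - 1) 1" unfolding m_regular_def by force
  then obtain D where D: "m - 1 = int D" "\<forall>f. \<exists>g\<in>deg_le D. f - g \<in> J"
    by (rule represented_if_cohomology_vanishes)
  from tau_le_if_represented[OF spec[OF D(2)]] D(1) show "int (tau I) + 1 \<le> m" by linarith
qed

end

section \<open>Affine and homogeneous inverse systems\<close>

theorem proposition2p11:
  fixes J :: "('n::finite, 'k::field) mpoly set"
    and L' :: "('n, 'k) dpow set"
    and I :: "('n option, 'k) mpoly set"
    and L :: "('n option, 'k) dpow set"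
    and \<alpha> s :: nat
  assumes "is_ideal J" and "concentrated_at_origin J"
    and "\<alpha> = socle_degree J"
    and "L' = perp J"
    and "I = Homog_ideal J"
    and "L = Homog_dp L'"
    and "s = dim_quot UNIV J"
  shows
    "\<comment> \<open>(i)\<close>
     (I = scheme_ideal J \<and> saturated I \<and> primary_ideal I \<and> radical I = point_ideal \<and>
      I \<subseteq> point_ideal \<and> ideal_power point_ideal (\<alpha> + 1) \<subseteq> I \<and>
      (\<forall>a b. a \<le> b \<longrightarrow>
         piece I a = {h \<in> hom_part a. \<forall>g\<in>hom_part (b - a). g * h \<in> piece I b}) \<and>
      (\<forall>a b. \<alpha> + 1 \<le> a \<and> a \<le> b \<longrightarrow>
         piece I b = module.span kscale {g * h | g h. g \<in> hom_part (b - a) \<and> h \<in> piece I a}) \<and>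
      (\<forall>a b. a \<le> b \<longrightarrow>
         piece I a = {h \<in> hom_part a. z_var ^ (b - a) * h \<in> piece I b}) \<and>
      (\<forall>b\<ge>\<alpha>. piece I b =
         z_var ^ (b - \<alpha>) *o piece I \<alpha> + piece (ideal_power point_ideal (\<alpha> + 1)) b))
     \<and> \<comment> \<open>(ii)\<close>
     (L = perp (scheme_ideal J) \<and>
      (\<forall>a b. a \<le> b \<longrightarrow> piece L a = contract (z_var ^ (b - a)) ` piece L b) \<and>
      dp_Z \<subseteq> L \<and> L \<subseteq> dp_subspace_mult (dp_le \<alpha>) dp_Z \<and>
      (\<forall>a b. \<alpha> \<le> a \<and> a \<le> b \<longrightarrow>
         Vector_Spaces.linear kscale kscale (Z_shift a b :: ('n option, 'k) dpow \<Rightarrow> _) \<and>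
         Vector_Spaces.linear kscale kscale (contract (z_var ^ (b - a)) :: ('n option, 'k) dpow \<Rightarrow> _) \<and>
         bij_betw (Z_shift a b) (piece L a) (piece L b) \<and>
         bij_betw (contract (z_var ^ (b - a))) (piece L b) (piece L a) \<and>
         (\<forall>F\<in>piece L a. contract (z_var ^ (b - a)) (Z_shift a b F) = F) \<and>
         (\<forall>G\<in>piece L b. Z_shift a b (contract (z_var ^ (b - a)) G) = G)) \<and>
      (\<forall>a b. \<alpha> \<le> a \<longrightarrow> piece L b = Z_shift a b ` piece L a))
     \<and> \<comment> \<open>(iii)\<close>
     ((\<forall>a b. a \<le> b \<longrightarrow>
         quot_linear I a b (quot_mult I (z_var ^ (b - a))) \<and>
         inj_on (quot_mult I (z_var ^ (b - a))) (quot_piece I a)) \<and>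
      (\<forall>a b. \<alpha> \<le> a \<and> a \<le> b \<longrightarrow>
         bij_betw (quot_mult I (z_var ^ (b - a))) (quot_piece I a) (quot_piece I b)) \<and>
      (\<forall>m>0.
         (m \<le> \<alpha> \<longrightarrow>
            quot_linear I (\<alpha> - m) \<alpha> (quot_mult I (z_var ^ m)) \<and>
            inj_on (quot_mult I (z_var ^ m)) (quot_piece I (\<alpha> - m))) \<and>
         quot_linear I \<alpha> (\<alpha> + m) (quot_mult I (z_var ^ m)) \<and>
         bij_betw (quot_mult I (z_var ^ m)) (quot_piece I \<alpha>) (quot_piece I (\<alpha> + m))))
     \<and> \<comment> \<open>(iv)\<close>
     (Proj_eq_Spec I J \<and> Proj_degree I = s \<and> ideal_power var_ideal s \<subseteq> J \<and>
      regularity (scheme_ideal J) = int (tau (scheme_ideal J)) + 1 \<and>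
      tau (scheme_ideal J) + 1 \<le> \<alpha> + 1 \<and> \<alpha> + 1 \<le> s)
     \<and> \<comment> \<open>(v)\<close>
     (\<forall>(LL :: ('n option, 'k) dpow set) II JJ.
        inverse_system LL \<and> dp_Z \<subseteq> LL \<and> LL \<subseteq> dp_subspace_mult (dp_le \<alpha>) dp_Z \<and>
        II = Ann LL \<and> JJ = dehomogenize ` II \<longrightarrow>
        concentrated_at_origin JJ \<and> socle_degree JJ \<le> \<alpha> \<and>
        ((\<forall>a b. a \<le> b \<longrightarrow> piece LL a = contract (z_var ^ (b - a)) ` piece LL b) \<longrightarrow>
           II = scheme_ideal JJ \<and> LL = perp (scheme_ideal JJ) \<and>
           (\<forall>b\<ge>\<alpha>. dehomogenize ` piece LL b = perp JJ \<and>
                    LL = Homog_dp (dehomogenize ` piece LL b))))"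
proof -
  have J: "is_ideal J" and conc: "concentrated_at_origin J" by fact+
  have prime: "prime_ideal (var_ideal :: ('n, 'k) mpoly set)" and sub: "J \<subseteq> var_ideal"
    using prime_var_ideal_if_concentrated[OF conc] by blast+
  obtain N where N: "ideal_power var_ideal N \<subseteq> J" by (rule nilpotent_if_concentrated[OF conc])
  have "J \<noteq> UNIV" using sub prime by (auto simp: prime_ideal_def)
  note socle = socle_degree[OF N this]
  have nil: "vdeg_ge UNIV (Suc \<alpha>) \<subseteq> J"
    using socle[of "Suc \<alpha>"] assms(3) unfolding var_ideal_power by simp
  interpret fat_point J \<alpha> by unfold_locales (rule J nil sub)+
  have I: "I = forms_ideal J" and scheme: "scheme_ideal J = forms_ideal J"
    using assms(5) by (simp_all add: Homog_ideal_eq[OF J] scheme_ideal_eq[OF J])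
  have L: "L = perp (forms_ideal J)" using assms(4,6) L_eq by simp
  have s: "\<alpha> + 1 \<le> s" using length_ge socle[of \<alpha>] assms(3,7) by simp
  have top: "ideal_power point_ideal (\<alpha> + 1) \<subseteq> I"
    using point_power_sub by (simp only: I point_ideal_power Suc_eq_plus1)
  have power_s: "ideal_power var_ideal s \<subseteq> J" using socle[of s] s assms(3) by simp
  have part_v: "concentrated_at_origin JJ \<and> socle_degree JJ \<le> \<alpha> \<and>
        ((\<forall>a b. a \<le> b \<longrightarrow> piece LL a = contract (z_var ^ (b - a)) ` piece LL b) \<longrightarrow>
           II = scheme_ideal JJ \<and> LL = perp (scheme_ideal JJ) \<and>
           (\<forall>b\<ge>\<alpha>. dehomogenize ` piece LL b = perp JJ \<and>
                    LL = Homog_dp (dehomogenize ` piece LL b)))"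
    if LL: "inverse_system LL" "dp_Z \<subseteq> LL" "LL \<subseteq> dp_subspace_mult (dp_le \<alpha>) dp_Z"
      and II: "II = Ann LL" "JJ = dehomogenize ` II"
    for LL :: "('n option, 'k) dpow set" and II JJ
  proof -
    interpret W: fat_point JJ \<alpha>
      unfolding II by (rule fat_point_of_inverse_system[OF LL])
    have W: "ideal_power var_ideal (Suc \<alpha>) \<subseteq> JJ"
      unfolding var_ideal_power by (rule W.nilpotent)
    have proper: "JJ \<noteq> UNIV" using W.sub_origin prime by (auto simp: prime_ideal_def)
    show ?thesis
    proof (intro conjI impI)
      show "concentrated_at_origin JJ"
        by (rule concentratedI[OF W.ideal_J W W.sub_origin prime])
      show "socle_degree JJ \<le> \<alpha>" using socle_degree[OF W proper] W by (metis less_Suc_eq_le)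
      assume surj: "\<forall>a b. a \<le> b \<longrightarrow> piece LL a = contract (z_var ^ (b - a)) ` piece LL b"
      have "II = forms_ideal JJ"
        unfolding II by (rule Ann_eq_forms_ideal[OF LL(1)]) (use surj in blast)
      moreover from this have "LL = perp (forms_ideal JJ)"
        using perp_Ann[OF LL(1)] by (simp add: II(1))
      ultimately show "II = scheme_ideal JJ" "LL = perp (scheme_ideal JJ)"
        "\<forall>b\<ge>\<alpha>. dehomogenize ` piece LL b = perp JJ \<and> LL = Homog_dp (dehomogenize ` piece LL b)"
        using W.dehomogenize_piece_L W.L_eq by (simp_all add: scheme_ideal_eq[OF W.ideal_J])
    qed
  qed
  show ?thesis
  proof (intro conjI)
    show "I = scheme_ideal J" using I scheme by simp
    show "saturated I" "primary_ideal I" "radical I = point_ideal" "I \<subseteq> point_ideal"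
      unfolding I by (rule saturated_I primary_I radical_I I_sub_point)+
    show "ideal_power point_ideal (\<alpha> + 1) \<subseteq> I" by (rule top)
    show "\<forall>a b. a \<le> b \<longrightarrow> piece I a = {h \<in> hom_part a. \<forall>g\<in>hom_part (b - a). g * h \<in> piece I b}"
      unfolding I using piece_I_quotient_all by blast
    show "\<forall>a b. \<alpha> + 1 \<le> a \<and> a \<le> b \<longrightarrow>
        piece I b = kv.span {g * h | g h. g \<in> hom_part (b - a) \<and> h \<in> piece I a}"
      unfolding I using piece_I_generated by blast
    show "\<forall>a b. a \<le> b \<longrightarrow> piece I a = {h \<in> hom_part a. z_var ^ (b - a) * h \<in> piece I b}"
      unfolding I using piece_I_quotient by blast
    show "\<forall>b\<ge>\<alpha>. piece I b =
        z_var ^ (b - \<alpha>) *o piece I \<alpha> + piece (ideal_power point_ideal (\<alpha> + 1)) b"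
      unfolding I using piece_I_decomposition by blast
    show "L = perp (scheme_ideal J)" using L scheme by simp
    show "\<forall>a b. a \<le> b \<longrightarrow> piece L a = contract (z_var ^ (b - a)) ` piece L b"
      unfolding L using piece_L_contract by blast
    show "dp_Z \<subseteq> L" "L \<subseteq> dp_subspace_mult (dp_le \<alpha>) dp_Z"
      unfolding L by (rule dp_Z_sub_L L_bounded)+
    show "\<forall>a b. \<alpha> \<le> a \<and> a \<le> b \<longrightarrow>
         Vector_Spaces.linear kscale kscale (Z_shift a b :: ('n option, 'k) dpow \<Rightarrow> _) \<and>
         Vector_Spaces.linear kscale kscale (contract (z_var ^ (b - a)) :: ('n option, 'k) dpow \<Rightarrow> _) \<and>
         bij_betw (Z_shift a b) (piece L a) (piece L b) \<and>
         bij_betw (contract (z_var ^ (b - a))) (piece L b) (piece L a) \<and>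
         (\<forall>F\<in>piece L a. contract (z_var ^ (b - a)) (Z_shift a b F) = F) \<and>
         (\<forall>G\<in>piece L b. Z_shift a b (contract (z_var ^ (b - a)) G) = G)"
      unfolding L using linear_Z_shift linear_contract Z_shift_bij Z_shift_inverse by blast
    show "\<forall>a b. \<alpha> \<le> a \<longrightarrow> piece L b = Z_shift a b ` piece L a"
      unfolding L using piece_L_Z_shift by blast
    show "\<forall>a b. a \<le> b \<longrightarrow> quot_linear I a b (quot_mult I (z_var ^ (b - a))) \<and>
        inj_on (quot_mult I (z_var ^ (b - a))) (quot_piece I a)"
      unfolding I using quot_z_linear quot_z_inj by blast
    show "\<forall>a b. \<alpha> \<le> a \<and> a \<le> b \<longrightarrow>
        bij_betw (quot_mult I (z_var ^ (b - a))) (quot_piece I a) (quot_piece I b)"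
      unfolding I using quot_z_bij by blast
    show "\<forall>m>0. (m \<le> \<alpha> \<longrightarrow> quot_linear I (\<alpha> - m) \<alpha> (quot_mult I (z_var ^ m)) \<and>
          inj_on (quot_mult I (z_var ^ m)) (quot_piece I (\<alpha> - m))) \<and>
        quot_linear I \<alpha> (\<alpha> + m) (quot_mult I (z_var ^ m)) \<and>
        bij_betw (quot_mult I (z_var ^ m)) (quot_piece I \<alpha>) (quot_piece I (\<alpha> + m))"
    proof (intro allI impI conjI)
      fix m :: nat
      show "quot_linear I (\<alpha> - m) \<alpha> (quot_mult I (z_var ^ m))" if "m \<le> \<alpha>"
        unfolding I using quot_z_linear[of "\<alpha> - m" \<alpha>] that by simp
      show "inj_on (quot_mult I (z_var ^ m)) (quot_piece I (\<alpha> - m))"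
        unfolding I by (rule quot_z_inj)
      show "quot_linear I \<alpha> (\<alpha> + m) (quot_mult I (z_var ^ m))"
        unfolding I using quot_z_linear[of \<alpha> "\<alpha> + m"] by simp
      show "bij_betw (quot_mult I (z_var ^ m)) (quot_piece I \<alpha>) (quot_piece I (\<alpha> + m))"
        unfolding I using quot_z_bij[of \<alpha> "\<alpha> + m"] by simp
    qed
    show "Proj_eq_Spec I J" unfolding I by (rule Proj_eq_Spec_I)
    show "Proj_degree I = s" unfolding I assms(7) by (rule Proj_degree_I)
    show "ideal_power var_ideal s \<subseteq> J" by (rule power_s)
    show "regularity (scheme_ideal J) = int (tau (scheme_ideal J)) + 1"
      unfolding scheme by (rule regularity_I)
    show "tau (scheme_ideal J) + 1 \<le> \<alpha> + 1" unfolding scheme using tau_le by simp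
    show "\<alpha> + 1 \<le> s" by (rule s)
  qed (intro allI impI, elim conjE, rule part_v)
qed

end
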